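(* Let $\bar\nu\in\mathbb{C}^n/Q$ and let $\bar\mu\in\mathbb{C}^n/P$ be the image of $\bar\nu$ under the natural projection $\mathbb{C}^n/Q\to\mathbb{C}^n/P$. The functors $$\operatorname{Ind}:(\mathcal{F}_n^{ev})^{\bar\nu}\to\mathcal{F}_n^{\bar\mu},\quad \operatorname{Ind}(M)=\mathcal{A}_n\otimes_{\mathcal{A}_n^{ev}}M,\qquad \operatorname{Res}:\mathcal{F}_n^{\bar\mu}\to(\mathcal{F}_n^{ev})^{\bar\nu},\quad \operatorname{Res}(N)=\bigoplus_{\gamma\in\bar\nu}N^{\gamma},$$ establish an equivalence of the categories $(\mathcal{F}_n^{ev})^{\bar\nu}$ and $\mathcal{F}_n^{\bar\mu}$.
   Context: The ground field is $\mathbb{C}$. $\mathcal{A}_n$ is the Weyl algebra of polynomial differential operators on $\mathbb{A}^n$ with standard generators $t_1,\dots,t_n,\partial_1,\dots,\partial_n$. The adjoint action of $t_1\partial_1,\dots,t_n\partial_n$ gives a grading $\mathcal{A}_n=\bigoplus_{\alpha\in P}\mathcal{A}_n^{\alpha}$ with $P=\mathbb{Z}^n\subset\mathbb{C}^n$. $Q\subset P$ is the index-2 sublattice of all $(\mu_1,\dots,\mu_n)$ with $\mu_1+\cdots+\mu_n\in2\mathbb{Z}$, and $\mathcal{A}_n^{ev}=\bigoplus_{\alpha\in Q}\mathcal{A}_n^{\alpha}$ (a subalgebra of $\mathcal{A}_n$; modules are taken over associative algebras). A module $M$ over $\mathcal{A}_n$ or $\mathcal{A}_n^{ev}$ is a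 weight module if $M=\bigoplus_{\mu\in\mathbb{C}^n}M^{\mu}$, $M^{\mu}=\{m: t_i\partial_i(m)=\mu_i m\ \forall i\}$; $\operatorname{supp}M=\{\mu: M^\mu\ne0\}$. $\mathcal{F}_n$ (resp. $\mathcal{F}_n^{ev}$) is the category of weight $\mathcal{A}_n$-modules (resp. $\mathcal{A}_n^{ev}$-modules) with finite weight multiplicities. $\mathcal{F}_n^{\bar\mu}$, for a coset $\bar\mu\in\mathbb{C}^n/P$, is the subcategory of modules in $\mathcal{F}_n$ with support in $\bar\mu$; $(\mathcal{F}_n^{ev})^{\bar\nu}$, for a coset $\bar\nu\in\mathbb{C}^n/Q$, is the subcategory of modules in $\mathcal{F}_n^{ev}$ with support in $\bar\nu$. *)

theory Defs
  imports
    "HOL-Algebra.Module"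
    "HOL-Algebra.Generated_Groups"
    "HOL-Algebra.Free_Abelian_Groups"
    "HOL-Library.Poly_Mapping"
    "HOL-Analysis.Finite_Cartesian_Product"
begin

text \<open>
  Arrows are indexed by their source and target, so an arrow need not determine its endpoints.
  \<open>Cmp C X Y Z g f\<close> is the composite of \<open>f : X \<rightarrow> Y\<close> and \<open>g : Y \<rightarrow> Z\<close>.
\<close>

record ('o, 'a) cat =
  Ob :: "'o set"
  Hom :: "'o \<Rightarrow> 'o \<Rightarrow> 'a set"
  Idn :: "'o \<Rightarrow> 'a"
  Cmp :: "'o \<Rightarrow> 'o \<Rightarrow> 'o \<Rightarrow> 'a \<Rightarrow> 'a \<Rightarrow> 'a"

definition is_category :: "('o, 'a) cat \<Rightarrow> bool" where
  "is_category C \<longleftrightarrow>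
     (\<forall>X\<in>Ob C. Idn C X \<in> Hom C X X) \<and>
     (\<forall>X\<in>Ob C. \<forall>Y\<in>Ob C. \<forall>Z\<in>Ob C. \<forall>f\<in>Hom C X Y. \<forall>g\<in>Hom C Y Z.
        Cmp C X Y Z g f \<in> Hom C X Z) \<and>
     (\<forall>X\<in>Ob C. \<forall>Y\<in>Ob C. \<forall>f\<in>Hom C X Y.
        Cmp C X X Y f (Idn C X) = f \<and> Cmp C X Y Y (Idn C Y) f = f) \<and>
     (\<forall>W\<in>Ob C. \<forall>X\<in>Ob C. \<forall>Y\<in>Ob C. \<forall>Z\<in>Ob C.
        \<forall>f\<in>Hom C W X. \<forall>g\<in>Hom C X Y. \<forall>h\<in>Hom C Y Z.
          Cmp C W Y Z h (Cmp C W X Y g f) = Cmp C W X Z (Cmp C X Y Z h g) f)"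

definition is_iso_arrow :: "('o, 'a) cat \<Rightarrow> 'o \<Rightarrow> 'o \<Rightarrow> 'a \<Rightarrow> bool" where
  "is_iso_arrow C X Y f \<longleftrightarrow>
     f \<in> Hom C X Y \<and>
     (\<exists>g\<in>Hom C Y X. Cmp C X Y X g f = Idn C X \<and> Cmp C Y X Y f g = Idn C Y)"

record ('o, 'a, 'p, 'b) func =
  FOb :: "'o \<Rightarrow> 'p"
  FArr :: "'o \<Rightarrow> 'o \<Rightarrow> 'a \<Rightarrow> 'b"

definition is_functor ::
    "('o, 'a) cat \<Rightarrow> ('p, 'b) cat \<Rightarrow> ('o, 'a, 'p, 'b) func \<Rightarrow> bool" where
  "is_functor C D F \<longleftrightarrow>
     (\<forall>X\<in>Ob C. FOb F X \<in> Ob D) \<and>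
     (\<forall>X\<in>Ob C. \<forall>Y\<in>Ob C. \<forall>f\<in>Hom C X Y. FArr F X Y f \<in> Hom D (FOb F X) (FOb F Y)) \<and>
     (\<forall>X\<in>Ob C. FArr F X X (Idn C X) = Idn D (FOb F X)) \<and>
     (\<forall>X\<in>Ob C. \<forall>Y\<in>Ob C. \<forall>Z\<in>Ob C. \<forall>f\<in>Hom C X Y. \<forall>g\<in>Hom C Y Z.
        FArr F X Z (Cmp C X Y Z g f)
          = Cmp D (FOb F X) (FOb F Y) (FOb F Z) (FArr F Y Z g) (FArr F X Y f))"

definition id_func :: "('o, 'a, 'o, 'a) func" where
  "id_func = \<lparr>FOb = (\<lambda>X. X), FArr = (\<lambda>X Y f. f)\<rparr>"

definition comp_func ::
    "('p, 'b, 'q, 'c) func \<Rightarrow> ('o, 'a, 'p, 'b) func \<Rightarrow> ('o, 'a, 'q, 'c) func" where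
  "comp_func G F =
     \<lparr>FOb = (\<lambda>X. FOb G (FOb F X)),
      FArr = (\<lambda>X Y f. FArr G (FOb F X) (FOb F Y) (FArr F X Y f))\<rparr>"

definition naturally_isomorphic ::
    "('o, 'a) cat \<Rightarrow> ('p, 'b) cat \<Rightarrow> ('o, 'a, 'p, 'b) func \<Rightarrow> ('o, 'a, 'p, 'b) func \<Rightarrow> bool" where
  "naturally_isomorphic C D F G \<longleftrightarrow>
     (\<exists>\<eta>. (\<forall>X\<in>Ob C. is_iso_arrow D (FOb F X) (FOb G X) (\<eta> X)) \<and>
          (\<forall>X\<in>Ob C. \<forall>Y\<in>Ob C. \<forall>f\<in>Hom C X Y.
             Cmp D (FOb F X) (FOb F Y) (FOb G Y) (\<eta> Y) (FArr F X Y f)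
               = Cmp D (FOb F X) (FOb G X) (FOb G Y) (FArr G X Y f) (\<eta> X)))"

definition establish_equivalence ::
    "('o, 'a) cat \<Rightarrow> ('p, 'b) cat \<Rightarrow> ('o, 'a, 'p, 'b) func \<Rightarrow> ('p, 'b, 'o, 'a) func \<Rightarrow> bool" where
  "establish_equivalence C D F G \<longleftrightarrow>
     is_category C \<and> is_category D \<and> is_functor C D F \<and> is_functor D C G \<and>
     naturally_isomorphic C C id_func (comp_func G F) \<and>
     naturally_isomorphic D D (comp_func F G) id_func"

text \<open>
  The library locale \<open>module\<close> requires a commutative ring; this is the same locale with \<open>ring\<close>
  in place of \<open>cring\<close>, on the library's record of modules. The fields \<open>mult\<close> and \<open>one\<close> which that
  record inherits from rings are never used for modules.
\<close>

locale left_module = R?: ring R + M?: abelian_group M for R (structure) and M (structure) +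
  assumes smult_closed:
      "\<lbrakk>a \<in> carrier R; x \<in> carrier M\<rbrakk> \<Longrightarrow> a \<odot>\<^bsub>M\<^esub> x \<in> carrier M"
    and smult_l_distr:
      "\<lbrakk>a \<in> carrier R; b \<in> carrier R; x \<in> carrier M\<rbrakk> \<Longrightarrow>
        (a \<oplus> b) \<odot>\<^bsub>M\<^esub> x = a \<odot>\<^bsub>M\<^esub> x \<oplus>\<^bsub>M\<^esub> b \<odot>\<^bsub>M\<^esub> x"
    and smult_r_distr:
      "\<lbrakk>a \<in> carrier R; x \<in> carrier M; y \<in> carrier M\<rbrakk> \<Longrightarrow>
        a \<odot>\<^bsub>M\<^esub> (x \<oplus>\<^bsub>M\<^esub> y) = a \<odot>\<^bsub>M\<^esub> x \<oplus>\<^bsub>M\<^esub> a \<odot>\<^bsub>M\<^esub> y"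
    and smult_assoc:
      "\<lbrakk>a \<in> carrier R; b \<in> carrier R; x \<in> carrier M\<rbrakk> \<Longrightarrow>
        (a \<otimes> b) \<odot>\<^bsub>M\<^esub> x = a \<odot>\<^bsub>M\<^esub> (b \<odot>\<^bsub>M\<^esub> x)"
    and smult_one:
      "x \<in> carrier M \<Longrightarrow> \<one> \<odot>\<^bsub>M\<^esub> x = x"

text \<open>
  Homomorphisms are extensional functions (\<open>undefined\<close> off the source), so that equality of arrows
  is equality of maps on the source.
\<close>

definition module_hom ::
    "('r, 'c) ring_scheme \<Rightarrow> ('r, 'm) module \<Rightarrow> ('r, 'k) module \<Rightarrow> ('m \<Rightarrow> 'k) set" where
  "module_hom R M N =
     {f \<in> carrier M \<rightarrow>\<^sub>E carrier N.
        (\<forall>x\<in>carrier M. \<forall>y\<in>carrier M. f (x \<oplus>\<^bsub>M\<^esub> y) = f x \<oplus>\<^bsub>N\<^esub> f y) \<and>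
        (\<forall>a\<in>carrier R. \<forall>x\<in>carrier M. f (a \<odot>\<^bsub>M\<^esub> x) = a \<odot>\<^bsub>N\<^esub> f x)}"

definition module_category ::
    "('r, 'c) ring_scheme \<Rightarrow> ('r, 'u) module set \<Rightarrow> (('r, 'u) module, 'u \<Rightarrow> 'u) cat" where
  "module_category R S =
     \<lparr>Ob = S,
      Hom = module_hom R,
      Idn = (\<lambda>M. \<lambda>x\<in>carrier M. x),
      Cmp = (\<lambda>L M N g f. compose (carrier L) g f)\<rparr>"

definition finite_families :: "('b, 'c) ring_scheme \<Rightarrow> 'i set \<Rightarrow> ('i \<Rightarrow> 'b set) \<Rightarrow> ('i \<Rightarrow> 'b) set" where
  "finite_families G I V = {x \<in> Pi\<^sub>E I V. finite {i\<in>I. x i \<noteq> \<zero>\<^bsub>G\<^esub>}}"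

definition family_sum :: "('b, 'c) ring_scheme \<Rightarrow> 'i set \<Rightarrow> ('i \<Rightarrow> 'b) \<Rightarrow> 'b" where
  "family_sum G I x = finsum G x {i\<in>I. x i \<noteq> \<zero>\<^bsub>G\<^esub>}"

definition sum_of_subgroups :: "('b, 'c) ring_scheme \<Rightarrow> 'i set \<Rightarrow> ('i \<Rightarrow> 'b set) \<Rightarrow> 'b set" where
  "sum_of_subgroups G I V = family_sum G I ` finite_families G I V"

definition is_direct_sum :: "('b, 'c) ring_scheme \<Rightarrow> 'i set \<Rightarrow> ('i \<Rightarrow> 'b set) \<Rightarrow> bool" where
  "is_direct_sum G I V \<longleftrightarrow> bij_betw (family_sum G I) (finite_families G I V) (carrier G)"

text \<open>
  The finite type \<open>'n\<close> indexes the variables, so \<open>n = CARD('n)\<close>. A polynomial is a finitely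
  supported map from exponent vectors to coefficients.
\<close>

type_synonym 'n cpoly = "('n \<Rightarrow>\<^sub>0 nat) \<Rightarrow>\<^sub>0 complex"
type_synonym 'n oper = "'n cpoly \<Rightarrow> 'n cpoly"

definition scal :: "complex \<Rightarrow> 'n oper" where
  "scal c p = Poly_Mapping.single 0 c * p"

definition tvar :: "'n \<Rightarrow> 'n oper" where
  "tvar i p = Poly_Mapping.single (Poly_Mapping.single i 1) 1 * p"

text \<open>
  When \<open>i\<close> does not occur in the monomial \<open>a\<close>, the truncated exponent \<open>a - single i 1\<close> is harmless:
  the coefficient vanishes.
\<close>

definition pdiff :: "'n \<Rightarrow> 'n oper" where
  "pdiff i p =
     (\<Sum>a\<in>Poly_Mapping.keys p.
        Poly_Mapping.single (a - Poly_Mapping.single i 1)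
          (of_nat (Poly_Mapping.lookup a i) * Poly_Mapping.lookup p a))"

definition euler :: "'n \<Rightarrow> 'n oper" where
  "euler i = tvar i \<circ> pdiff i"

inductive_set weyl_carrier :: "'n oper set" where
  scal: "scal c \<in> weyl_carrier"
| tvar: "tvar i \<in> weyl_carrier"
| pdiff: "pdiff i \<in> weyl_carrier"
| add: "a \<in> weyl_carrier \<Longrightarrow> b \<in> weyl_carrier \<Longrightarrow> (\<lambda>p. a p + b p) \<in> weyl_carrier"
| comp: "a \<in> weyl_carrier \<Longrightarrow> b \<in> weyl_carrier \<Longrightarrow> a \<circ> b \<in> weyl_carrier"

definition Weyl :: "'n oper ring" where
  "Weyl =
     \<lparr>carrier = weyl_carrier,
      mult = (\<lambda>a b. a \<circ> b),
      one = (\<lambda>p. p),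
      ring.zero = (\<lambda>p. 0),
      add = (\<lambda>a b p. a p + b p)\<rparr>"

definition P_lattice :: "(complex ^ 'n::finite) set" where
  "P_lattice = {\<mu>. \<forall>i. \<mu> $ i \<in> \<int>}"

definition Q_lattice :: "(complex ^ 'n::finite) set" where
  "Q_lattice = {\<mu> \<in> P_lattice. \<exists>k::int. (\<Sum>i\<in>UNIV. \<mu> $ i) = of_int (2 * k)}"

definition weyl_degree :: "complex ^ 'n::finite \<Rightarrow> 'n oper set" where
  "weyl_degree \<alpha> =
     {a \<in> carrier Weyl. \<forall>i. (\<lambda>p. euler i (a p) - a (euler i p)) = scal (\<alpha> $ i) \<circ> a}"

definition Weyl_ev :: "('n::finite) oper ring" where
  "Weyl_ev = Weyl\<lparr>carrier := sum_of_subgroups Weyl Q_lattice weyl_degree\<rparr>"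

definition weight_space :: "(('n::finite) oper, 'u) module \<Rightarrow> complex ^ 'n \<Rightarrow> 'u set" where
  "weight_space M \<mu> = {m \<in> carrier M. \<forall>i. euler i \<odot>\<^bsub>M\<^esub> m = scal (\<mu> $ i) \<odot>\<^bsub>M\<^esub> m}"

definition supp :: "(('n::finite) oper, 'u) module \<Rightarrow> (complex ^ 'n) set" where
  "supp M = {\<mu>. weight_space M \<mu> \<noteq> {\<zero>\<^bsub>M\<^esub>}}"

definition is_weight_module :: "(('n::finite) oper, 'u) module \<Rightarrow> bool" where
  "is_weight_module M \<longleftrightarrow> is_direct_sum M UNIV (weight_space M)"

definition finite_dimensional :: "(('n::finite) oper, 'u) module \<Rightarrow> 'u set \<Rightarrow> bool" where
  "finite_dimensional M V \<longleftrightarrow>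
     (\<exists>B. finite B \<and> B \<subseteq> V \<and> (\<forall>v\<in>V. \<exists>c. v = (\<Oplus>\<^bsub>M\<^esub>b\<in>B. scal (c b) \<odot>\<^bsub>M\<^esub> b)))"

text \<open>
  The objects of the two categories are the modules whose carrier is a subset of an arbitrary
  type \<open>'u\<close>, which plays the role of the universe.
\<close>

definition weight_modules :: "('n::finite) oper ring \<Rightarrow> ('n oper, 'u) module set" where
  "weight_modules R =
     {M. left_module R M \<and> is_weight_module M \<and>
         (\<forall>\<mu>. finite_dimensional M (weight_space M \<mu>))}"

definition F_cat :: "(complex ^ 'n::finite) set \<Rightarrow> (('n oper, 'u) module, 'u \<Rightarrow> 'u) cat" where
  "F_cat mubar = module_category Weyl {M \<in> weight_modules Weyl. supp M \<subseteq> mubar}"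

definition Fev_cat :: "(complex ^ 'n::finite) set \<Rightarrow> (('n oper, 'u) module, 'u \<Rightarrow> 'u) cat" where
  "Fev_cat nubar = module_category Weyl_ev {M \<in> weight_modules Weyl_ev. supp M \<subseteq> nubar}"

definition congruent_mod :: "(complex ^ 'n::finite) set \<Rightarrow> ((complex ^ 'n) \<times> (complex ^ 'n)) set" where
  "congruent_mod L = {(x, y). y - x \<in> L}"

definition coset_space :: "(complex ^ 'n::finite) set \<Rightarrow> (complex ^ 'n) set set" where
  "coset_space L = UNIV // congruent_mod L"

definition coset_projection :: "(complex ^ 'n::finite) set \<Rightarrow> (complex ^ 'n) set" where
  "coset_projection nubar = congruent_mod P_lattice `` nubar"

text \<open>
  For rings \<open>R \<subseteq> S\<close> with the same operations, \<open>S \<otimes>\<^sub>R M\<close> is the quotient of the free abelian group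
  on \<open>S \<times> M\<close> by the usual relations; its elements are cosets.
\<close>

definition tensor_relations ::
    "('r, 'c) ring_scheme \<Rightarrow> ('r, 'd) ring_scheme \<Rightarrow> ('r, 'm) module \<Rightarrow> ('r \<times> 'm \<Rightarrow>\<^sub>0 int) set" where
  "tensor_relations S R M =
     {frag_of (a \<oplus>\<^bsub>S\<^esub> b, x) - frag_of (a, x) - frag_of (b, x) | a b x.
        a \<in> carrier S \<and> b \<in> carrier S \<and> x \<in> carrier M} \<union>
     {frag_of (a, x \<oplus>\<^bsub>M\<^esub> y) - frag_of (a, x) - frag_of (a, y) | a x y.
        a \<in> carrier S \<and> x \<in> carrier M \<and> y \<in> carrier M} \<union>
     {frag_of (a \<otimes>\<^bsub>S\<^esub> r, x) - frag_of (a, r \<odot>\<^bsub>M\<^esub> x) | a r x.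
        a \<in> carrier S \<and> r \<in> carrier R \<and> x \<in> carrier M}"

definition tensor_free ::
    "('r, 'c) ring_scheme \<Rightarrow> ('r, 'm) module \<Rightarrow> ('r \<times> 'm \<Rightarrow>\<^sub>0 int) monoid" where
  "tensor_free S M = free_Abelian_group (carrier S \<times> carrier M)"

definition tensor_null ::
    "('r, 'c) ring_scheme \<Rightarrow> ('r, 'd) ring_scheme \<Rightarrow> ('r, 'm) module \<Rightarrow> ('r \<times> 'm \<Rightarrow>\<^sub>0 int) set" where
  "tensor_null S R M = generate (tensor_free S M) (tensor_relations S R M)"

text \<open>
  A map of free generators, extended additively, induces the map on cosets
  \<open>X \<mapsto> \<Union>x\<in>X. N + h x\<close> where \<open>N\<close> is the subgroup of relations of the target.
\<close>

definition tensor ::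
    "('r, 'c) ring_scheme \<Rightarrow> ('r, 'd) ring_scheme \<Rightarrow> ('r, 'm) module \<Rightarrow>
       ('r, ('r \<times> 'm \<Rightarrow>\<^sub>0 int) set) module" where
  "tensor S R M =
     (let F = tensor_free S M; N = tensor_null S R M in
      \<lparr>carrier = carrier (F Mod N),
       mult = (\<lambda>_ _. undefined),
       one = undefined,
       ring.zero = one (F Mod N),
       add = monoid.mult (F Mod N),
       smult = (\<lambda>a X. \<Union>x\<in>X. N #>\<^bsub>F\<^esub> frag_extend (\<lambda>(b, m). frag_of (a \<otimes>\<^bsub>S\<^esub> b, m)) x)\<rparr>)"

definition tensor_map ::
    "('r, 'c) ring_scheme \<Rightarrow> ('r, 'd) ring_scheme \<Rightarrow> ('r, 'm) module \<Rightarrow> ('r, 'k) module \<Rightarrow>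
       ('m \<Rightarrow> 'k) \<Rightarrow> ('r \<times> 'm \<Rightarrow>\<^sub>0 int) set \<Rightarrow> ('r \<times> 'k \<Rightarrow>\<^sub>0 int) set" where
  "tensor_map S R M M' f X =
     (\<Union>x\<in>X. tensor_null S R M' #>\<^bsub>tensor_free S M'\<^esub>
        frag_extend (\<lambda>(b, m). frag_of (b, f m)) x)"

text \<open>
  The tensor product is not a module on the universe \<open>'u\<close>, so \<open>Ind M\<close> is its copy along a chosen
  injection of its carrier into \<open>'u\<close>. Such an injection exists for every object \<open>M\<close>: if \<open>M\<close> is zero,
  so is the tensor product; otherwise \<open>M\<close> contains a copy of the complex numbers, the Weyl algebra
  has the cardinality of the continuum, and hence the free abelian group on pairs \<open>(a, m)\<close> is
  equipotent to \<open>M\<close>.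
\<close>

definition transport_module :: "('m \<Rightarrow> 'u) \<Rightarrow> ('r, 'm) module \<Rightarrow> ('r, 'u) module" where
  "transport_module e M =
     (let d = inv_into (carrier M) e in
      \<lparr>carrier = e ` carrier M,
       mult = (\<lambda>_ _. undefined),
       one = undefined,
       ring.zero = e \<zero>\<^bsub>M\<^esub>,
       add = (\<lambda>x y. e (d x \<oplus>\<^bsub>M\<^esub> d y)),
       smult = (\<lambda>a x. e (a \<odot>\<^bsub>M\<^esub> d x))\<rparr>)"

definition Ind_embedding ::
    "(('n::finite) oper, 'u) module \<Rightarrow> ('n oper \<times> 'u \<Rightarrow>\<^sub>0 int) set \<Rightarrow> 'u" where
  "Ind_embedding M = (SOME e. inj_on e (carrier (tensor Weyl Weyl_ev M)))"

definition Ind ::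
    "(('n::finite oper, 'u) module, 'u \<Rightarrow> 'u, ('n oper, 'u) module, 'u \<Rightarrow> 'u) func" where
  "Ind =
     \<lparr>FOb = (\<lambda>M. transport_module (Ind_embedding M) (tensor Weyl Weyl_ev M)),
      FArr = (\<lambda>M M' f.
        \<lambda>x\<in>Ind_embedding M ` carrier (tensor Weyl Weyl_ev M).
          Ind_embedding M' (tensor_map Weyl Weyl_ev M M' f
            (inv_into (carrier (tensor Weyl Weyl_ev M)) (Ind_embedding M) x)))\<rparr>"

definition Res_carrier :: "(complex ^ 'n::finite) set \<Rightarrow> ('n oper, 'u) module \<Rightarrow> 'u set" where
  "Res_carrier nubar N = sum_of_subgroups N nubar (weight_space N)"

definition Res ::
    "(complex ^ 'n::finite) set \<Rightarrow>
       (('n oper, 'u) module, 'u \<Rightarrow> 'u, ('n oper, 'u) module, 'u \<Rightarrow> 'u) func" where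
  "Res nubar =
     \<lparr>FOb = (\<lambda>N. N\<lparr>carrier := Res_carrier nubar N\<rparr>),
      FArr = (\<lambda>N N' f. restrict f (Res_carrier nubar N))\<rparr>"

end

theory Submission
  imports Defs "HOL-Algebra.Subrings"
begin

text \<open>
  The Weyl algebra splits by parity of the total degree into even and odd operators, and this
  \<open>\<int>/2\<close>-grading is strong: the relation \<open>\<partial>\<^sub>i t\<^sub>i - t\<^sub>i \<partial>\<^sub>i = 1\<close> writes the identity as a sum of products
  of two odd operators. For a strongly graded ring, induction from the degree zero part is an
  equivalence onto graded modules whose inverse is the degree zero part. A weight module with
  support in a coset of \<open>P\<close> carries such a grading for free: its weights lie in \<open>nubar\<close> or in the
  rest of the coset, and an odd operator exchanges the two.

  In detail, every odd operator \<open>a\<close> equals \<open>\<partial>\<^sub>i (t\<^sub>i a) - t\<^sub>i (\<partial>\<^sub>i a)\<close> with even factors in parentheses.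
  Hence each element of the induced module has the form \<open>1 \<otimes> m\<^sub>0 + \<partial>\<^sub>i \<otimes> m\<^sub>1 + t\<^sub>i \<otimes> m\<^sub>2\<close>
  (\<open>tensor_generation\<close>). This single formula carries most of the argument: it bounds the
  cardinality of the tensor product, so that the latter embeds into the universe
  (\<open>Ind_embedding_inj\<close>); it gives the weights and the finite multiplicities of the induced module;
  and it shows that maps out of the induced module are determined on \<open>1 \<otimes> M\<close>.

  The unit \<open>m \<mapsto> 1 \<otimes> m\<close> is injective because \<open>a \<otimes> m \<mapsto> even_part a \<cdot> m\<close> is a well-defined left inverse,
  and it is onto the part of the induced module with weights in \<open>nubar\<close> because weight spaces for
  distinct weights are independent. The counit \<open>a \<otimes> n \<mapsto> a \<cdot> n\<close> is bijective by the same splitting of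
  \<open>1\<close>: each \<open>n\<close> of odd weight is \<open>\<partial>\<^sub>i (t\<^sub>i n) - t\<^sub>i (\<partial>\<^sub>i n)\<close>, and a kernel element is annihilated by both
  \<open>t\<^sub>i\<close> and \<open>\<partial>\<^sub>i\<close>, hence zero (\<open>counit_bij\<close>).

  Two devices keep the formal argument short. The even subalgebra, defined through the grading by
  \<open>Q\<close>, is recognised as the set of operators commuting with the substitution \<open>t \<mapsto> -t\<close>
  (\<open>weyl_even_graded\<close>). And \<open>Res_carrier T M\<close>, the sum of the weight spaces with weights in
  \<open>T\<close>, is used for arbitrary \<open>T\<close>: being a weight module with support in \<open>T\<close> then just means that
  \<open>Res_carrier T M\<close> is everything (\<open>weight_module_iff\<close>).
\<close>

section \<open>The generators acting on monomials\<close>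


lemma lookup_single_mult:
  "Poly_Mapping.lookup (Poly_Mapping.single a c * p) k =
     (c::complex) * Sum_any (\<lambda>q. Poly_Mapping.lookup p q when k = a + q)"
proof -
  have "Poly_Mapping.lookup (Poly_Mapping.single a c * p) k =
      Sum_any (\<lambda>l. c * Sum_any (\<lambda>q. Poly_Mapping.lookup p q when k = l + q) when l = a)"
    unfolding lookup_mult
    by (rule Sum_any.cong) (auto simp: lookup_single when_def)
  then show ?thesis by simp
qed

lemma lookup_scal: "Poly_Mapping.lookup (scal c p) k = c * Poly_Mapping.lookup p k"
  by (simp add: scal_def lookup_single_mult)

abbreviation unit_exp :: "'n \<Rightarrow> 'n \<Rightarrow>\<^sub>0 nat" where
  "unit_exp i \<equiv> Poly_Mapping.single i 1"

lemma exp_plus_minus_unit: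
  "Poly_Mapping.lookup k i > 0 \<Longrightarrow> unit_exp i + (k - unit_exp i) = k"
  by (rule poly_mapping_eqI) (auto simp: lookup_add lookup_minus lookup_single when_def)

lemma lookup_tvar:
  "Poly_Mapping.lookup (tvar i p) k =
     (if Poly_Mapping.lookup k i > 0 then Poly_Mapping.lookup p (k - unit_exp i) else 0)"
proof (cases "Poly_Mapping.lookup k i > 0")
  case True
  have "k = unit_exp i + q \<longleftrightarrow> q = k - unit_exp i" for q
    using exp_plus_minus_unit[OF True] by auto
  then show ?thesis using True by (simp add: tvar_def lookup_single_mult)
next
  case False
  then have "k \<noteq> unit_exp i + q" for q
    by (auto simp: lookup_add)
  then show ?thesis using False by (simp add: tvar_def lookup_single_mult)
qed

lemma lookup_pdiff:
  "Poly_Mapping.lookup (pdiff i p) k =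
     of_nat (Poly_Mapping.lookup k i + 1) * Poly_Mapping.lookup p (k + unit_exp i)"
proof -
  have "Poly_Mapping.lookup (pdiff i p) k =
     (\<Sum>a\<in>Poly_Mapping.keys p. of_nat (Poly_Mapping.lookup a i) * Poly_Mapping.lookup p a
         when a - unit_exp i = k)"
    by (simp add: pdiff_def lookup_sum lookup_single)
  also have "\<dots> = (\<Sum>a\<in>Poly_Mapping.keys p.
      if a = k + unit_exp i then of_nat (Poly_Mapping.lookup a i) * Poly_Mapping.lookup p a else 0)"
  proof (rule sum.cong[OF refl])
    fix a
    show "(of_nat (Poly_Mapping.lookup a i) * Poly_Mapping.lookup p a when a - unit_exp i = k) =
      (if a = k + unit_exp i then of_nat (Poly_Mapping.lookup a i) * Poly_Mapping.lookup p a else 0)"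
    \<comment> \<open>A monomial without the \<open>i\<close>-th variable has a truncated exponent, but then its term vanishes.\<close>
    proof (cases "Poly_Mapping.lookup a i > 0")
      case True
      then have "a - unit_exp i = k \<longleftrightarrow> a = k + unit_exp i"
        using exp_plus_minus_unit[OF True] by (auto simp: add.commute)
      then show ?thesis by (auto simp: when_def)
    qed (auto simp: when_def)
  qed
  also have "\<dots> = of_nat (Poly_Mapping.lookup k i + 1) * Poly_Mapping.lookup p (k + unit_exp i)"
    by (subst sum.delta) (auto simp: in_keys_iff lookup_add)
  finally show ?thesis .
qed

lemma lookup_euler:
  "Poly_Mapping.lookup (euler i p) k = of_nat (Poly_Mapping.lookup k i) * Poly_Mapping.lookup p k"
  using exp_plus_minus_unit[of k i]
  by (auto simp: euler_def lookup_tvar lookup_pdiff lookup_minus add.commute simp del: of_nat_Suc)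

lemma canonical_commutation:
  "pdiff i (tvar i p) - tvar i (pdiff i p) = p"
  using exp_plus_minus_unit[of _ i]
  by (intro poly_mapping_eqI)
    (auto simp: lookup_minus lookup_tvar lookup_pdiff lookup_add add.commute algebra_simps)

section \<open>The parity reflection\<close>

definition parity_sign :: "('n::finite \<Rightarrow>\<^sub>0 nat) \<Rightarrow> complex" where
  "parity_sign k = (-1) ^ (\<Sum>i\<in>UNIV. Poly_Mapping.lookup k i)"

text \<open>
  The substitution \<open>t \<mapsto> -t\<close> on polynomials. Conjugation by it is the automorphism of the Weyl
  algebra that negates every generator \<open>t\<^sub>i\<close> and \<open>\<partial>\<^sub>i\<close>, so parity of operators can be tested
  without mentioning degrees.
\<close>

definition reflect :: "('n::finite) oper" where
  "reflect p = Poly_Mapping.mapp (\<lambda>k c. parity_sign k * c) p"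

lemma lookup_reflect:
  "Poly_Mapping.lookup (reflect p) k = parity_sign k * Poly_Mapping.lookup p k"
  by (simp add: reflect_def lookup_mapp when_def in_keys_iff)

lemma parity_sign_square [simp]: "parity_sign k * parity_sign k = 1"
  by (simp add: parity_sign_def flip: power_add mult_2)

lemma parity_sign_square' [simp]: "parity_sign k * (parity_sign k * c) = c"
  by (simp flip: mult.assoc)

lemma parity_sign_add: "parity_sign (k + l) = parity_sign k * parity_sign l"
  by (simp add: parity_sign_def lookup_add sum.distrib power_add)

lemma parity_sign_unit_exp: "parity_sign (Poly_Mapping.single i (Suc 0)) = -1"
  by (simp add: parity_sign_def lookup_single when_def)

lemma reflect_reflect [simp]: "reflect (reflect p) = p"
  by (rule poly_mapping_eqI) (simp add: lookup_reflect)

lemma reflect_add: "reflect (p + q) = reflect p + reflect q"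
  by (rule poly_mapping_eqI) (simp add: lookup_reflect lookup_add algebra_simps)

lemma reflect_scal: "reflect (scal c p) = scal c (reflect p)"
  by (rule poly_mapping_eqI) (simp add: lookup_reflect lookup_scal)

lemma reflect_tvar: "reflect (tvar i p) = scal (-1) (tvar i (reflect p))"
proof (rule poly_mapping_eqI)
  fix k
  have "parity_sign k = - parity_sign (k - unit_exp i)" if "Poly_Mapping.lookup k i > 0"
    using parity_sign_add[of "unit_exp i" "k - unit_exp i"] exp_plus_minus_unit[OF that]
    by (simp add: parity_sign_unit_exp)
  then show "Poly_Mapping.lookup (reflect (tvar i p)) k =
      Poly_Mapping.lookup (scal (-1) (tvar i (reflect p))) k"
    by (auto simp: lookup_reflect lookup_tvar lookup_scal)
qed

lemma reflect_pdiff: "reflect (pdiff i p) = scal (-1) (pdiff i (reflect p))"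
  by (rule poly_mapping_eqI)
    (simp add: lookup_reflect lookup_pdiff lookup_scal parity_sign_add parity_sign_unit_exp)

lemma scal_scal: "scal c (scal d p) = scal (c * d) p"
  by (rule poly_mapping_eqI) (simp add: lookup_scal)

lemma scal_one [simp]: "scal 1 = (\<lambda>p. p)"
  by (rule ext, rule poly_mapping_eqI) (simp add: lookup_scal)

lemma scal_zero [simp]: "scal 0 = (\<lambda>p. 0)"
  by (rule ext, rule poly_mapping_eqI) (simp add: lookup_scal)

lemma scal_add: "scal c (p + q) = scal c p + scal c q"
  by (simp add: scal_def algebra_simps)

lemma scal_add_left: "scal (c + d) p = scal c p + scal d p"
  by (rule poly_mapping_eqI) (simp add: lookup_scal lookup_add algebra_simps)

lemma scal_minus_one: "scal (-1) p = - p"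
  by (rule poly_mapping_eqI) (simp add: lookup_scal)

text \<open>
  Elements of the Weyl algebra are functions on polynomials; composition distributes over sums
  on the right, and scalars are central, only because these functions are linear.
\<close>

lemma weyl_linear:
  assumes "a \<in> weyl_carrier"
  shows "a (p + q) = a p + a q" and "a (scal c p) = scal c (a p)"
proof -
  have "(\<forall>p q. a (p + q) = a p + a q) \<and> (\<forall>c p. a (scal c p) = scal c (a p))"
    using assms
  proof induction
    case (scal c)
    then show ?case
      by (auto simp: scal_add scal_scal mult.commute)
  next
    case (tvar i)
    then show ?case
      by (auto intro!: poly_mapping_eqI simp: lookup_tvar lookup_add lookup_scal)
  next
    case (pdiff i)
    then show ?case
      by (auto intro!: poly_mapping_eqI simp: lookup_pdiff lookup_add lookup_scal algebra_simps)
  next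
    case (add a b)
    then show ?case by (auto simp: scal_add)
  qed auto
  then show "a (p + q) = a p + a q" "a (scal c p) = scal c (a p)" by auto
qed

lemma weyl_zero: "a \<in> weyl_carrier \<Longrightarrow> a 0 = 0"
  using weyl_linear(2)[of a 0 0] by simp

lemma weyl_one_closed: "(\<lambda>p. p) \<in> weyl_carrier"
  using weyl_carrier.scal[of 1] by simp

lemma weyl_zero_closed: "(\<lambda>p. 0) \<in> weyl_carrier"
  using weyl_carrier.scal[of 0] by simp

lemma weyl_uminus_closed: "a \<in> weyl_carrier \<Longrightarrow> (\<lambda>p. - a p) \<in> weyl_carrier"
  using weyl_carrier.comp[OF weyl_carrier.scal[of "-1"]] by (simp add: o_def scal_minus_one)

lemma Weyl_simps [simp]:
  "carrier Weyl = weyl_carrier"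
  "a \<otimes>\<^bsub>Weyl\<^esub> b = a \<circ> b"
  "\<one>\<^bsub>Weyl\<^esub> = (\<lambda>p. p)"
  "\<zero>\<^bsub>Weyl\<^esub> = (\<lambda>p. 0)"
  "a \<oplus>\<^bsub>Weyl\<^esub> b = (\<lambda>p. a p + b p)"
  by (simp_all add: Weyl_def)

lemma ring_Weyl: "ring (Weyl :: 'n oper ring)"
proof (rule ringI)
  show "abelian_group (Weyl :: 'n oper ring)"
  proof (rule abelian_groupI)
    fix a :: "'n oper" assume "a \<in> carrier Weyl"
    then show "\<exists>b\<in>carrier Weyl. b \<oplus>\<^bsub>Weyl\<^esub> a = \<zero>\<^bsub>Weyl\<^esub>"
      by (intro bexI[of _ "\<lambda>p. - a p"]) (auto simp: weyl_uminus_closed)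
  qed (auto simp: weyl_zero_closed weyl_carrier.add algebra_simps)
  show "monoid (Weyl :: 'n oper ring)"
    by (rule monoidI) (auto simp: weyl_one_closed weyl_carrier.comp fun_eq_iff)
qed (auto simp: weyl_linear)

text \<open>
  The projection onto the operators that commute with the reflection, as the average over
  the group of order two generated by the conjugation.
\<close>

definition even_part :: "('n::finite) oper \<Rightarrow> 'n oper" where
  "even_part a p = scal (1/2) (a p + reflect (a (reflect p)))"

lemma reflect_conj_closed:
  "a \<in> weyl_carrier \<Longrightarrow> reflect \<circ> a \<circ> reflect \<in> weyl_carrier"
proof (induction rule: weyl_carrier.induct)
  case (scal c)
  then show ?case by (simp add: o_def reflect_scal weyl_carrier.scal)
next
  case (tvar i)
  then show ?case
    using weyl_carrier.comp[OF weyl_carrier.scal[of "-1"] weyl_carrier.tvar]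
    by (simp add: o_def reflect_tvar)
next
  case (pdiff i)
  then show ?case
    using weyl_carrier.comp[OF weyl_carrier.scal[of "-1"] weyl_carrier.pdiff]
    by (simp add: o_def reflect_pdiff)
next
  case (add a b)
  then show ?case using weyl_carrier.add by (fastforce simp: o_def reflect_add)
next
  case (comp a b)
  then show ?case using weyl_carrier.comp[OF comp(3,4)] by (simp add: o_def)
qed

lemma even_part_closed: "a \<in> weyl_carrier \<Longrightarrow> even_part a \<in> weyl_carrier"
  using weyl_carrier.comp[OF weyl_carrier.scal[of "1/2"]
      weyl_carrier.add[OF _ reflect_conj_closed], of a a]
  by (simp add: o_def even_part_def[abs_def])

section \<open>Lattices and degrees\<close>

lemma P_lattice_zero: "0 \<in> P_lattice"
  by (simp add: P_lattice_def)

lemma P_lattice_add: "x \<in> P_lattice \<Longrightarrow> y \<in> P_lattice \<Longrightarrow> x + y \<in> P_lattice"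
  by (simp add: P_lattice_def)

lemma P_lattice_uminus: "x \<in> P_lattice \<Longrightarrow> - x \<in> P_lattice"
  by (simp add: P_lattice_def)

lemma P_lattice_total: 
  assumes "x \<in> P_lattice"
  obtains m :: int where "(\<Sum>i\<in>UNIV. x $ i) = of_int m"
proof -
  have "(\<Sum>i\<in>UNIV. x $ i) \<in> \<int>"
    using assms by (intro Ints_sum) (simp add: P_lattice_def)
  then show thesis using that by (auto elim: Ints_cases)
qed

lemma Q_lattice_iff:
  assumes "x \<in> P_lattice" "(\<Sum>i\<in>UNIV. x $ i) = of_int m"
  shows "x \<in> Q_lattice \<longleftrightarrow> even m"
proof -
  have "(of_int m :: complex) = of_int (2 * k) \<longleftrightarrow> m = 2 * k" for k
    by (rule of_int_eq_iff)
  then show ?thesis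
    unfolding Q_lattice_def using assms by (auto simp del: of_int_mult)
qed

lemma Q_lattice_subset: "Q_lattice \<subseteq> P_lattice"
  by (auto simp: Q_lattice_def)

lemma Q_lattice_zero: "0 \<in> Q_lattice"
  using Q_lattice_iff[OF P_lattice_zero, of 0] by simp

lemma Q_lattice_add_iff:
  assumes "x \<in> P_lattice" "y \<in> P_lattice"
  shows "x + y \<in> Q_lattice \<longleftrightarrow> (x \<in> Q_lattice \<longleftrightarrow> y \<in> Q_lattice)"
proof -
  obtain m where m: "(\<Sum>i\<in>UNIV. x $ i) = of_int m" using P_lattice_total assms by blast
  obtain l where l: "(\<Sum>i\<in>UNIV. y $ i) = of_int l" using P_lattice_total assms by blast
  have "(\<Sum>i\<in>UNIV. (x + y) $ i) = of_int (m + l)"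
    by (simp add: sum.distrib m l)
  from Q_lattice_iff[OF P_lattice_add[OF assms] this] Q_lattice_iff[OF assms(1) m]
    Q_lattice_iff[OF assms(2) l]
  show ?thesis by auto
qed

lemma Q_lattice_uminus_iff:
  assumes "x \<in> P_lattice"
  shows "- x \<in> Q_lattice \<longleftrightarrow> x \<in> Q_lattice"
  using Q_lattice_add_iff[OF assms P_lattice_uminus[OF assms]] Q_lattice_zero by auto

lemma axis_lattice: "axis i 1 \<in> P_lattice" "axis i 1 \<notin> Q_lattice"
proof -
  show P: "axis i 1 \<in> P_lattice" by (simp add: P_lattice_def axis_def)
  have "(\<Sum>j\<in>UNIV. (axis i 1 :: complex ^ 'a) $ j) = of_int 1"
    by (simp add: axis_def)
  from Q_lattice_iff[OF P this] show "axis i 1 \<notin> Q_lattice" by simp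
qed

lemma weyl_degree_iff:
  "a \<in> weyl_degree \<alpha> \<longleftrightarrow>
     a \<in> weyl_carrier \<and> (\<forall>i p. euler i (a p) = a (euler i p) + scal (\<alpha> $ i) (a p))"
  by (auto simp: weyl_degree_def fun_eq_iff algebra_simps)

lemma scal_degree: "scal c \<in> weyl_degree 0"
  unfolding weyl_degree_iff
  by (auto intro!: weyl_carrier.scal poly_mapping_eqI simp: lookup_euler lookup_scal)

lemma tvar_degree: "tvar i \<in> weyl_degree (axis i 1)"
  unfolding weyl_degree_iff
proof (intro conjI allI)
  fix j p
  show "euler j (tvar i p) = tvar i (euler j p) + scal (axis i 1 $ j) (tvar i p)"
    by (rule poly_mapping_eqI)
      (auto simp: lookup_euler lookup_scal lookup_add lookup_tvar lookup_minus lookup_single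
        when_def axis_def algebra_simps of_nat_diff)
qed (rule weyl_carrier.tvar)

lemma pdiff_degree: "pdiff i \<in> weyl_degree (- axis i 1)"
  unfolding weyl_degree_iff
proof (intro conjI allI)
  fix j p
  show "euler j (pdiff i p) = pdiff i (euler j p) + scal ((- axis i 1) $ j) (pdiff i p)"
    by (rule poly_mapping_eqI)
      (auto simp: lookup_euler lookup_scal lookup_add lookup_pdiff lookup_minus lookup_single
        when_def axis_def algebra_simps)
qed (rule weyl_carrier.pdiff)

lemma weyl_degree_add:
  "a \<in> weyl_degree \<alpha> \<Longrightarrow> b \<in> weyl_degree \<alpha> \<Longrightarrow> (\<lambda>p. a p + b p) \<in> weyl_degree \<alpha>"
  unfolding weyl_degree_iff
  by (auto intro: weyl_carrier.add simp: scal_add weyl_linear)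
    (metis (no_types, lifting) euler_def ab_semigroup_add_class.add_ac(1) add.left_commute
      weyl_carrier.comp weyl_carrier.pdiff weyl_carrier.tvar weyl_linear(1))

lemma weyl_degree_comp:
  "a \<in> weyl_degree \<alpha> \<Longrightarrow> b \<in> weyl_degree \<beta> \<Longrightarrow> a \<circ> b \<in> weyl_degree (\<alpha> + \<beta>)"
  unfolding weyl_degree_iff
  by (auto intro: weyl_carrier.comp simp: scal_add_left weyl_linear)

lemma euler_degree: "euler i \<in> weyl_degree 0"
  using weyl_degree_comp[OF tvar_degree[of i] pdiff_degree[of i]] by (simp add: euler_def)

lemma weyl_degree_zero_op: "(\<lambda>p. 0) \<in> weyl_degree \<alpha>"
  unfolding weyl_degree_iff
  by (auto simp: weyl_zero_closed intro!: poly_mapping_eqI simp: lookup_euler lookup_scal)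

text \<open>
  An operator of degree \<open>\<alpha>\<close> shifts the eigenvalues of all Euler operators by \<open>\<alpha>\<close>, so it sends
  \<open>t\<^sup>k\<close> to a multiple of \<open>t\<close> to the power \<open>k + \<alpha>\<close>. The total degree changes by \<open>m\<close>, and the reflection sees
  the parity of that change.
\<close>

lemma weyl_degree_parity_monomial:
  assumes a: "a \<in> weyl_degree \<alpha>" and m: "(\<Sum>i\<in>UNIV. \<alpha> $ i) = of_int m"
  shows "reflect (a (reflect (Poly_Mapping.single k c))) =
      scal (if even m then 1 else -1) (a (Poly_Mapping.single k c))"
proof -
  let ?x = "Poly_Mapping.single k c"
  have aW: "a \<in> weyl_carrier" using a by (simp add: weyl_degree_iff)
  have refl_x: "reflect ?x = scal (parity_sign k) ?x"
    by (rule poly_mapping_eqI) (auto simp: lookup_reflect lookup_scal lookup_single when_def)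
  have eul_x: "euler i ?x = scal (of_nat (Poly_Mapping.lookup k i)) ?x" for i
    by (rule poly_mapping_eqI) (auto simp: lookup_euler lookup_scal lookup_single when_def)
  have sgn: "parity_sign l * parity_sign k = (if even m then 1 else -1)"
    if l: "Poly_Mapping.lookup (a ?x) l \<noteq> 0" for l
  proof -
    have eq: "of_nat (Poly_Mapping.lookup l i) = of_nat (Poly_Mapping.lookup k i) + \<alpha> $ i" for i
    proof -
      have "euler i (a ?x) = scal (of_nat (Poly_Mapping.lookup k i) + \<alpha> $ i) (a ?x)"
        using a by (simp add: weyl_degree_iff eul_x weyl_linear[OF aW] scal_add_left)
      from arg_cong[OF this, of "\<lambda>p. Poly_Mapping.lookup p l"] l
      show ?thesis by (simp add: lookup_euler lookup_scal)
    qed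
    have "(of_nat (\<Sum>i\<in>UNIV. Poly_Mapping.lookup l i) :: complex) =
        (\<Sum>i\<in>UNIV. of_nat (Poly_Mapping.lookup k i) + \<alpha> $ i)"
      unfolding of_nat_sum by (rule sum.cong) (simp_all add: eq)
    also have "\<dots> = of_nat (\<Sum>i\<in>UNIV. Poly_Mapping.lookup k i) + of_int m"
      by (simp add: sum.distrib m)
    finally have "int (\<Sum>i\<in>UNIV. Poly_Mapping.lookup l i) =
        int (\<Sum>i\<in>UNIV. Poly_Mapping.lookup k i) + m"
      by (metis (no_types, lifting) of_int_add of_int_eq_iff of_int_of_nat_eq)
    then have "even (\<Sum>i\<in>UNIV. Poly_Mapping.lookup l i) =
       (even (\<Sum>i\<in>UNIV. Poly_Mapping.lookup k i) = even m)"
      by (metis even_add even_of_nat)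
    then show ?thesis
      by (simp add: parity_sign_def uminus_power_if)
  qed
  show ?thesis
    unfolding refl_x weyl_linear(2)[OF aW]
    by (rule poly_mapping_eqI) (use sgn in \<open>fastforce simp: lookup_reflect lookup_scal\<close>)
qed

lemma weyl_degree_parity:
  assumes a: "a \<in> weyl_degree \<alpha>" and m: "(\<Sum>i\<in>UNIV. \<alpha> $ i) = of_int m"
  shows "reflect (a (reflect p)) = scal (if even m then 1 else -1) (a p)"
proof -
  have aW: "a \<in> weyl_carrier" using a by (simp add: weyl_degree_iff)
  show ?thesis
  proof (induction p rule: update_induct)
    case const
    have "reflect 0 = (0 :: 'a cpoly)" by (rule poly_mapping_eqI) (simp add: lookup_reflect)
    then show ?case using weyl_linear(2)[OF aW, of 0 0]
      by (simp add: scal_def weyl_zero[OF aW])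
  next
    case (update p k c)
    have "Poly_Mapping.update k c p = p + Poly_Mapping.single k c"
      using update by (intro poly_mapping_eqI)
        (auto simp: lookup_update lookup_add lookup_single when_def in_keys_iff)
    then show ?case
      using update weyl_degree_parity_monomial[OF a m, of k c]
      by (simp add: reflect_add weyl_linear[OF aW] scal_add)
  qed
qed

section \<open>Sums of graded pieces\<close>

text \<open>
  Both the grading of the Weyl algebra and the weight decomposition of a module are families
  of this kind; the index set \<open>I\<close> of a sum is left variable.
\<close>

locale additive_family = abelian_group G for G (structure) +
  fixes V :: "'i \<Rightarrow> 'a set"
  assumes V_carrier: "V i \<subseteq> carrier G"
    and V_zero: "\<zero> \<in> V i"
    and V_add: "x \<in> V i \<Longrightarrow> y \<in> V i \<Longrightarrow> x \<oplus> y \<in> V i"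
begin

lemma family_sum_eq_finsum:
  assumes "finite K" "K \<subseteq> I" "{i\<in>I. x i \<noteq> \<zero>} \<subseteq> K" "\<And>i. i \<in> I \<Longrightarrow> x i \<in> carrier G"
  shows "family_sum G I x = finsum G x K"
  unfolding family_sum_def
  by (rule add.finprod_mono_neutral_cong_left) (use assms in auto)

lemma finite_familiesD:
  assumes "x \<in> finite_families G I V"
  shows "finite {i\<in>I. x i \<noteq> \<zero>}" "\<And>i. i \<in> I \<Longrightarrow> x i \<in> V i" "\<And>i. i \<in> I \<Longrightarrow> x i \<in> carrier G"
  using assms V_carrier by (auto simp: finite_families_def)

text \<open>
  The induction principle through which all later statements about sums of graded pieces reduce
  to homogeneous elements.
\<close>

lemma sum_of_subgroups_induct [consumes 1, case_names zero add homogeneous]: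
  assumes "s \<in> sum_of_subgroups G I V"
    and zero: "P \<zero>"
    and add: "\<And>x y. x \<in> carrier G \<Longrightarrow> y \<in> carrier G \<Longrightarrow> P x \<Longrightarrow> P y \<Longrightarrow> P (x \<oplus> y)"
    and hom: "\<And>i x. i \<in> I \<Longrightarrow> x \<in> V i \<Longrightarrow> P x"
  shows "P s"
proof -
  from assms(1) obtain x where x: "x \<in> finite_families G I V" and s: "s = family_sum G I x"
    by (auto simp: sum_of_subgroups_def)
  note xD = finite_familiesD[OF x]
  have "P (finsum G x K)" if "finite K" "K \<subseteq> I" for K
    using that
  proof (induction K rule: finite_induct)
    case empty
    then show ?case using zero by simp
  next
    case (insert k K)
    then have "finsum G x (insert k K) = x k \<oplus> finsum G x K"
      using xD by (intro finsum_insert) auto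
    moreover have "finsum G x K \<in> carrier G"
      using insert xD by (intro finsum_closed) auto
    ultimately show ?case using insert xD hom add by auto
  qed
  from this[OF xD(1)] show ?thesis unfolding s family_sum_def by auto
qed

lemma sum_of_subgroups_subset: "sum_of_subgroups G I V \<subseteq> carrier G"
proof
  fix s assume "s \<in> sum_of_subgroups G I V"
  then show "s \<in> carrier G"
    by (induction rule: sum_of_subgroups_induct) (use V_carrier in auto)
qed

lemma sum_of_subgroups_zero: "\<zero> \<in> sum_of_subgroups G I V"
  unfolding sum_of_subgroups_def
proof (rule image_eqI)
  show "(\<lambda>i\<in>I. \<zero>) \<in> finite_families G I V"
    by (auto simp: finite_families_def V_zero)
  have "{i \<in> I. (\<lambda>i\<in>I. \<zero>) i \<noteq> \<zero>} = {}" by auto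
  then show "\<zero> = family_sum G I (\<lambda>i\<in>I. \<zero>)" 
    by (simp add: family_sum_def)
qed

lemma sum_of_subgroups_homogeneous:
  assumes "i \<in> I" "v \<in> V i" shows "v \<in> sum_of_subgroups G I V"
  unfolding sum_of_subgroups_def
proof (rule image_eqI)
  let ?x = "\<lambda>k\<in>I. if k = i then v else \<zero>"
  have vc: "v \<in> carrier G" using assms V_carrier by auto
  have fin: "finite {k \<in> I. ?x k \<noteq> \<zero>}"
    by (rule finite_subset[of _ "{i}"]) auto
  then show "?x \<in> finite_families G I V"
    using assms by (auto simp: finite_families_def V_zero)
  have "family_sum G I ?x = finsum G ?x {i}"
    using assms vc by (intro family_sum_eq_finsum) auto
  then show "v = family_sum G I ?x"
    using assms vc by simp
qed

lemma sum_of_subgroups_add: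
  assumes "s \<in> sum_of_subgroups G I V" "t \<in> sum_of_subgroups G I V"
  shows "s \<oplus> t \<in> sum_of_subgroups G I V"
proof -
  obtain x where x: "x \<in> finite_families G I V" and s: "s = family_sum G I x"
    using assms by (auto simp: sum_of_subgroups_def)
  obtain y where y: "y \<in> finite_families G I V" and t: "t = family_sum G I y"
    using assms by (auto simp: sum_of_subgroups_def)
  note xD = finite_familiesD[OF x] and yD = finite_familiesD[OF y]
  define z where "z = (\<lambda>i\<in>I. x i \<oplus> y i)"
  define K where "K = {i\<in>I. x i \<noteq> \<zero>} \<union> {i\<in>I. y i \<noteq> \<zero>}"
  have K: "finite K" "K \<subseteq> I" using xD yD by (auto simp: K_def)
  have zK: "{i\<in>I. z i \<noteq> \<zero>} \<subseteq> K" by (auto simp: z_def K_def)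
  have "z \<in> finite_families G I V"
    using finite_subset[OF zK K(1)] xD yD V_add by (auto simp: finite_families_def z_def)
  moreover have "family_sum G I z = s \<oplus> t"
  proof -
    have "family_sum G I z = finsum G z K"
      using K zK xD yD by (intro family_sum_eq_finsum) (auto simp: z_def)
    also have "\<dots> = finsum G (\<lambda>i. x i \<oplus> y i) K"
      using K xD yD by (intro finsum_cong') (auto simp: z_def)
    also have "\<dots> = finsum G x K \<oplus> finsum G y K"
      using K xD yD by (intro finsum_addf) auto
    also have "finsum G x K = s"
      unfolding s using K xD by (intro family_sum_eq_finsum[symmetric]) (auto simp: K_def)
    also have "finsum G y K = t"
      unfolding t using K yD by (intro family_sum_eq_finsum[symmetric]) (auto simp: K_def)
    finally show ?thesis .
  qed
  ultimately show ?thesis unfolding sum_of_subgroups_def by (metis image_eqI)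
qed

lemma sum_of_subgroups_mono:
  assumes "I \<subseteq> J" shows "sum_of_subgroups G I V \<subseteq> sum_of_subgroups G J V"
proof
  fix s assume "s \<in> sum_of_subgroups G I V"
  then show "s \<in> sum_of_subgroups G J V"
    by (induction rule: sum_of_subgroups_induct)
      (use assms in \<open>auto simp: sum_of_subgroups_zero sum_of_subgroups_add
        intro: sum_of_subgroups_homogeneous\<close>)
qed

text \<open>
  Two families with equal sums differ by a family with sum zero.
\<close>

lemma is_direct_sumI:
  assumes neg: "\<And>i x. x \<in> V i \<Longrightarrow> \<ominus> x \<in> V i"
    and gen: "carrier G \<subseteq> sum_of_subgroups G I V"
    and indep: "\<And>K x. finite K \<Longrightarrow> (\<And>i. i \<in> K \<Longrightarrow> x i \<in> V i) \<Longrightarrow> finsum G x K = \<zero> \<Longrightarrow>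
       \<forall>i\<in>K. x i = \<zero>"
  shows "is_direct_sum G I V"
  unfolding is_direct_sum_def bij_betw_def
proof
  show "family_sum G I ` finite_families G I V = carrier G"
    using gen sum_of_subgroups_subset by (auto simp: sum_of_subgroups_def)
  show "inj_on (family_sum G I) (finite_families G I V)"
  proof (rule inj_onI)
    fix x y assume x: "x \<in> finite_families G I V" and y: "y \<in> finite_families G I V"
      and eq: "family_sum G I x = family_sum G I y"
    note xD = finite_familiesD[OF x] and yD = finite_familiesD[OF y]
    define K where "K = {i\<in>I. x i \<noteq> \<zero>} \<union> {i\<in>I. y i \<noteq> \<zero>}"
    have K: "finite K" "K \<subseteq> I" using xD yD by (auto simp: K_def)
    have zV: "x i \<ominus> y i \<in> V i" if "i \<in> K" for i
      using that K xD yD V_add neg by (auto simp: a_minus_def)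
    have xs: "finsum G x K = family_sum G I x"
      using K xD by (intro family_sum_eq_finsum[symmetric]) (auto simp: K_def)
    have ys: "finsum G y K = family_sum G I y"
      using K yD by (intro family_sum_eq_finsum[symmetric]) (auto simp: K_def)
    have closed: "finsum G y K \<in> carrier G" "finsum G (\<lambda>i. x i \<ominus> y i) K \<in> carrier G"
      using K xD yD by (auto intro!: finsum_closed)
    have "finsum G (\<lambda>i. x i \<ominus> y i) K \<oplus> finsum G y K = finsum G (\<lambda>i. (x i \<ominus> y i) \<oplus> y i) K"
      using K xD yD by (intro finsum_addf[symmetric]) auto
    also have "\<dots> = finsum G x K"
      using K xD yD by (intro finsum_cong') (auto simp: a_minus_def a_assoc l_neg)
    also have "\<dots> = finsum G y K" using xs ys eq by simp
    finally have "finsum G (\<lambda>i. x i \<ominus> y i) K = \<zero>"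
      using closed by simp
    from indep[OF K(1) zV this] have z: "x i \<ominus> y i = \<zero>" if "i \<in> K" for i using that by auto
    show "x = y"
    proof (rule PiE_ext)
      show "x \<in> Pi\<^sub>E I V" "y \<in> Pi\<^sub>E I V" using x y by (auto simp: finite_families_def)
      fix i assume i: "i \<in> I"
      show "x i = y i"
      proof (cases "i \<in> K")
        case True
        have "x i = (x i \<ominus> y i) \<oplus> y i"
          using xD yD i by (simp add: a_minus_def a_assoc l_neg)
        then show ?thesis using z[OF True] yD i by simp
      qed (use i in \<open>auto simp: K_def\<close>)
    qed
  qed
qed

end

section \<open>The even subalgebra\<close>

interpretation degree: additive_family "Weyl :: ('n::finite) oper ring" weyl_degree
  rewrites "carrier (Weyl :: 'n oper ring) = weyl_carrier"
    and "ring.zero (Weyl :: 'n oper ring) = (\<lambda>p. 0)"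
    and "add (Weyl :: 'n oper ring) = (\<lambda>a b p. a p + b p)"
proof -
  show "additive_family (Weyl :: ('n::finite) oper ring) weyl_degree"
    by (intro additive_family.intro ring.is_abelian_group[OF ring_Weyl] additive_family_axioms.intro)
      (auto simp: weyl_degree_zero_op weyl_degree_add, simp add: weyl_degree_iff)
qed (auto simp: fun_eq_iff)

text \<open>
  The generators are homogeneous and products of homogeneous operators are homogeneous.
\<close>

lemma weyl_graded: "sum_of_subgroups Weyl P_lattice weyl_degree = (weyl_carrier :: ('n::finite) oper set)"
proof
  let ?S = "sum_of_subgroups Weyl P_lattice weyl_degree :: 'n oper set"
  show "?S \<subseteq> weyl_carrier"
    by (rule degree.sum_of_subgroups_subset)
  have comp_hom: "a \<circ> b \<in> ?S" if a: "a \<in> weyl_degree \<alpha>" "\<alpha> \<in> P_lattice" and b: "b \<in> ?S" for a b \<alpha>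
    using b
  proof (induction rule: degree.sum_of_subgroups_induct)
    case zero
    have "a \<circ> (\<lambda>p :: 'n cpoly. 0) = (\<lambda>p. 0)" using a by (auto simp: weyl_degree_iff weyl_zero)
    then show ?case by (simp only: degree.sum_of_subgroups_zero)
  next
    case (add x y)
    have "a \<circ> (\<lambda>p. x p + y p) = (\<lambda>p. (a \<circ> x) p + (a \<circ> y) p)"
      using a by (auto simp: weyl_degree_iff weyl_linear)
    then show ?case using degree.sum_of_subgroups_add[OF add(3,4)] by simp
  next
    case (homogeneous \<beta> b)
    then show ?case
      using a by (intro degree.sum_of_subgroups_homogeneous[of "\<alpha> + \<beta>"] weyl_degree_comp P_lattice_add)
  qed
  show "weyl_carrier \<subseteq> ?S"
  proof
    fix a :: "'n oper" assume "a \<in> weyl_carrier"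
    then show "a \<in> ?S"
    proof induction
      case (scal c)
      show ?case by (rule degree.sum_of_subgroups_homogeneous[OF P_lattice_zero scal_degree])
    next
      case (tvar i)
      show ?case by (rule degree.sum_of_subgroups_homogeneous[OF axis_lattice(1) tvar_degree])
    next
      case (pdiff i)
      show ?case
        by (rule degree.sum_of_subgroups_homogeneous[OF P_lattice_uminus[OF axis_lattice(1)] pdiff_degree])
    next
      case (add a b)
      then show ?case using degree.sum_of_subgroups_add by blast
    next
      case (comp a b)
      from comp(3) show ?case
      proof (induction rule: degree.sum_of_subgroups_induct)
        case zero
        show ?case by (simp add: o_def degree.sum_of_subgroups_zero)
      next
        case (add x y)
        have "(\<lambda>p. x p + y p) \<circ> b = (\<lambda>p. (x \<circ> b) p + (y \<circ> b) p)" by auto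
        then show ?case using degree.sum_of_subgroups_add[OF add(3,4)] by simp
      next
        case (homogeneous \<alpha> a)
        then show ?case using comp_hom comp(4) by blast
      qed
    qed
  qed
qed

definition even_ops :: "('n::finite) oper set" where
  "even_ops = {a \<in> weyl_carrier. \<forall>p. reflect (a (reflect p)) = a p}"

lemma even_part_even: "a \<in> even_ops \<Longrightarrow> even_part a = a"
proof -
  have "scal (1/2) (q + q) = q" for q :: "'a cpoly"
    unfolding scal_add scal_add_left[symmetric] by simp
  then show "a \<in> even_ops \<Longrightarrow> even_part a = a"
    unfolding even_ops_def even_part_def fun_eq_iff by simp
qed

lemma weyl_degree_even:
  assumes "a \<in> weyl_degree \<alpha>" "\<alpha> \<in> Q_lattice"
  shows "a \<in> even_ops"
proof -
  obtain m where m: "(\<Sum>i\<in>UNIV. \<alpha> $ i) = of_int m"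
    using P_lattice_total assms Q_lattice_subset by blast
  then have "even m" using Q_lattice_iff assms Q_lattice_subset by blast
  then show ?thesis
    using weyl_degree_parity[OF assms(1) m] assms by (simp add: even_ops_def weyl_degree_iff)
qed

lemma weyl_degree_odd:
  assumes "a \<in> weyl_degree \<alpha>" "\<alpha> \<in> P_lattice" "\<alpha> \<notin> Q_lattice"
  shows "reflect (a (reflect p)) = - a p" "even_part a = (\<lambda>p. 0)"
proof -
  obtain m where m: "(\<Sum>i\<in>UNIV. \<alpha> $ i) = of_int m"
    using P_lattice_total assms by blast
  then have "odd m" using Q_lattice_iff assms by blast
  then show *: "reflect (a (reflect p)) = - a p" for p
    using weyl_degree_parity[OF assms(1) m] by (simp add: scal_minus_one)
  show "even_part a = (\<lambda>p. 0)"
    by (auto simp: even_part_def[abs_def] * fun_eq_iff) (simp add: scal_def)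
qed

lemma even_part_add: "even_part (\<lambda>p. a p + b p) = (\<lambda>p. even_part a p + even_part b p)"
  by (auto simp: even_part_def fun_eq_iff reflect_add scal_add algebra_simps)

text \<open>
  \<open>even_part\<close> is right linear over the even operators. This is what makes \<open>a \<otimes> m \<mapsto> even_part a \<cdot> m\<close>
  well defined later.
\<close>

lemma even_part_right:
  "b \<in> even_ops \<Longrightarrow> even_part (a \<circ> b) = even_part a \<circ> b"
  by (auto simp: even_part_def fun_eq_iff even_ops_def) (metis reflect_reflect)

lemma even_ops_comp: "a \<in> even_ops \<Longrightarrow> b \<in> even_ops \<Longrightarrow> a \<circ> b \<in> even_ops"
  by (auto simp: even_ops_def weyl_carrier.comp) (metis reflect_reflect)

lemma even_ops_add: "a \<in> even_ops \<Longrightarrow> b \<in> even_ops \<Longrightarrow> (\<lambda>p. a p + b p) \<in> even_ops"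
  by (auto simp: even_ops_def weyl_carrier.add reflect_add)

lemma even_ops_scal: "scal c \<in> even_ops"
  using weyl_degree_even[OF scal_degree Q_lattice_zero] .

lemma even_ops_euler: "euler i \<in> even_ops"
  using weyl_degree_even[OF euler_degree Q_lattice_zero] .

lemma even_ops_one: "(\<lambda>p. p) \<in> even_ops"
  using even_ops_scal[of 1] by simp

lemma even_ops_zero: "(\<lambda>p. 0) \<in> even_ops"
  using even_ops_scal[of 0] by simp

text \<open>
  Homogeneous operators with degree in \<open>Q\<close> are even by the parity count on monomials. Conversely,
  an even operator is a sum of homogeneous ones with degrees in \<open>P\<close>, and applying \<open>even_part\<close>
  to that sum deletes exactly the summands with degree outside \<open>Q\<close>.
\<close>

lemma weyl_even_graded:
  "sum_of_subgroups Weyl Q_lattice weyl_degree = (even_ops :: ('n::finite) oper set)"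
  (is "?S = ?E")
proof
  show "?S \<subseteq> ?E"
  proof
    fix a :: "'n oper" assume "a \<in> sum_of_subgroups Weyl Q_lattice weyl_degree"
    then show "a \<in> even_ops"
      by (induction rule: degree.sum_of_subgroups_induct)
        (auto simp: even_ops_zero even_ops_add weyl_degree_even)
  qed
  show "?E \<subseteq> ?S"
  proof
    fix a :: "'n oper" assume a: "a \<in> even_ops"
    then have "a \<in> sum_of_subgroups Weyl P_lattice weyl_degree"
      by (simp add: weyl_graded even_ops_def)
    then have "even_part a \<in> sum_of_subgroups Weyl Q_lattice weyl_degree"
    proof (induction rule: degree.sum_of_subgroups_induct)
      case zero
      show ?case by (simp add: even_part_even[OF even_ops_zero] degree.sum_of_subgroups_zero)
    next
      case (add a b)
      then show ?case by (simp add: even_part_add degree.sum_of_subgroups_add)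
    next
      case (homogeneous \<alpha> a)
      show ?case
      proof (cases "\<alpha> \<in> Q_lattice")
        case True
        then show ?thesis
          using homogeneous degree.sum_of_subgroups_homogeneous
          by (simp add: even_part_even[OF weyl_degree_even])
      next
        case False
        then show ?thesis
          using homogeneous by (simp add: weyl_degree_odd degree.sum_of_subgroups_zero)
      qed
    qed
    then show "a \<in> sum_of_subgroups Weyl Q_lattice weyl_degree"
      by (simp add: even_part_even[OF a])
  qed
qed

lemma even_part_in_even_ops: "a \<in> weyl_carrier \<Longrightarrow> even_part a \<in> even_ops"
  by (simp add: even_ops_def even_part_closed)
    (simp add: even_part_def reflect_scal reflect_add add.commute)

lemma even_ops_subset: "even_ops \<subseteq> weyl_carrier"
  by (auto simp: even_ops_def)

lemma Weyl_ev_eq: "Weyl_ev = Weyl\<lparr>carrier := even_ops\<rparr>"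
  by (simp add: Weyl_ev_def weyl_even_graded)

lemma Weyl_ev_simps [simp]:
  "carrier Weyl_ev = even_ops"
  "a \<otimes>\<^bsub>Weyl_ev\<^esub> b = a \<circ> b"
  "\<one>\<^bsub>Weyl_ev\<^esub> = (\<lambda>p. p)"
  "\<zero>\<^bsub>Weyl_ev\<^esub> = (\<lambda>p. 0)"
  "a \<oplus>\<^bsub>Weyl_ev\<^esub> b = (\<lambda>p. a p + b p)"
  by (simp_all add: Weyl_ev_eq)

lemma ring_Weyl_ev: "ring (Weyl_ev :: ('n::finite) oper ring)"
  unfolding Weyl_ev_eq
proof (rule ring.subring_is_ring[OF ring_Weyl], rule ring.subringI[OF ring_Weyl])
  fix a :: "'n oper" assume a: "a \<in> even_ops"
  then have "\<ominus>\<^bsub>Weyl\<^esub> a = scal (-1) \<circ> a"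
    by (intro abelian_group.minus_equality[OF ring.is_abelian_group[OF ring_Weyl]])
      (auto simp: even_ops_def weyl_carrier.scal weyl_carrier.comp scal_minus_one)
  then show "\<ominus>\<^bsub>Weyl\<^esub> a \<in> even_ops"
    using a by (simp add: even_ops_comp even_ops_scal)
qed (simp_all add: even_ops_one even_ops_comp even_ops_add even_ops_subset)

section \<open>Weight spaces\<close>

context left_module
begin

lemma smult_r_null:
  assumes "a \<in> carrier R" shows "a \<odot>\<^bsub>M\<^esub> \<zero>\<^bsub>M\<^esub> = \<zero>\<^bsub>M\<^esub>"
proof -
  have "a \<odot>\<^bsub>M\<^esub> \<zero>\<^bsub>M\<^esub> \<oplus>\<^bsub>M\<^esub> a \<odot>\<^bsub>M\<^esub> \<zero>\<^bsub>M\<^esub> = a \<odot>\<^bsub>M\<^esub> \<zero>\<^bsub>M\<^esub>"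
    using smult_r_distr[of a "\<zero>\<^bsub>M\<^esub>" "\<zero>\<^bsub>M\<^esub>"] assms by simp
  moreover have "a \<odot>\<^bsub>M\<^esub> \<zero>\<^bsub>M\<^esub> \<in> carrier M" using assms by (intro smult_closed) auto
  ultimately show ?thesis using M.add.l_cancel_one by blast
qed

lemma smult_l_null:
  assumes "x \<in> carrier M" shows "\<zero> \<odot>\<^bsub>M\<^esub> x = \<zero>\<^bsub>M\<^esub>"
proof -
  have "\<zero> \<odot>\<^bsub>M\<^esub> x \<oplus>\<^bsub>M\<^esub> \<zero> \<odot>\<^bsub>M\<^esub> x = \<zero> \<odot>\<^bsub>M\<^esub> x"
    using smult_l_distr[of \<zero> \<zero> x] assms by simp
  moreover have "\<zero> \<odot>\<^bsub>M\<^esub> x \<in> carrier M" using assms by (intro smult_closed) auto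
  ultimately show ?thesis using M.add.l_cancel_one by blast
qed

lemma smult_finsum:
  assumes "a \<in> carrier R" "finite K" "x \<in> K \<rightarrow> carrier M"
  shows "a \<odot>\<^bsub>M\<^esub> finsum M x K = finsum M (\<lambda>i. a \<odot>\<^bsub>M\<^esub> x i) K"
  using assms(2,3)
proof (induction K rule: finite_induct)
  case empty
  then show ?case using assms(1) by (simp add: smult_r_null)
next
  case (insert k K)
  then show ?case using assms(1)
    by (simp add: Pi_iff smult_r_distr smult_closed)
qed

end

text \<open>
  Weights involve only scalars and Euler operators, which are even. Hence their theory is the
  same over the Weyl algebra and over its even part, and is developed here for both at once.
\<close>

locale weyl_like_module = left_module R M
  for R :: "('n::finite) oper ring" and M :: "('n oper, 'u) module" +
  fixes C :: "'n oper set"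
  assumes R_eq: "R = Weyl\<lparr>carrier := C\<rparr>"
    and even_in_C: "even_ops \<subseteq> C"
    and C_weyl: "C \<subseteq> weyl_carrier"
begin

lemma R_simps [simp]:
  "carrier R = C"
  "a \<otimes>\<^bsub>R\<^esub> b = a \<circ> b"
  "\<one>\<^bsub>R\<^esub> = (\<lambda>p. p)"
  "\<zero>\<^bsub>R\<^esub> = (\<lambda>p. 0)"
  "a \<oplus>\<^bsub>R\<^esub> b = (\<lambda>p. a p + b p)"
  by (simp_all add: R_eq)

lemma smult_l_distr': "a \<in> C \<Longrightarrow> b \<in> C \<Longrightarrow> x \<in> carrier M \<Longrightarrow>
    (\<lambda>p. a p + b p) \<odot>\<^bsub>M\<^esub> x = a \<odot>\<^bsub>M\<^esub> x \<oplus>\<^bsub>M\<^esub> b \<odot>\<^bsub>M\<^esub> x"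
  using smult_l_distr[of a b x] by simp

lemma smult_assoc': "a \<in> C \<Longrightarrow> b \<in> C \<Longrightarrow> x \<in> carrier M \<Longrightarrow>
    a \<odot>\<^bsub>M\<^esub> (b \<odot>\<^bsub>M\<^esub> x) = (a \<circ> b) \<odot>\<^bsub>M\<^esub> x"
  using smult_assoc[of a b x] by simp

lemma smult_closed': "a \<in> C \<Longrightarrow> x \<in> carrier M \<Longrightarrow> a \<odot>\<^bsub>M\<^esub> x \<in> carrier M"
  using smult_closed[of a x] by simp

lemma smult_one' [simp]: "x \<in> carrier M \<Longrightarrow> (\<lambda>p. p) \<odot>\<^bsub>M\<^esub> x = x"
  using smult_one by simp

lemma smult_zero' [simp]: "x \<in> carrier M \<Longrightarrow> (\<lambda>p. 0) \<odot>\<^bsub>M\<^esub> x = \<zero>\<^bsub>M\<^esub>"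
  using smult_l_null by simp

lemma scal_C: "scal c \<in> C" using even_ops_scal even_in_C by blast

lemma euler_C: "euler i \<in> C" using even_ops_euler even_in_C by blast

lemma smult_minus_one:
  assumes "x \<in> carrier M" shows "scal (-1) \<odot>\<^bsub>M\<^esub> x = \<ominus>\<^bsub>M\<^esub> x"
proof (rule M.minus_equality[symmetric])
  have "scal (-1) \<odot>\<^bsub>M\<^esub> x \<oplus>\<^bsub>M\<^esub> scal 1 \<odot>\<^bsub>M\<^esub> x = (\<lambda>p. scal (-1) p + scal 1 p) \<odot>\<^bsub>M\<^esub> x"
    using assms by (intro smult_l_distr'[symmetric] scal_C)
  also have "(\<lambda>p. scal (-1) p + scal 1 p) = (\<lambda>p. 0 :: 'n cpoly)"
    by (auto simp: scal_minus_one)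
  finally show "scal (-1) \<odot>\<^bsub>M\<^esub> x \<oplus>\<^bsub>M\<^esub> x = \<zero>\<^bsub>M\<^esub>" using assms by simp
qed (use assms smult_closed' scal_C in auto)

lemma scal_cancel:
  assumes "x \<in> carrier M" "scal c \<odot>\<^bsub>M\<^esub> x = \<zero>\<^bsub>M\<^esub>" "c \<noteq> 0"
  shows "x = \<zero>\<^bsub>M\<^esub>"
proof -
  have "scal (1/c) \<odot>\<^bsub>M\<^esub> (scal c \<odot>\<^bsub>M\<^esub> x) = (scal (1/c) \<circ> scal c) \<odot>\<^bsub>M\<^esub> x"
    by (rule smult_assoc'[OF scal_C scal_C assms(1)])
  also have "scal (1/c) \<circ> scal c = (\<lambda>p :: 'n cpoly. p)"
    using assms by (auto simp: fun_eq_iff scal_scal)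
  finally show ?thesis using assms smult_r_null[of "scal (1/c)"] scal_C by simp
qed

lemma weight_spaceD:
  "m \<in> weight_space M \<mu> \<Longrightarrow> m \<in> carrier M"
  "m \<in> weight_space M \<mu> \<Longrightarrow> euler i \<odot>\<^bsub>M\<^esub> m = scal (\<mu> $ i) \<odot>\<^bsub>M\<^esub> m"
  by (auto simp: weight_space_def)

text \<open>
  The Euler operators satisfy \<open>E\<^sub>i a = a E\<^sub>i + \<alpha>\<^sub>i a\<close> for \<open>a\<close> of degree \<open>\<alpha>\<close>.
\<close>

lemma weight_space_smult:
  assumes a: "a \<in> C" "a \<in> weyl_degree \<alpha>" and m: "m \<in> weight_space M \<mu>"
  shows "a \<odot>\<^bsub>M\<^esub> m \<in> weight_space M (\<mu> + \<alpha>)"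
  unfolding weight_space_def
proof (intro CollectI conjI allI)
  note mM = weight_spaceD[OF m]
  show "a \<odot>\<^bsub>M\<^esub> m \<in> carrier M" using a mM smult_closed' by auto
  fix i
  have aW: "a \<in> weyl_carrier" using a C_weyl by auto
  have ca: "c \<in> C \<Longrightarrow> d \<in> C \<Longrightarrow> c \<circ> d \<in> C" for c d
    using R.m_closed[of c d] by simp
  have "euler i \<odot>\<^bsub>M\<^esub> (a \<odot>\<^bsub>M\<^esub> m) = (euler i \<circ> a) \<odot>\<^bsub>M\<^esub> m"
    using a mM by (simp add: smult_assoc' euler_C del: o_apply)
  also have "euler i \<circ> a = (\<lambda>p. (a \<circ> euler i) p + (scal (\<alpha> $ i) \<circ> a) p)"
    using a by (auto simp: weyl_degree_iff)
  also have "\<dots> \<odot>\<^bsub>M\<^esub> m = (a \<circ> euler i) \<odot>\<^bsub>M\<^esub> m \<oplus>\<^bsub>M\<^esub> (scal (\<alpha> $ i) \<circ> a) \<odot>\<^bsub>M\<^esub> m"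
    using a mM by (intro smult_l_distr' ca scal_C euler_C)
  also have "(a \<circ> euler i) \<odot>\<^bsub>M\<^esub> m = a \<odot>\<^bsub>M\<^esub> (scal (\<mu> $ i) \<odot>\<^bsub>M\<^esub> m)"
    using a mM by (simp add: smult_assoc'[symmetric] euler_C)
  also have "\<dots> = (a \<circ> scal (\<mu> $ i)) \<odot>\<^bsub>M\<^esub> m"
    using a mM by (simp add: smult_assoc' scal_C del: o_apply)
  also have "a \<circ> scal (\<mu> $ i) = scal (\<mu> $ i) \<circ> a"
    using weyl_linear[OF aW] by auto
  also have "(scal (\<mu> $ i) \<circ> a) \<odot>\<^bsub>M\<^esub> m \<oplus>\<^bsub>M\<^esub> (scal (\<alpha> $ i) \<circ> a) \<odot>\<^bsub>M\<^esub> m =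
      (\<lambda>p. (scal (\<mu> $ i) \<circ> a) p + (scal (\<alpha> $ i) \<circ> a) p) \<odot>\<^bsub>M\<^esub> m"
    using a mM by (intro smult_l_distr'[symmetric] ca scal_C)
  also have "(\<lambda>p. (scal (\<mu> $ i) \<circ> a) p + (scal (\<alpha> $ i) \<circ> a) p) = scal ((\<mu> + \<alpha>) $ i) \<circ> a"
    by (auto simp: scal_add_left)
  also have "\<dots> \<odot>\<^bsub>M\<^esub> m = scal ((\<mu> + \<alpha>) $ i) \<odot>\<^bsub>M\<^esub> (a \<odot>\<^bsub>M\<^esub> m)"
    using a mM by (simp add: smult_assoc' scal_C del: o_apply)
  finally show "euler i \<odot>\<^bsub>M\<^esub> (a \<odot>\<^bsub>M\<^esub> m) = scal ((\<mu> + \<alpha>) $ i) \<odot>\<^bsub>M\<^esub> (a \<odot>\<^bsub>M\<^esub> m)" .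
qed

lemma weight_space_zero: "\<zero>\<^bsub>M\<^esub> \<in> weight_space M \<mu>"
  by (simp add: weight_space_def smult_r_null scal_C euler_C)

lemma weight_space_add:
  "x \<in> weight_space M \<mu> \<Longrightarrow> y \<in> weight_space M \<mu> \<Longrightarrow> x \<oplus>\<^bsub>M\<^esub> y \<in> weight_space M \<mu>"
  by (simp add: weight_space_def smult_r_distr scal_C euler_C)

lemma weight_space_minus:
  assumes "x \<in> weight_space M \<mu>" shows "\<ominus>\<^bsub>M\<^esub> x \<in> weight_space M \<mu>"
  using weight_space_smult[OF scal_C scal_degree assms, of "-1"]
    smult_minus_one[OF weight_spaceD(1)[OF assms]]
  by simp

lemma weight_space_scal: "x \<in> weight_space M \<mu> \<Longrightarrow> scal c \<odot>\<^bsub>M\<^esub> x \<in> weight_space M \<mu>"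
  using weight_space_smult[OF scal_C scal_degree, of x \<mu>] by simp

sublocale weights: additive_family M "weight_space M"
  by unfold_locales (auto simp: weight_space_zero weight_space_add weight_spaceD)

text \<open>
  Eigenvectors for distinct joint eigenvalues: to remove the weight \<open>\<kappa>\<close> from a vanishing sum, apply
  \<open>E\<^sub>i - \<kappa>\<^sub>i\<close>, which multiplies the summand of weight \<open>\<mu>\<close> by \<open>\<mu>\<^sub>i - \<kappa>\<^sub>i\<close>; the coordinate \<open>i\<close> may be
  chosen differently for each \<open>\<mu>\<close>.
\<close>

lemma weight_vectors_independent:
  assumes "finite K" "\<And>\<mu>. \<mu> \<in> K \<Longrightarrow> x \<mu> \<in> weight_space M \<mu>" "finsum M x K = \<zero>\<^bsub>M\<^esub>"
  shows "\<forall>\<mu>\<in>K. x \<mu> = \<zero>\<^bsub>M\<^esub>"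
  using assms
proof (induction K arbitrary: x rule: finite_induct)
  case empty
  then show ?case by simp
next
  case (insert \<kappa> K)
  have xc: "x \<mu> \<in> carrier M" if "\<mu> \<in> insert \<kappa> K" for \<mu>
    using insert.prems(1)[OF that] by (rule weight_spaceD)
  have x0: "x \<mu> = \<zero>\<^bsub>M\<^esub>" if \<mu>: "\<mu> \<in> K" for \<mu>
  proof -
    from \<mu> insert.hyps have "\<mu> \<noteq> \<kappa>" by auto
    then obtain i where i: "\<mu> $ i \<noteq> \<kappa> $ i" by (auto simp: vec_eq_iff)
    define b where "b = (\<lambda>p. euler i p + scal (- \<kappa> $ i) p)"
    have bC: "b \<in> C"
      using R.add.m_closed[of "euler i" "scal (- \<kappa> $ i)"] scal_C euler_C by (simp add: b_def)
    have bx: "b \<odot>\<^bsub>M\<^esub> x \<nu> = scal (\<nu> $ i - \<kappa> $ i) \<odot>\<^bsub>M\<^esub> x \<nu>" if \<nu>: "\<nu> \<in> insert \<kappa> K" for \<nu>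
    proof -
      have "b \<odot>\<^bsub>M\<^esub> x \<nu> = scal (\<nu> $ i) \<odot>\<^bsub>M\<^esub> x \<nu> \<oplus>\<^bsub>M\<^esub> scal (- \<kappa> $ i) \<odot>\<^bsub>M\<^esub> x \<nu>"
        unfolding b_def using weight_spaceD(2)[OF insert.prems(1)[OF \<nu>]] xc[OF \<nu>]
        by (simp add: smult_l_distr' scal_C euler_C)
      also have "\<dots> = (\<lambda>p. scal (\<nu> $ i) p + scal (- \<kappa> $ i) p) \<odot>\<^bsub>M\<^esub> x \<nu>"
        using xc[OF \<nu>] by (simp add: smult_l_distr' scal_C)
      also have "(\<lambda>p. scal (\<nu> $ i) p + scal (- \<kappa> $ i) p) = (scal (\<nu> $ i - \<kappa> $ i) :: 'n oper)"
        by (rule ext) (simp flip: scal_add_left)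
      finally show ?thesis .
    qed
    let ?y = "\<lambda>\<nu>. scal (\<nu> $ i - \<kappa> $ i) \<odot>\<^bsub>M\<^esub> x \<nu>"
    have yc: "?y \<in> insert \<kappa> K \<rightarrow> carrier M"
      using xc by (auto intro!: smult_closed' scal_C)
    have "\<zero>\<^bsub>M\<^esub> = b \<odot>\<^bsub>M\<^esub> finsum M x (insert \<kappa> K)"
      using insert.prems(2) bC by (simp add: smult_r_null)
    also have "\<dots> = finsum M (\<lambda>\<nu>. b \<odot>\<^bsub>M\<^esub> x \<nu>) (insert \<kappa> K)"
      using xc bC insert.hyps by (intro smult_finsum) auto
    also have "\<dots> = finsum M ?y (insert \<kappa> K)"
      using bx yc by (intro M.finsum_cong') auto
    also have "\<dots> = ?y \<kappa> \<oplus>\<^bsub>M\<^esub> finsum M ?y K"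
      using yc insert.hyps by (intro M.finsum_insert) auto
    also have "?y \<kappa> = \<zero>\<^bsub>M\<^esub>" using xc by simp
    finally have "finsum M ?y K = \<zero>\<^bsub>M\<^esub>"
      using yc M.finsum_closed[of ?y K] M.l_zero by (simp add: Pi_iff)
    then have "\<forall>\<nu>\<in>K. ?y \<nu> = \<zero>\<^bsub>M\<^esub>"
      using insert.prems(1) by (intro insert.IH weight_space_scal) auto
    with \<mu> have "scal (\<mu> $ i - \<kappa> $ i) \<odot>\<^bsub>M\<^esub> x \<mu> = \<zero>\<^bsub>M\<^esub>" by auto
    from scal_cancel[OF _ this] i xc \<mu> show ?thesis by auto
  qed
  have "finsum M x K = finsum M (\<lambda>_. \<zero>\<^bsub>M\<^esub>) K"
    by (rule M.finsum_cong') (use x0 in auto)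
  then have "finsum M x K = \<zero>\<^bsub>M\<^esub>" by simp
  moreover have "finsum M x (insert \<kappa> K) = x \<kappa> \<oplus>\<^bsub>M\<^esub> finsum M x K"
    using insert.hyps xc by (intro M.finsum_insert) auto
  ultimately have "x \<kappa> = \<zero>\<^bsub>M\<^esub>" using insert.prems(2) xc by simp
  with x0 show ?case by auto
qed

text \<open>
  The form in which independence of weight spaces is used: it separates the even from the odd
  part of a module.
\<close>

lemma Res_carrier_disjoint:
  assumes x: "x \<in> Res_carrier T M" "x \<in> Res_carrier T' M" and T: "T \<inter> T' = {}"
  shows "x = \<zero>\<^bsub>M\<^esub>"
proof -
  obtain f where f: "f \<in> finite_families M T (weight_space M)" and xf: "x = family_sum M T f"
    using x by (auto simp: Res_carrier_def sum_of_subgroups_def)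
  obtain g where g: "g \<in> finite_families M T' (weight_space M)" and xg: "x = family_sum M T' g"
    using x by (auto simp: Res_carrier_def sum_of_subgroups_def)
  note fD = weights.finite_familiesD[OF f] and gD = weights.finite_familiesD[OF g]
  define K where "K = {\<mu>\<in>T. f \<mu> \<noteq> \<zero>\<^bsub>M\<^esub>}"
  define K' where "K' = {\<mu>\<in>T'. g \<mu> \<noteq> \<zero>\<^bsub>M\<^esub>}"
  \<comment> \<open>Subtracting the two expressions for \<open>x\<close> gives a vanishing sum with pairwise distinct weights.\<close>
  define h where "h \<mu> = (if \<mu> \<in> T then f \<mu> else \<ominus>\<^bsub>M\<^esub> g \<mu>)" for \<mu>
  have KK: "finite K" "finite K'" "K \<inter> K' = {}" "K \<subseteq> T" "K' \<subseteq> T'"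
    using fD gD T by (auto simp: K_def K'_def)
  have xK: "x = finsum M f K"
    unfolding xf family_sum_def K_def ..
  have xK': "x = finsum M g K'"
    unfolding xg family_sum_def K'_def ..
  have xc: "x \<in> carrier M" unfolding xK using fD KK by (intro M.finsum_closed) auto
  have hW: "h \<mu> \<in> weight_space M \<mu>" if "\<mu> \<in> K \<union> K'" for \<mu>
    using that fD gD KK by (auto simp: h_def weight_space_minus)
  have hc: "h \<mu> \<in> carrier M" if "\<mu> \<in> K \<union> K'" for \<mu>
    using weight_spaceD(1)[OF hW[OF that]] .
  have h1: "finsum M h K = x"
    unfolding xK by (rule M.finsum_cong') (use fD KK in \<open>auto simp: h_def\<close>)
  have "finsum M h K' \<oplus>\<^bsub>M\<^esub> finsum M g K' = finsum M (\<lambda>\<mu>. h \<mu> \<oplus>\<^bsub>M\<^esub> g \<mu>) K'"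
    using hc gD KK by (intro M.finsum_addf[symmetric]) auto
  also have "\<dots> = finsum M (\<lambda>_. \<zero>\<^bsub>M\<^esub>) K'"
  proof (rule M.finsum_cong')
    fix \<mu> assume "\<mu> \<in> K'"
    then have "\<mu> \<notin> T" "g \<mu> \<in> carrier M" using KK T gD by auto
    then show "h \<mu> \<oplus>\<^bsub>M\<^esub> g \<mu> = \<zero>\<^bsub>M\<^esub>" by (simp add: h_def M.l_neg)
  qed auto
  also have "\<dots> = \<zero>\<^bsub>M\<^esub>" by simp
  finally have h2: "finsum M h K' \<oplus>\<^bsub>M\<^esub> x = \<zero>\<^bsub>M\<^esub>" using xK' by simp
  have "finsum M h (K \<union> K') = finsum M h K \<oplus>\<^bsub>M\<^esub> finsum M h K'"
    using KK hc by (intro M.finsum_Un_disjoint) auto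
  also have "\<dots> = \<zero>\<^bsub>M\<^esub>"
    using h1 h2 xc hc by (simp add: M.add.m_comm M.finsum_closed)
  finally have "\<forall>\<mu>\<in>K \<union> K'. h \<mu> = \<zero>\<^bsub>M\<^esub>"
    using KK hW by (intro weight_vectors_independent) auto
  then have "\<forall>\<mu>\<in>K. h \<mu> = \<zero>\<^bsub>M\<^esub>" by auto
  then have "finsum M h K = finsum M (\<lambda>_. \<zero>\<^bsub>M\<^esub>) K"
    by (intro M.finsum_cong') auto
  with h1 show ?thesis by simp
qed

lemmas Res_carrier_zero = weights.sum_of_subgroups_zero[folded Res_carrier_def]
lemmas Res_carrier_add = weights.sum_of_subgroups_add[folded Res_carrier_def]
lemmas Res_carrier_subset = weights.sum_of_subgroups_subset[folded Res_carrier_def]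
lemmas Res_carrier_mono = weights.sum_of_subgroups_mono[folded Res_carrier_def]
lemmas Res_carrier_weight = weights.sum_of_subgroups_homogeneous[folded Res_carrier_def]
lemmas Res_carrier_induct [consumes 1, case_names zero add homogeneous] =
  weights.sum_of_subgroups_induct[folded Res_carrier_def]

lemma Res_carrier_closed: "x \<in> Res_carrier T M \<Longrightarrow> x \<in> carrier M"
  using Res_carrier_subset by blast

lemma Res_carrier_smult:
  assumes "a \<in> C" "a \<in> weyl_degree \<alpha>" "\<And>\<mu>. \<mu> \<in> T \<Longrightarrow> \<mu> + \<alpha> \<in> T'" and x: "x \<in> Res_carrier T M"
  shows "a \<odot>\<^bsub>M\<^esub> x \<in> Res_carrier T' M"
  using x
proof (induction rule: Res_carrier_induct)
  case zero
  show ?case using assms by (simp add: smult_r_null Res_carrier_zero)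
next
  case (add x y)
  then show ?case using assms by (simp add: smult_r_distr Res_carrier_add)
next
  case (homogeneous \<mu> x)
  then show ?case using assms weight_space_smult by (blast intro: Res_carrier_weight)
qed

lemma Res_carrier_even_smult:
  assumes "a \<in> even_ops" and T: "\<And>\<mu> \<alpha>. \<mu> \<in> T \<Longrightarrow> \<alpha> \<in> Q_lattice \<Longrightarrow> \<mu> + \<alpha> \<in> T"
    and x: "x \<in> Res_carrier T M"
  shows "a \<odot>\<^bsub>M\<^esub> x \<in> Res_carrier T M"
proof -
  note xc = Res_carrier_closed[OF x]
  from assms(1) have "a \<in> sum_of_subgroups Weyl Q_lattice weyl_degree"
    by (simp add: weyl_even_graded)
  then have "a \<in> even_ops \<and> a \<odot>\<^bsub>M\<^esub> x \<in> Res_carrier T M"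
  proof (induction rule: degree.sum_of_subgroups_induct)
    case zero
    show ?case using xc by (simp add: even_ops_zero Res_carrier_zero)
  next
    case (add a b)
    then show ?case using xc even_in_C
      by (auto simp: even_ops_add Res_carrier_add smult_l_distr' subset_iff)
  next
    case (homogeneous \<alpha> a)
    then have "a \<in> even_ops" by (intro weyl_degree_even)
    then show ?case using homogeneous Res_carrier_smult[OF _ homogeneous(2) T x] even_in_C by auto
  qed
  then show ?thesis by simp
qed

text \<open>
  Directness is automatic by independence, so a weight module only has to be spanned by its
  weight vectors. Testing this with the weights in \<open>T\<close> also records the bound on the support.
\<close>

lemma weight_module_iff:
  "is_weight_module M \<and> supp M \<subseteq> T \<longleftrightarrow> carrier M \<subseteq> Res_carrier T M"
proof
  assume *: "is_weight_module M \<and> supp M \<subseteq> T"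
  show "carrier M \<subseteq> Res_carrier T M"
  proof
    fix x assume "x \<in> carrier M"
    then have "x \<in> Res_carrier UNIV M"
      using * by (auto simp: is_weight_module_def is_direct_sum_def bij_betw_def
          Res_carrier_def sum_of_subgroups_def)
    then show "x \<in> Res_carrier T M"
    proof (induction rule: Res_carrier_induct)
      case (homogeneous \<mu> x)
      show ?case
      proof (cases "\<mu> \<in> T")
        case False
        then have "weight_space M \<mu> = {\<zero>\<^bsub>M\<^esub>}" using * by (auto simp: supp_def)
        then show ?thesis using homogeneous by (simp add: Res_carrier_zero)
      qed (use homogeneous in \<open>auto intro: Res_carrier_weight\<close>)
    qed (auto simp: Res_carrier_zero Res_carrier_add)
  qed
next
  assume *: "carrier M \<subseteq> Res_carrier T M"
  have "is_weight_module M"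
    unfolding is_weight_module_def
  proof (rule weights.is_direct_sumI)
    show "carrier M \<subseteq> sum_of_subgroups M UNIV (weight_space M)"
      using * Res_carrier_mono[of T UNIV] by (auto simp: Res_carrier_def)
    show "\<ominus>\<^bsub>M\<^esub> x \<in> weight_space M \<mu>" if "x \<in> weight_space M \<mu>" for \<mu> x
      using that by (rule weight_space_minus)
    show "\<forall>\<mu>\<in>K. x \<mu> = \<zero>\<^bsub>M\<^esub>"
      if "finite K" "\<And>\<mu>. \<mu> \<in> K \<Longrightarrow> x \<mu> \<in> weight_space M \<mu>" "finsum M x K = \<zero>\<^bsub>M\<^esub>" for K x
      using that by (rule weight_vectors_independent)
  qed
  moreover have "supp M \<subseteq> T"
  proof
    fix \<mu> assume "\<mu> \<in> supp M"
    then obtain x where x: "x \<in> weight_space M \<mu>" "x \<noteq> \<zero>\<^bsub>M\<^esub>"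
      using weight_space_zero by (auto simp: supp_def)
    show "\<mu> \<in> T"
    proof (rule ccontr)
      assume "\<mu> \<notin> T"
      then have "x = \<zero>\<^bsub>M\<^esub>"
        using Res_carrier_weight[of \<mu> "{\<mu>}", OF _ x(1)] weight_spaceD(1)[OF x(1)] *
        by (intro Res_carrier_disjoint[of x "{\<mu>}" T]) auto
      with x show False by simp
    qed
  qed
  ultimately show "is_weight_module M \<and> supp M \<subseteq> T" ..
qed

end

lemma weyl_module_iff:
  fixes M :: "(('a::finite) oper, 'u) module"
  shows "left_module Weyl M \<longleftrightarrow> weyl_like_module Weyl M weyl_carrier"
proof -
  have "(Weyl :: 'a oper ring) = Weyl\<lparr>carrier := weyl_carrier\<rparr>" by (simp add: Weyl_def)
  then show ?thesis
    by (auto simp: weyl_like_module_def weyl_like_module_axioms_def even_ops_subset)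
qed

lemma weyl_ev_module_iff: "left_module Weyl_ev M \<longleftrightarrow> weyl_like_module Weyl_ev M even_ops"
  by (auto simp: weyl_like_module_def weyl_like_module_axioms_def even_ops_subset Weyl_ev_eq)

section \<open>Tensor products over a subring\<close>

definition pure_tensor ::
    "('r, 'c) ring_scheme \<Rightarrow> ('r, 'd) ring_scheme \<Rightarrow> ('r, 'm) module \<Rightarrow> 'r \<Rightarrow> 'm \<Rightarrow>
       ('r \<times> 'm \<Rightarrow>\<^sub>0 int) set" where
  "pure_tensor S R M a m = tensor_null S R M #>\<^bsub>tensor_free S M\<^esub> frag_of (a, m)"

lemma tensor_relations_cases [consumes 1, case_names left right balanced]:
  assumes "x \<in> tensor_relations S R M"
  obtains a b m where "x = frag_of (a \<oplus>\<^bsub>S\<^esub> b, m) - frag_of (a, m) - frag_of (b, m)"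
      "a \<in> carrier S" "b \<in> carrier S" "m \<in> carrier M"
    | a m m' where "x = frag_of (a, m \<oplus>\<^bsub>M\<^esub> m') - frag_of (a, m) - frag_of (a, m')"
      "a \<in> carrier S" "m \<in> carrier M" "m' \<in> carrier M"
    | a r m where "x = frag_of (a \<otimes>\<^bsub>S\<^esub> r, m) - frag_of (a, r \<odot>\<^bsub>M\<^esub> m)"
      "a \<in> carrier S" "r \<in> carrier R" "m \<in> carrier M"
  using assms unfolding tensor_relations_def by blast

lemma tensor_relations_intros:
  "\<lbrakk>a \<in> carrier S; b \<in> carrier S; m \<in> carrier M\<rbrakk> \<Longrightarrow>
     frag_of (a \<oplus>\<^bsub>S\<^esub> b, m) - frag_of (a, m) - frag_of (b, m) \<in> tensor_relations S R M"
  "\<lbrakk>a \<in> carrier S; m \<in> carrier M; m' \<in> carrier M\<rbrakk> \<Longrightarrow>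
     frag_of (a, m \<oplus>\<^bsub>M\<^esub> m') - frag_of (a, m) - frag_of (a, m') \<in> tensor_relations S R M"
  "\<lbrakk>a \<in> carrier S; r \<in> carrier R; m \<in> carrier M\<rbrakk> \<Longrightarrow>
     frag_of (a \<otimes>\<^bsub>S\<^esub> r, m) - frag_of (a, r \<odot>\<^bsub>M\<^esub> m) \<in> tensor_relations S R M"
  unfolding tensor_relations_def by blast+

locale tensor_product = S?: ring S + left_module R M
  for S :: "('r, 'c) ring_scheme" and R :: "('r, 'd) ring_scheme" and M :: "('r, 'm) module" +
  assumes R_subset: "carrier R \<subseteq> carrier S"
begin

abbreviation "F \<equiv> tensor_free S M"
abbreviation "N \<equiv> tensor_null S R M"
abbreviation "T \<equiv> tensor S R M"
abbreviation "cls x \<equiv> N #>\<^bsub>F\<^esub> x"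

lemma F_simps [simp]:
  "x \<in> carrier F \<longleftrightarrow> Poly_Mapping.keys x \<subseteq> carrier S \<times> carrier M"
  "x \<otimes>\<^bsub>F\<^esub> y = x + y"
  "\<one>\<^bsub>F\<^esub> = 0"
  by (simp_all add: tensor_free_def)

lemma comm_group_F: "comm_group F"
  unfolding tensor_free_def by (rule abelian_free_Abelian_group)

sublocale F: comm_group F by (rule comm_group_F)

lemma F_minus: "x \<in> carrier F \<Longrightarrow> y \<in> carrier F \<Longrightarrow> x - y \<in> carrier F"
  using keys_diff[of x y] by auto

lemma F_plus: "x \<in> carrier F \<Longrightarrow> y \<in> carrier F \<Longrightarrow> x + y \<in> carrier F"
  using F.m_closed[of x y] by (simp del: F_simps(1))

lemma frag_of_F: "a \<in> carrier S \<Longrightarrow> m \<in> carrier M \<Longrightarrow> frag_of (a, m) \<in> carrier F"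
  by simp

lemma relations_F: "tensor_relations S R M \<subseteq> carrier F"
proof -
  have "a \<otimes>\<^bsub>S\<^esub> r \<in> carrier S \<and> r \<odot>\<^bsub>M\<^esub> x \<in> carrier M"
    if "a \<in> carrier S" "r \<in> carrier R" "x \<in> carrier M" for a r x
    using that R_subset smult_closed by auto
  then show ?thesis
    unfolding tensor_relations_def
    by (auto simp del: F_simps(1) intro!: F_minus frag_of_F)
qed

lemma subgroup_N: "subgroup N F"
  unfolding tensor_null_def by (rule F.generate_is_subgroup[OF relations_F])

sublocale N: normal N F
  using subgroup_N F.subgroup_imp_normal by blast

lemma N_F: "x \<in> N \<Longrightarrow> x \<in> carrier F"
  using N.subset by blast

lemma N_zero: "0 \<in> N"
  using N.one_closed by simp

lemma N_plus: "x \<in> N \<Longrightarrow> y \<in> N \<Longrightarrow> x + y \<in> N"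
  using N.m_closed by simp

lemma N_uminus: "x \<in> N \<Longrightarrow> - x \<in> N"
  using N.m_inv_closed[of x] N_F[of x] by (simp add: tensor_free_def)

lemma N_minus: "x \<in> N \<Longrightarrow> y \<in> N \<Longrightarrow> x - y \<in> N"
  using N_plus[OF _ N_uminus] by fastforce

lemma cls_eq_iff:
  assumes "x \<in> carrier F" "y \<in> carrier F"
  shows "cls x = cls y \<longleftrightarrow> x - y \<in> N"
proof
  assume "cls x = cls y"
  then have "x \<in> cls y" using F.rcos_self[OF assms(1) subgroup_N] by simp
  then show "x - y \<in> N" by (auto simp: r_coset_def)
next
  assume "x - y \<in> N"
  then have "x \<in> cls y" by (force simp: r_coset_def)
  then show "cls x = cls y"
    using F.repr_independence[OF _ assms(2) subgroup_N] by simp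
qed

lemma mem_clsD: "x \<in> cls y \<Longrightarrow> y \<in> carrier F \<Longrightarrow> x \<in> carrier F \<and> x - y \<in> N"
  using N_F F_plus by (auto simp: r_coset_def simp del: F_simps(1))

lemma T_simps:
  "carrier T = cls ` carrier F"
  "\<zero>\<^bsub>T\<^esub> = cls 0"
  "add T = set_mult F"
  using F.coset_mult_one[OF N.subset]
  by (auto simp: tensor_def Let_def carrier_FactGroup)

lemma T_add: "x \<in> carrier F \<Longrightarrow> y \<in> carrier F \<Longrightarrow> cls x \<oplus>\<^bsub>T\<^esub> cls y = cls (x + y)"
  using N.rcos_sum[of x y] by (simp add: T_simps)

lemma abelian_group_T: "abelian_group T"
proof -
  interpret Q: comm_group "F Mod N"
    by (rule F.abelian_FactGroup[OF subgroup_N])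
  have eq: "carrier T = carrier (F Mod N)" "add T = mult (F Mod N)" "\<zero>\<^bsub>T\<^esub> = \<one>\<^bsub>F Mod N\<^esub>"
    by (simp_all add: tensor_def Let_def)
  show ?thesis
    by (rule abelian_groupI)
      (use Q.l_inv_ex Q.m_closed Q.m_assoc Q.m_comm in \<open>auto simp: eq simp del: mult_FactGroup one_FactGroup\<close>)
qed

sublocale T: abelian_group T by (rule abelian_group_T)

lemma F_induct [consumes 1, case_names zero diff gen]:
  assumes "x \<in> carrier F" "P 0"
    "\<And>x y. x \<in> carrier F \<Longrightarrow> y \<in> carrier F \<Longrightarrow> P x \<Longrightarrow> P y \<Longrightarrow> P (x - y)"
    "\<And>a m. a \<in> carrier S \<Longrightarrow> m \<in> carrier M \<Longrightarrow> P (frag_of (a, m))"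
  shows "P x"
  using free_Abelian_group_induct[of x "carrier S \<times> carrier M" P] assms by auto

lemma N_induct [consumes 1, case_names zero add uminus gen]:
  assumes "x \<in> N" "P 0"
    "\<And>x y. P x \<Longrightarrow> P y \<Longrightarrow> P (x + y)" "\<And>x. P x \<Longrightarrow> P (- x)"
    "\<And>x. x \<in> tensor_relations S R M \<Longrightarrow> P x"
  shows "P x"
proof -
  from assms(1) have "x \<in> generate F (tensor_relations S R M)" by (simp add: tensor_null_def)
  then show ?thesis
  proof (induction rule: generate.induct)
    case (inv h)
    then have "inv\<^bsub>F\<^esub> h = - h" using relations_F by (auto simp: tensor_free_def)
    then show ?case using assms inv by simp
  qed (use assms in auto)
qed

lemma relation_N: "x \<in> tensor_relations S R M \<Longrightarrow> x \<in> N"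
  by (simp add: tensor_null_def generate.incl)

abbreviation "pt \<equiv> pure_tensor S R M"

lemma pt_closed: "a \<in> carrier S \<Longrightarrow> m \<in> carrier M \<Longrightarrow> pt a m \<in> carrier T"
  by (auto simp: T_simps pure_tensor_def)

lemma pt_add_left:
  assumes "a \<in> carrier S" "b \<in> carrier S" "m \<in> carrier M"
  shows "pt (a \<oplus>\<^bsub>S\<^esub> b) m = pt a m \<oplus>\<^bsub>T\<^esub> pt b m"
proof -
  have "frag_of (a \<oplus>\<^bsub>S\<^esub> b, m) - frag_of (a, m) - frag_of (b, m) \<in> N"
    by (rule relation_N) (use assms in \<open>simp add: tensor_relations_intros\<close>)
  then have "frag_of (a \<oplus>\<^bsub>S\<^esub> b, m) - (frag_of (a, m) + frag_of (b, m)) \<in> N"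
    by (simp add: algebra_simps)
  then show ?thesis
    using assms frag_of_F F_plus unfolding pure_tensor_def
    by (simp add: T_add cls_eq_iff del: F_simps(1))
qed

lemma pt_add_right:
  assumes "a \<in> carrier S" "m \<in> carrier M" "m' \<in> carrier M"
  shows "pt a (m \<oplus>\<^bsub>M\<^esub> m') = pt a m \<oplus>\<^bsub>T\<^esub> pt a m'"
proof -
  have "frag_of (a, m \<oplus>\<^bsub>M\<^esub> m') - frag_of (a, m) - frag_of (a, m') \<in> N"
    by (rule relation_N) (use assms in \<open>simp add: tensor_relations_intros\<close>)
  then have "frag_of (a, m \<oplus>\<^bsub>M\<^esub> m') - (frag_of (a, m) + frag_of (a, m')) \<in> N"
    by (simp add: algebra_simps)
  then show ?thesis
    using assms frag_of_F F_plus unfolding pure_tensor_def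
    by (simp add: T_add cls_eq_iff del: F_simps(1))
qed

lemma pt_balanced:
  assumes "a \<in> carrier S" "r \<in> carrier R" "m \<in> carrier M"
  shows "pt (a \<otimes>\<^bsub>S\<^esub> r) m = pt a (r \<odot>\<^bsub>M\<^esub> m)"
proof -
  have "frag_of (a \<otimes>\<^bsub>S\<^esub> r, m) - frag_of (a, r \<odot>\<^bsub>M\<^esub> m) \<in> N"
    by (rule relation_N) (use assms in \<open>simp add: tensor_relations_intros\<close>)
  moreover have "r \<in> carrier S" using assms R_subset by auto
  ultimately show ?thesis
    using assms smult_closed unfolding pure_tensor_def
    by (subst cls_eq_iff) (simp_all add: frag_of_F del: F_simps(1))
qed

lemma pt_zero_right:
  assumes "a \<in> carrier S" shows "pt a \<zero>\<^bsub>M\<^esub> = \<zero>\<^bsub>T\<^esub>"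
proof -
  have "pt a \<zero>\<^bsub>M\<^esub> = pt a \<zero>\<^bsub>M\<^esub> \<oplus>\<^bsub>T\<^esub> pt a \<zero>\<^bsub>M\<^esub>"
    using pt_add_right[OF assms, of "\<zero>\<^bsub>M\<^esub>" "\<zero>\<^bsub>M\<^esub>"] by simp
  then show ?thesis using pt_closed[OF assms M.zero_closed] T.add.l_cancel_one' by blast
qed

lemma cls_uminus_pt:
  assumes "a \<in> carrier S" "m \<in> carrier M"
  shows "cls (- frag_of (a, m)) = pt a (\<ominus>\<^bsub>M\<^esub> m)"
proof -
  have "pt a (\<ominus>\<^bsub>M\<^esub> m) \<oplus>\<^bsub>T\<^esub> pt a m = \<zero>\<^bsub>T\<^esub>"
    using assms pt_add_right[of a "\<ominus>\<^bsub>M\<^esub> m" m] by (simp add: M.l_neg pt_zero_right)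
  then have "cls (frag_of (a, \<ominus>\<^bsub>M\<^esub> m) + frag_of (a, m)) = cls 0"
    using assms frag_of_F by (simp add: T_add T_simps(2) pure_tensor_def del: F_simps(1))
  then have "frag_of (a, \<ominus>\<^bsub>M\<^esub> m) + frag_of (a, m) \<in> N"
    using assms by (subst (asm) cls_eq_iff) (auto simp: frag_of_F F_plus simp del: F_simps(1),
        simp)
  from N_uminus[OF this] show ?thesis
    unfolding pure_tensor_def using assms
    by (subst cls_eq_iff) (auto simp: algebra_simps)
qed

text \<open>
  Sums of pure tensors suffice, without differences, since \<open>-(a \<otimes> m) = a \<otimes> (-m)\<close>.
\<close>

lemma T_induct [consumes 1, case_names zero add pure]:
  assumes X: "X \<in> carrier T" and zero: "P \<zero>\<^bsub>T\<^esub>"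
    and add: "\<And>X Y. X \<in> carrier T \<Longrightarrow> Y \<in> carrier T \<Longrightarrow> P X \<Longrightarrow> P Y \<Longrightarrow> P (X \<oplus>\<^bsub>T\<^esub> Y)"
    and pure: "\<And>a m. a \<in> carrier S \<Longrightarrow> m \<in> carrier M \<Longrightarrow> P (pt a m)"
  shows "P X"
proof -
  from X obtain x where x: "x \<in> carrier F" and X: "X = cls x" by (auto simp: T_simps)
  \<comment> \<open>The induction on free generators produces differences, so negatives are carried along.\<close>
  from x have "P (cls x) \<and> P (cls (- x))"
  proof (induction rule: F_induct)
    case zero
    then show ?case using assms(2) by (simp add: T_simps)
  next
    case (diff x y)
    have mx: "- x \<in> carrier F" "- y \<in> carrier F" using diff by auto
    have "P (cls (x + - y))" "P (cls (- x + y))"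
      using diff mx add[of "cls x" "cls (- y)"] add[of "cls (- x)" "cls y"]
      by (auto simp: T_add T_simps(1) simp del: F_simps(1))
    then show ?case by (simp add: algebra_simps)
  next
    case (gen a m)
    then show ?case using pure[of a m] pure[of a "\<ominus>\<^bsub>M\<^esub> m"]
      by (simp add: cls_uminus_pt) (simp add: pure_tensor_def)
  qed
  then show ?thesis by (simp add: X)
qed

text \<open>
  The universal property. The target is a plain abelian group, which allows targets on which
  \<open>S\<close> does not act, such as \<open>M\<close> itself.
\<close>

lemma tensor_lift:
  assumes G: "abelian_group G"
    and closed: "\<And>a m. a \<in> carrier S \<Longrightarrow> m \<in> carrier M \<Longrightarrow> \<beta> a m \<in> carrier G"
    and add_left: "\<And>a b m. a \<in> carrier S \<Longrightarrow> b \<in> carrier S \<Longrightarrow> m \<in> carrier M \<Longrightarrow>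
      \<beta> (a \<oplus>\<^bsub>S\<^esub> b) m = \<beta> a m \<oplus>\<^bsub>G\<^esub> \<beta> b m"
    and add_right: "\<And>a m m'. a \<in> carrier S \<Longrightarrow> m \<in> carrier M \<Longrightarrow> m' \<in> carrier M \<Longrightarrow>
      \<beta> a (m \<oplus>\<^bsub>M\<^esub> m') = \<beta> a m \<oplus>\<^bsub>G\<^esub> \<beta> a m'"
    and balanced_\<beta>: "\<And>a r m. a \<in> carrier S \<Longrightarrow> r \<in> carrier R \<Longrightarrow> m \<in> carrier M \<Longrightarrow>
      \<beta> (a \<otimes>\<^bsub>S\<^esub> r) m = \<beta> a (r \<odot>\<^bsub>M\<^esub> m)"
  shows "\<exists>\<phi>. (\<forall>X\<in>carrier T. \<phi> X \<in> carrier G) \<and>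
    (\<forall>X\<in>carrier T. \<forall>Y\<in>carrier T. \<phi> (X \<oplus>\<^bsub>T\<^esub> Y) = \<phi> X \<oplus>\<^bsub>G\<^esub> \<phi> Y) \<and>
    (\<forall>a\<in>carrier S. \<forall>m\<in>carrier M. \<phi> (pt a m) = \<beta> a m)"
proof -
  interpret G: abelian_group G by fact
  have "case_prod \<beta> ` (carrier S \<times> carrier M) \<subseteq> carrier (add_monoid G)"
    using closed by auto
  then obtain h where h: "h \<in> hom F (add_monoid G)"
    and hgen: "\<And>x. x \<in> carrier S \<times> carrier M \<Longrightarrow> h (frag_of x) = case_prod \<beta> x"
    using comm_group.free_Abelian_group_universal[OF G.a_comm_group] unfolding tensor_free_def
    by metis
  have hclosed: "h x \<in> carrier G" if "x \<in> carrier F" for x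
    using h that by (auto simp: hom_def simp del: F_simps(1))
  have hadd: "h (x + y) = h x \<oplus>\<^bsub>G\<^esub> h y" if "x \<in> carrier F" "y \<in> carrier F" for x y
    using h that by (auto simp: hom_def simp del: F_simps(1))
  have h0: "h 0 = \<zero>\<^bsub>G\<^esub>"
    using hadd[of 0 0] hclosed[of 0] by (simp add: G.add.l_cancel_one')
  have hminus: "h (x - y) = h x \<ominus>\<^bsub>G\<^esub> h y" if xy: "x \<in> carrier F" "y \<in> carrier F" for x y
  proof -
    have "h x = h (x - y) \<oplus>\<^bsub>G\<^esub> h y" using hadd[OF F_minus[OF xy] xy(2)] by simp
    then show ?thesis using hclosed[OF xy(2)] hclosed[OF F_minus[OF xy]]
      by (simp add: a_minus_def G.a_assoc G.r_neg)
  qed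
  have hgen': "h (frag_of (a, m)) = \<beta> a m" if "a \<in> carrier S" "m \<in> carrier M" for a m
    using hgen that by auto
  have cancel: "u \<oplus>\<^bsub>G\<^esub> v \<ominus>\<^bsub>G\<^esub> u \<ominus>\<^bsub>G\<^esub> v = \<zero>\<^bsub>G\<^esub>" if "u \<in> carrier G" "v \<in> carrier G" for u v
  proof -
    have "u \<oplus>\<^bsub>G\<^esub> v \<ominus>\<^bsub>G\<^esub> u \<ominus>\<^bsub>G\<^esub> v = (u \<oplus>\<^bsub>G\<^esub> v) \<oplus>\<^bsub>G\<^esub> \<ominus>\<^bsub>G\<^esub> (u \<oplus>\<^bsub>G\<^esub> v)"
      using that by (simp add: a_minus_def G.minus_add G.a_assoc)
    then show ?thesis using that by (simp add: G.r_neg)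
  qed
  have hrel: "h x = \<zero>\<^bsub>G\<^esub>" if x: "x \<in> tensor_relations S R M" for x
  proof -
    from x show ?thesis
    proof (cases rule: tensor_relations_cases)
      case (left a b m)
      then show ?thesis using closed
        by (simp add: hminus F_minus frag_of_F hgen' add_left cancel
            del: F_simps(1))
    next
      case (right a m m')
      then show ?thesis using closed
        by (simp add: hminus F_minus frag_of_F hgen' add_right cancel
            del: F_simps(1))
    next
      case (balanced a r m)
      moreover have "r \<in> carrier S" using balanced(3) R_subset by auto
      ultimately show ?thesis using closed smult_closed
        by (simp add: hminus frag_of_F hgen' balanced_\<beta> a_minus_def G.r_neg del: F_simps(1))
    qed
  qed
  have hN: "h x = \<zero>\<^bsub>G\<^esub>" if "x \<in> N" for x
  proof -
    from that have "x \<in> carrier F \<and> h x = \<zero>\<^bsub>G\<^esub>"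
    proof (induction rule: N_induct)
      case (uminus x)
      then show ?case using hminus[of 0 x] h0 by (simp add: a_minus_def)
    next
      case (gen x)
      then show ?case using hrel relations_F by blast
    qed (use h0 hadd F_plus in \<open>auto simp del: F_simps(1)\<close>, simp)
    then show ?thesis ..
  qed
  \<comment> \<open>The map is evaluated on an arbitrary representative: two of them differ by a relation.\<close>
  define \<phi> where "\<phi> X = h (SOME x. x \<in> X)" for X
  have \<phi>: "\<phi> (cls x) = h x" if x: "x \<in> carrier F" for x
  proof -
    have "(SOME y. y \<in> cls x) \<in> cls x"
      using F.rcos_self[OF x subgroup_N] by (rule someI)
    from mem_clsD[OF this x] have y: "(SOME y. y \<in> cls x) \<in> carrier F"
      and "(SOME y. y \<in> cls x) - x \<in> N" by auto
    then have "h ((SOME y. y \<in> cls x) - x) = \<zero>\<^bsub>G\<^esub>" using hN by blast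
    moreover have "h (SOME y. y \<in> cls x) = h ((SOME y. y \<in> cls x) - x) \<oplus>\<^bsub>G\<^esub> h x"
      using hadd[OF F_minus[OF y x] x] by simp
    ultimately show ?thesis using hclosed[OF x] by (simp add: \<phi>_def)
  qed
  show ?thesis
  proof (intro exI[of _ \<phi>] conjI ballI)
    show "\<phi> X \<in> carrier G" if "X \<in> carrier T" for X
      using that \<phi> hclosed by (auto simp: T_simps simp del: F_simps(1))
    show "\<phi> (X \<oplus>\<^bsub>T\<^esub> Y) = \<phi> X \<oplus>\<^bsub>G\<^esub> \<phi> Y" if XY: "X \<in> carrier T" "Y \<in> carrier T" for X Y
    proof -
      from XY obtain x y where "X = cls x" "Y = cls y" "x \<in> carrier F" "y \<in> carrier F"
        by (auto simp: T_simps(1))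
      then show ?thesis using \<phi> hadd F_plus by (simp add: T_add del: F_simps(1))
    qed
    show "\<phi> (pt a m) = \<beta> a m" if "a \<in> carrier S" "m \<in> carrier M" for a m
      using that hgen' \<phi>[of "frag_of (a, m)"] by (simp add: pure_tensor_def)
  qed
qed

text \<open>
  All representatives contribute the same coset to the union once the map sends relations to
  relations. Both the action of \<open>S\<close> and the functoriality of the tensor product are unions of this form.
\<close>

lemma coset_map_cls:
  fixes h :: "('r \<times> 'm \<Rightarrow>\<^sub>0 int) \<Rightarrow> ('r2 \<times> 'm2 \<Rightarrow>\<^sub>0 int)"
  assumes tp: "tensor_product S' R' M'"
    and h: "h 0 = 0" "\<And>x y. h (x + y) = h x + h y" "\<And>x. h (- x) = - h x"
    and hF: "\<And>x. x \<in> carrier F \<Longrightarrow> h x \<in> carrier (tensor_free S' M')"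
    and hN: "\<And>x. x \<in> tensor_relations S R M \<Longrightarrow> h x \<in> tensor_null S' R' M'"
    and x: "x \<in> carrier F"
  shows "(\<Union>y\<in>cls x. tensor_null S' R' M' #>\<^bsub>tensor_free S' M'\<^esub> h y) =
     tensor_null S' R' M' #>\<^bsub>tensor_free S' M'\<^esub> h x"
proof -
  interpret T': tensor_product S' R' M' by fact
  have N: "h y \<in> T'.N" if "y \<in> N" for y
    using that by (induction rule: N_induct) (auto simp: h hN T'.N_zero T'.N_plus T'.N_uminus)
  have "T'.cls (h y) = T'.cls (h x)" if "y \<in> cls x" for y
  proof -
    have y: "y \<in> carrier F" "y - x \<in> N" using mem_clsD[OF that x] by auto
    have "h y - h x = h (y - x)" using h(2)[of y "- x"] h(3)[of x] by simp
    then show ?thesis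
      using N[OF y(2)] hF[OF y(1)] hF[OF x] by (subst T'.cls_eq_iff) (auto simp del: F_simps(1) T'.F_simps(1))
  qed
  then show ?thesis using F.rcos_self[OF x subgroup_N] by blast
qed

abbreviation "act a \<equiv> frag_extend (\<lambda>(b, m). frag_of (a \<otimes>\<^bsub>S\<^esub> b, m))"

lemma act_F:
  assumes "a \<in> carrier S" "x \<in> carrier F" shows "act a x \<in> carrier F"
  using assms(2)
  by (induction rule: F_induct)
    (use assms(1) in \<open>auto simp: frag_extend_diff F_minus simp del: F_simps(1) intro!: frag_of_F\<close>,
      simp)

lemma T_smult_cls:
  assumes a: "a \<in> carrier S" and x: "x \<in> carrier F"
  shows "a \<odot>\<^bsub>T\<^esub> cls x = cls (act a x)"
proof -
  have "act a x \<in> N" if "x \<in> tensor_relations S R M" for x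
  proof -
    from that have "act a x \<in> tensor_relations S R M"
    proof (cases rule: tensor_relations_cases)
      case (left b c m)
      then have "act a x = frag_of (a \<otimes>\<^bsub>S\<^esub> b \<oplus>\<^bsub>S\<^esub> a \<otimes>\<^bsub>S\<^esub> c, m) - frag_of (a \<otimes>\<^bsub>S\<^esub> b, m) - frag_of (a \<otimes>\<^bsub>S\<^esub> c, m)"
        using a by (simp add: frag_extend_diff S.r_distr)
      then show ?thesis using left a S.m_closed by (simp add: tensor_relations_intros)
    next
      case (right b m m')
      then have "act a x = frag_of (a \<otimes>\<^bsub>S\<^esub> b, m \<oplus>\<^bsub>M\<^esub> m') - frag_of (a \<otimes>\<^bsub>S\<^esub> b, m) - frag_of (a \<otimes>\<^bsub>S\<^esub> b, m')"
        using a by (simp add: frag_extend_diff)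
      then show ?thesis using right a S.m_closed by (simp add: tensor_relations_intros)
    next
      case (balanced b r m)
      moreover have "r \<in> carrier S" using balanced R_subset by auto
      ultimately have "act a x = frag_of ((a \<otimes>\<^bsub>S\<^esub> b) \<otimes>\<^bsub>S\<^esub> r, m) - frag_of (a \<otimes>\<^bsub>S\<^esub> b, r \<odot>\<^bsub>M\<^esub> m)"
        using a by (simp add: frag_extend_diff S.m_assoc)
      then show ?thesis using balanced a S.m_closed by (simp add: tensor_relations_intros)
    qed
    then show ?thesis by (rule relation_N)
  qed
  then have "(\<Union>y\<in>cls x. cls (act a y)) = cls (act a x)"
    using a x act_F by (intro coset_map_cls[OF tensor_product_axioms])
      (auto simp: frag_extend_add frag_extend_minus simp del: F_simps(1))
  then show ?thesis by (simp add: tensor_def Let_def)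
qed

lemma T_smult_pt:
  assumes "a \<in> carrier S" "b \<in> carrier S" "m \<in> carrier M"
  shows "a \<odot>\<^bsub>T\<^esub> pt b m = pt (a \<otimes>\<^bsub>S\<^esub> b) m"
  using assms T_smult_cls[OF assms(1) frag_of_F[OF assms(2,3)]] by (simp add: pure_tensor_def)

lemma left_module_T: "left_module S T"
proof (rule left_module.intro[OF S.ring_axioms abelian_group_T], rule left_module_axioms.intro)
  fix a X assume a: "a \<in> carrier S" and "X \<in> carrier T"
  then obtain x where x: "x \<in> carrier F" "X = cls x" by (auto simp: T_simps)
  then show "a \<odot>\<^bsub>T\<^esub> X \<in> carrier T"
    using a act_F by (auto simp: T_smult_cls T_simps simp del: F_simps(1))
next
  fix a X Y assume a: "a \<in> carrier S" and "X \<in> carrier T" "Y \<in> carrier T"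
  then obtain x y where x: "x \<in> carrier F" "X = cls x" and y: "y \<in> carrier F" "Y = cls y"
    by (auto simp: T_simps(1))
  then show "a \<odot>\<^bsub>T\<^esub> (X \<oplus>\<^bsub>T\<^esub> Y) = a \<odot>\<^bsub>T\<^esub> X \<oplus>\<^bsub>T\<^esub> a \<odot>\<^bsub>T\<^esub> Y"
    using a act_F F_plus by (simp add: T_smult_cls T_add frag_extend_add del: F_simps(1))
next
  fix a b X assume ab: "a \<in> carrier S" "b \<in> carrier S" and "X \<in> carrier T"
  then obtain x where x: "x \<in> carrier F" and X: "X = cls x" by (auto simp: T_simps)
  from x have "cls (act (a \<oplus>\<^bsub>S\<^esub> b) x) = cls (act a x + act b x)"
  proof -
    from x have "act (a \<oplus>\<^bsub>S\<^esub> b) x - (act a x + act b x) \<in> N"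
    proof (induction rule: F_induct)
      case (diff x y)
      from N_minus[OF diff(3,4)] show ?case by (simp add: frag_extend_diff algebra_simps)
    next
      case (gen c m)
      have "frag_of (a \<otimes>\<^bsub>S\<^esub> c \<oplus>\<^bsub>S\<^esub> b \<otimes>\<^bsub>S\<^esub> c, m) - frag_of (a \<otimes>\<^bsub>S\<^esub> c, m) - frag_of (b \<otimes>\<^bsub>S\<^esub> c, m) \<in> N"
        using gen ab S.m_closed by (intro relation_N tensor_relations_intros) auto
      then show ?case using gen ab by (simp add: S.l_distr algebra_simps)
    qed (simp add: N_zero)
    then show ?thesis using x ab act_F F_plus by (subst cls_eq_iff) (auto simp del: F_simps(1))
  qed
  then show "(a \<oplus>\<^bsub>S\<^esub> b) \<odot>\<^bsub>T\<^esub> X = a \<odot>\<^bsub>T\<^esub> X \<oplus>\<^bsub>T\<^esub> b \<odot>\<^bsub>T\<^esub> X"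
    using x ab act_F unfolding X by (simp add: T_smult_cls T_add del: F_simps(1))
next
  fix a b X assume ab: "a \<in> carrier S" "b \<in> carrier S" and "X \<in> carrier T"
  then obtain x where x: "x \<in> carrier F" and X: "X = cls x" by (auto simp: T_simps)
  from x have "act (a \<otimes>\<^bsub>S\<^esub> b) x = act a (act b x)"
    by (induction rule: F_induct) (use ab in \<open>auto simp: frag_extend_diff S.m_assoc\<close>)
  then show "(a \<otimes>\<^bsub>S\<^esub> b) \<odot>\<^bsub>T\<^esub> X = a \<odot>\<^bsub>T\<^esub> (b \<odot>\<^bsub>T\<^esub> X)"
    using x ab act_F unfolding X by (simp add: T_smult_cls del: F_simps(1))
next
  fix X assume "X \<in> carrier T"
  then obtain x where x: "x \<in> carrier F" and X: "X = cls x" by (auto simp: T_simps)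
  from x have "act \<one>\<^bsub>S\<^esub> x = x"
    by (induction rule: F_induct) (auto simp: frag_extend_diff)
  then show "\<one>\<^bsub>S\<^esub> \<odot>\<^bsub>T\<^esub> X = X"
    using x unfolding X by (simp add: T_smult_cls del: F_simps(1))
qed

end

lemma tensor_map_pure:
  assumes tp: "tensor_product S R M" "tensor_product S R M'"
    and f: "f \<in> module_hom R M M'"
  shows "a \<in> carrier S \<Longrightarrow> m \<in> carrier M \<Longrightarrow>
      tensor_map S R M M' f (pure_tensor S R M a m) = pure_tensor S R M' a (f m)" (is "PROP ?A")
    and "X \<in> carrier (tensor S R M) \<Longrightarrow> tensor_map S R M M' f X \<in> carrier (tensor S R M')" (is "PROP ?B")
    and "X \<in> carrier (tensor S R M) \<Longrightarrow> Y \<in> carrier (tensor S R M) \<Longrightarrow>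
      tensor_map S R M M' f (X \<oplus>\<^bsub>tensor S R M\<^esub> Y) =
        tensor_map S R M M' f X \<oplus>\<^bsub>tensor S R M'\<^esub> tensor_map S R M M' f Y" (is "PROP ?C")
proof -
  interpret A: tensor_product S R M by fact
  interpret B: tensor_product S R M' by fact
  let ?h = "frag_extend (\<lambda>(b, m). frag_of (b, f m))"
  have fc: "f m \<in> carrier M'" if "m \<in> carrier M" for m
    using f that by (auto simp: module_hom_def)
  have hF: "?h x \<in> carrier B.F" if "x \<in> carrier A.F" for x
    using that by (induction rule: A.F_induct)
      (auto simp: frag_extend_diff B.F_minus fc simp del: B.F_simps(1) intro!: B.frag_of_F, simp)
  have hN: "?h x \<in> B.N" if "x \<in> tensor_relations S R M" for x
  proof (rule B.relation_N)
    from that show "?h x \<in> tensor_relations S R M'"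
    proof (cases rule: tensor_relations_cases)
      case (left b c m)
      then have "?h x = frag_of (b \<oplus>\<^bsub>S\<^esub> c, f m) - frag_of (b, f m) - frag_of (c, f m)"
        by (simp add: frag_extend_diff)
      then show ?thesis using left fc by (simp add: tensor_relations_intros)
    next
      case (right b m m')
      then have "?h x = frag_of (b, f m \<oplus>\<^bsub>M'\<^esub> f m') - frag_of (b, f m) - frag_of (b, f m')"
        using f by (simp add: frag_extend_diff module_hom_def)
      then show ?thesis using right fc by (simp add: tensor_relations_intros)
    next
      case (balanced b r m)
      then have "?h x = frag_of (b \<otimes>\<^bsub>S\<^esub> r, f m) - frag_of (b, r \<odot>\<^bsub>M'\<^esub> f m)"
        using f by (simp add: frag_extend_diff module_hom_def)
      then show ?thesis using balanced fc by (simp add: tensor_relations_intros)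
    qed
  qed
  have map_cls: "tensor_map S R M M' f (A.cls x) = B.cls (?h x)" if "x \<in> carrier A.F" for x
    unfolding tensor_map_def
    by (rule A.coset_map_cls[OF tp(2) _ _ _ hF hN that])
      (auto simp: frag_extend_add frag_extend_minus)
  show "PROP ?A"
    using map_cls[OF A.frag_of_F] by (simp add: pure_tensor_def)
  show "PROP ?B"
    using map_cls hF by (auto simp: A.T_simps B.T_simps simp del: A.F_simps(1) B.F_simps(1))
  show "PROP ?C"
    using map_cls hF A.F_plus
    by (auto simp: A.T_simps(1) A.T_add B.T_add frag_extend_add simp del: A.F_simps(1) B.F_simps(1))
qed

section \<open>Odd operators and the strong grading\<close>

definition odd_ops :: "('n::finite) oper set" where
  "odd_ops = {a \<in> weyl_carrier. \<forall>p. reflect (a (reflect p)) = - a p}"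

lemma odd_ops_subset: "odd_ops \<subseteq> weyl_carrier"
  by (auto simp: odd_ops_def)

lemma tvar_odd: "tvar i \<in> odd_ops"
  by (simp add: odd_ops_def weyl_carrier.tvar reflect_tvar scal_minus_one)

lemma pdiff_odd: "pdiff i \<in> odd_ops"
  by (simp add: odd_ops_def weyl_carrier.pdiff reflect_pdiff scal_minus_one)

lemma weyl_uminus: "a \<in> weyl_carrier \<Longrightarrow> a (- p) = - a p"
  using weyl_linear(2)[of a "-1" p] by (simp add: scal_minus_one)

lemma odd_odd: 
  assumes "a \<in> odd_ops" "b \<in> odd_ops" shows "a \<circ> b \<in> even_ops"
proof -
  have "reflect (a (b (reflect p))) = a (b p)" for p
  proof -
    have "reflect (a (b (reflect p))) = reflect (a (reflect (reflect (b (reflect p)))))" by simp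
    also have "\<dots> = a (b p)" using assms by (simp add: odd_ops_def weyl_uminus)
    finally show ?thesis .
  qed
  then show ?thesis using assms by (simp add: even_ops_def odd_ops_def weyl_carrier.comp)
qed

text \<open>
  The canonical commutation relation multiplied by \<open>a\<close>. For odd \<open>a\<close> the inner factors \<open>t\<^sub>i a\<close> and
  \<open>- \<partial>\<^sub>i a\<close> are even, so the odd operators are generated by two elements over the even ones.
\<close>

lemma odd_decomposition:
  "(\<lambda>p. (pdiff i \<circ> (tvar i \<circ> a)) p + (tvar i \<circ> (scal (-1) \<circ> (pdiff i \<circ> a))) p) = a"
proof
  fix p
  show "(pdiff i \<circ> (tvar i \<circ> a)) p + (tvar i \<circ> (scal (-1) \<circ> (pdiff i \<circ> a))) p = a p"
    using canonical_commutation[of i "a p"]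
    by (simp add: scal_minus_one weyl_uminus[OF weyl_carrier.tvar])
qed

lemma even_odd_decomposition:
  assumes "a \<in> weyl_carrier"
  obtains b where "b \<in> odd_ops" "a = (\<lambda>p. even_part a p + b p)"
proof
  have e: "even_part a \<in> even_ops" using even_part_in_even_ops[OF assms] .
  let ?b = "\<lambda>p. a p + (scal (-1) \<circ> even_part a) p"
  show "a = (\<lambda>p. even_part a p + ?b p)" by (auto simp: scal_minus_one)
  have "?b \<in> weyl_carrier"
    using e even_ops_subset by (intro weyl_carrier.add assms weyl_carrier.comp weyl_carrier.scal) auto
  moreover have "reflect (?b (reflect p)) = - ?b p" for p
  proof -
    have "scal (1/2) q + scal (1/2) q = q" for q :: "'a cpoly"
      by (simp flip: scal_add_left)
    then have "even_part a p + even_part a p = a p + reflect (a (reflect p))"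
      unfolding even_part_def scal_add
      by (metis (no_types, lifting) ab_semigroup_add_class.add_ac(1) add.left_commute)
    moreover have "reflect (even_part a (reflect p)) = even_part a p"
      using e by (simp add: even_ops_def)
    ultimately show ?thesis
      by (simp add: reflect_add reflect_scal) (simp add: scal_minus_one algebra_simps)
  qed
  ultimately show "?b \<in> odd_ops" by (simp add: odd_ops_def)
qed

section \<open>The induced module\<close>

lemma tensor_product_Weyl:
  assumes "left_module Weyl_ev M" shows "tensor_product Weyl Weyl_ev M"
  using assms ring_Weyl even_ops_subset
  by (simp add: tensor_product_def tensor_product_axioms_def)

text \<open>
  Even operators pass through the tensor sign to \<open>M\<close>; an odd operator is first written as a
  combination of \<open>\<partial>\<^sub>i\<close> and \<open>t\<^sub>i\<close> with even coefficients on the right.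
\<close>

lemma tensor_generation:
  assumes M: "left_module Weyl_ev (M :: (('n::finite) oper, 'u) module)"
    and X: "X \<in> carrier (tensor Weyl Weyl_ev M)"
  shows "\<exists>m0\<in>carrier M. \<exists>m1\<in>carrier M. \<exists>m2\<in>carrier M.
    X = pure_tensor Weyl Weyl_ev M (\<lambda>p. p) m0 \<oplus>\<^bsub>tensor Weyl Weyl_ev M\<^esub>
      (pure_tensor Weyl Weyl_ev M (pdiff i) m1 \<oplus>\<^bsub>tensor Weyl Weyl_ev M\<^esub>
       pure_tensor Weyl Weyl_ev M (tvar i) m2)"
proof -
  interpret tensor_product Weyl Weyl_ev M by (rule tensor_product_Weyl[OF M])
  have 1: "(\<lambda>p. p) \<in> carrier (Weyl :: 'n oper ring)" "pdiff i \<in> carrier Weyl" "tvar i \<in> carrier Weyl"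
    by (simp_all add: weyl_one_closed weyl_carrier.intros)
  show ?thesis
    using X
  proof (induction rule: T_induct)
    case zero
    show ?case
      by (intro bexI[of _ "\<zero>\<^bsub>M\<^esub>"]) (simp_all add: pt_zero_right[OF 1(1)] pt_zero_right[OF 1(2)] pt_zero_right[OF 1(3)])
  next
    case (add X Y)
    obtain m0 m1 m2 where m: "m0 \<in> carrier M" "m1 \<in> carrier M" "m2 \<in> carrier M"
      and X: "X = pt (\<lambda>p. p) m0 \<oplus>\<^bsub>T\<^esub> (pt (pdiff i) m1 \<oplus>\<^bsub>T\<^esub> pt (tvar i) m2)"
      using add(3) by blast
    obtain n0 n1 n2 where n: "n0 \<in> carrier M" "n1 \<in> carrier M" "n2 \<in> carrier M"
      and Y: "Y = pt (\<lambda>p. p) n0 \<oplus>\<^bsub>T\<^esub> (pt (pdiff i) n1 \<oplus>\<^bsub>T\<^esub> pt (tvar i) n2)"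
      using add(4) by blast
    note c = 1[THEN pt_closed]
    have "X \<oplus>\<^bsub>T\<^esub> Y = pt (\<lambda>p. p) (m0 \<oplus>\<^bsub>M\<^esub> n0) \<oplus>\<^bsub>T\<^esub>
        (pt (pdiff i) (m1 \<oplus>\<^bsub>M\<^esub> n1) \<oplus>\<^bsub>T\<^esub> pt (tvar i) (m2 \<oplus>\<^bsub>M\<^esub> n2))"
      unfolding X Y using m n c
      by (simp add: pt_add_right[OF 1(1)] pt_add_right[OF 1(2)] pt_add_right[OF 1(3)] T.a_ac)
    then show ?case using m n M.add.m_closed by blast
  next
    case (pure a m)
    then have a: "a \<in> weyl_carrier" by simp
    obtain b where b: "b \<in> odd_ops" and ab: "a = (\<lambda>p. even_part a p + b p)"
      using even_odd_decomposition[OF a] by blast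
    have ev: "even_part a \<in> even_ops" "tvar i \<circ> b \<in> even_ops" "scal (-1) \<circ> (pdiff i \<circ> b) \<in> even_ops"
      using b by (auto intro: even_part_in_even_ops[OF a] odd_odd tvar_odd pdiff_odd
          even_ops_comp even_ops_scal)
    have W: "even_part a \<in> carrier Weyl" "b \<in> carrier Weyl" "tvar i \<circ> b \<in> carrier Weyl"
      "scal (-1) \<circ> (pdiff i \<circ> b) \<in> carrier Weyl"
      "pdiff i \<circ> (tvar i \<circ> b) \<in> carrier Weyl"
      "tvar i \<circ> (scal (-1) \<circ> (pdiff i \<circ> b)) \<in> carrier Weyl"
      using ev b even_ops_subset odd_ops_subset by (auto simp del: comp_apply intro!: weyl_carrier.comp weyl_carrier.intros)
    have "pt a m = pt (even_part a) m \<oplus>\<^bsub>T\<^esub> pt b m"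
      using pt_add_left[OF W(1,2) pure(2)] ab by simp
    also have "pt (even_part a) m = pt (\<lambda>p. p) (even_part a \<odot>\<^bsub>M\<^esub> m)"
      using pt_balanced[OF 1(1) _ pure(2), of "even_part a"] ev by (simp add: comp_def)
    also have "pt b m = pt (pdiff i \<circ> (tvar i \<circ> b)) m \<oplus>\<^bsub>T\<^esub> pt (tvar i \<circ> (scal (-1) \<circ> (pdiff i \<circ> b))) m"
      using pt_add_left[OF W(5,6) pure(2)] odd_decomposition[of i b] by simp
    also have "pt (pdiff i \<circ> (tvar i \<circ> b)) m = pt (pdiff i) ((tvar i \<circ> b) \<odot>\<^bsub>M\<^esub> m)"
      using pt_balanced[OF 1(2) _ pure(2), of "tvar i \<circ> b"] ev by simp
    also have "pt (tvar i \<circ> (scal (-1) \<circ> (pdiff i \<circ> b))) m =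
        pt (tvar i) ((scal (-1) \<circ> (pdiff i \<circ> b)) \<odot>\<^bsub>M\<^esub> m)"
      using pt_balanced[OF 1(3) _ pure(2), of "scal (-1) \<circ> (pdiff i \<circ> b)"] ev by simp
    finally show ?case
      using ev pure(2) smult_closed[of _ m] by (metis Weyl_ev_simps(1))
  qed
qed

text \<open>
  A nonzero module contains a copy of \<open>\<complex>\<close>.
\<close>

lemma weyl_ev_module_infinite:
  assumes M: "left_module Weyl_ev (M :: (('n::finite) oper, 'u) module)"
    and v: "v \<in> carrier M" "v \<noteq> \<zero>\<^bsub>M\<^esub>"
  shows "infinite (carrier M)"
proof -
  interpret weyl_like_module Weyl_ev M even_ops using M weyl_ev_module_iff by blast
  have "inj (\<lambda>c. scal c \<odot>\<^bsub>M\<^esub> v)"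
  proof (rule injI, rule ccontr)
    fix c d assume eq: "scal c \<odot>\<^bsub>M\<^esub> v = scal d \<odot>\<^bsub>M\<^esub> v" and "c \<noteq> d"
    have "scal (c - d) = (\<lambda>p. scal c p + scal (- d) p :: 'n cpoly)"
      by (rule ext) (simp flip: scal_add_left)
    then have "scal (c - d) \<odot>\<^bsub>M\<^esub> v = scal c \<odot>\<^bsub>M\<^esub> v \<oplus>\<^bsub>M\<^esub> scal (- d) \<odot>\<^bsub>M\<^esub> v"
      using v by (simp add: smult_l_distr' scal_C)
    also have "\<dots> = (\<lambda>p. scal d p + scal (- d) p) \<odot>\<^bsub>M\<^esub> v"
      unfolding eq using v by (simp add: smult_l_distr' scal_C)
    also have "(\<lambda>p. scal d p + scal (- d) p) = (\<lambda>p. 0 :: 'n cpoly)"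
      by (rule ext) (simp flip: scal_add_left)
    finally have "scal (c - d) \<odot>\<^bsub>M\<^esub> v = \<zero>\<^bsub>M\<^esub>" using v by simp
    with scal_cancel[OF v(1) this] v \<open>c \<noteq> d\<close> show False by simp
  qed
  then have "infinite (range (\<lambda>c. scal c \<odot>\<^bsub>M\<^esub> v))"
    using range_inj_infinite infinite_UNIV_char_0 finite_imageD by blast
  moreover have "range (\<lambda>c. scal c \<odot>\<^bsub>M\<^esub> v) \<subseteq> carrier M"
    using v smult_closed' scal_C by auto
  ultimately show ?thesis using finite_subset by blast
qed

text \<open>
  By \<open>tensor_generation\<close> the tensor product is an image of \<open>M \<times> M \<times> M\<close>. If \<open>M\<close> is infinite, this
  product is equipotent to \<open>M\<close>, a subset of the universe; otherwise \<open>M\<close> is zero.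
\<close>

lemma Ind_embedding_inj:
  assumes M: "left_module Weyl_ev (M :: (('n::finite) oper, 'u) module)"
  shows "inj_on (Ind_embedding M) (carrier (tensor Weyl Weyl_ev M))"
proof -
  interpret tensor_product Weyl Weyl_ev M by (rule tensor_product_Weyl[OF M])
  let ?i = "undefined :: 'n"
  define g where "g = (\<lambda>(m0, m1, m2). pt (\<lambda>p. p) m0 \<oplus>\<^bsub>T\<^esub> (pt (pdiff ?i) m1 \<oplus>\<^bsub>T\<^esub> pt (tvar ?i) m2))"
  have surj: "carrier T \<subseteq> g ` (carrier M \<times> carrier M \<times> carrier M)"
  proof
    fix X assume "X \<in> carrier T"
    then obtain m0 m1 m2 where "m0 \<in> carrier M" "m1 \<in> carrier M" "m2 \<in> carrier M" "X = g (m0, m1, m2)"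
      using tensor_generation[OF M, of X ?i] unfolding g_def by auto
    then show "X \<in> g ` (carrier M \<times> carrier M \<times> carrier M)" by blast
  qed
  have "\<exists>e :: ('n oper \<times> 'u \<Rightarrow>\<^sub>0 int) set \<Rightarrow> 'u. inj_on e (carrier T)"
  proof (cases "finite (carrier M)")
    case True
    then have "carrier M = {\<zero>\<^bsub>M\<^esub>}"
      using weyl_ev_module_infinite[OF M] by auto
    then have "carrier T \<subseteq> {g (\<zero>\<^bsub>M\<^esub>, \<zero>\<^bsub>M\<^esub>, \<zero>\<^bsub>M\<^esub>)}"
      using surj by simp
    then have "X = Y" if "X \<in> carrier T" "Y \<in> carrier T" for X Y
      using that by blast
    then show ?thesis by (auto simp: inj_on_def)
  next
    case False
    have "|carrier M \<times> carrier M \<times> carrier M| =o |carrier M|"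
    proof -
      have "|carrier M \<times> carrier M| \<le>o |carrier M|"
        using card_of_Times_same_infinite[OF False] ordIso_iff_ordLeq by blast
      moreover have "carrier M \<times> carrier M \<noteq> {}" using M.zero_closed by blast
      ultimately show ?thesis by (intro card_of_Times_infinite[OF False, THEN conjunct1])
    qed
    then obtain b where b: "bij_betw b (carrier M) (carrier M \<times> carrier M \<times> carrier M)"
      using card_of_ordIso bij_betw_inv by blast
    then have "carrier T \<subseteq> (g \<circ> b) ` carrier M"
      using surj unfolding bij_betw_def image_comp[symmetric] by simp
    from inj_on_inv_into[OF this] show ?thesis by blast
  qed
  then show ?thesis unfolding Ind_embedding_def by (rule someI_ex)
qed

lemma transport_module_simps:
  "carrier (transport_module e M) = e ` carrier M"
  "\<zero>\<^bsub>transport_module e M\<^esub> = e \<zero>\<^bsub>M\<^esub>"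
  "inj_on e (carrier M) \<Longrightarrow> X \<in> carrier M \<Longrightarrow> Y \<in> carrier M \<Longrightarrow>
     e X \<oplus>\<^bsub>transport_module e M\<^esub> e Y = e (X \<oplus>\<^bsub>M\<^esub> Y)"
  "inj_on e (carrier M) \<Longrightarrow> X \<in> carrier M \<Longrightarrow>
     a \<odot>\<^bsub>transport_module e M\<^esub> e X = e (a \<odot>\<^bsub>M\<^esub> X)"
  by (simp_all add: transport_module_def Let_def)

lemma left_module_transport:
  assumes "left_module R M" and e: "inj_on e (carrier M)"
  shows "left_module R (transport_module e M)"
proof -
  interpret left_module R M by fact
  note simps = transport_module_simps(1,2) transport_module_simps(3,4)[OF e]
  have "abelian_group (transport_module e M)"
  proof (rule abelian_groupI)
    fix x assume "x \<in> carrier (transport_module e M)"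
    then obtain X where X: "X \<in> carrier M" "x = e X" by (auto simp: simps)
    then show "\<exists>y\<in>carrier (transport_module e M).
        y \<oplus>\<^bsub>transport_module e M\<^esub> x = \<zero>\<^bsub>transport_module e M\<^esub>"
      by (intro bexI[of _ "e (\<ominus>\<^bsub>M\<^esub> X)"]) (auto simp: simps M.l_neg)
  qed (auto simp: simps M.a_assoc intro!: arg_cong[of _ _ e] M.a_comm)
  then show ?thesis
    by (intro left_module.intro left_module_axioms.intro R.ring_axioms)
      (auto simp: simps smult_closed smult_l_distr smult_r_distr smult_assoc smult_one)
qed

text \<open>
  The properties that characterise \<open>N = A \<otimes> M\<close>, with \<open>A\<close> the Weyl algebra, and
  \<open>j m = 1 \<otimes> m\<close>, freed from cosets and from the transport along the chosen embedding. The universal property is stated for targets on the same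
  universe, which covers the two needed ones: \<open>M\<close> itself and modules over the Weyl algebra.
\<close>

locale weyl_induced = M: left_module Weyl_ev M + N: left_module Weyl N
  for M N :: "(('n::finite) oper, 'u) module" +
  fixes j :: "'u \<Rightarrow> 'u"
  assumes j_closed: "m \<in> carrier M \<Longrightarrow> j m \<in> carrier N"
    and j_add: "m \<in> carrier M \<Longrightarrow> m' \<in> carrier M \<Longrightarrow> j (m \<oplus>\<^bsub>M\<^esub> m') = j m \<oplus>\<^bsub>N\<^esub> j m'"
    and j_smult: "a \<in> even_ops \<Longrightarrow> m \<in> carrier M \<Longrightarrow> j (a \<odot>\<^bsub>M\<^esub> m) = a \<odot>\<^bsub>N\<^esub> j m"
    and generation: "n \<in> carrier N \<Longrightarrow> \<exists>m0\<in>carrier M. \<exists>m1\<in>carrier M. \<exists>m2\<in>carrier M.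
        n = j m0 \<oplus>\<^bsub>N\<^esub> (pdiff i \<odot>\<^bsub>N\<^esub> j m1 \<oplus>\<^bsub>N\<^esub> tvar i \<odot>\<^bsub>N\<^esub> j m2)"
    and universal: "\<And>(G :: ('n oper, 'u) module) \<beta>. abelian_group G \<Longrightarrow>
      (\<And>a m. a \<in> weyl_carrier \<Longrightarrow> m \<in> carrier M \<Longrightarrow> \<beta> a m \<in> carrier G) \<Longrightarrow>
      (\<And>a b m. a \<in> weyl_carrier \<Longrightarrow> b \<in> weyl_carrier \<Longrightarrow> m \<in> carrier M \<Longrightarrow>
        \<beta> (\<lambda>p. a p + b p) m = \<beta> a m \<oplus>\<^bsub>G\<^esub> \<beta> b m) \<Longrightarrow>
      (\<And>a m m'. a \<in> weyl_carrier \<Longrightarrow> m \<in> carrier M \<Longrightarrow> m' \<in> carrier M \<Longrightarrow>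
        \<beta> a (m \<oplus>\<^bsub>M\<^esub> m') = \<beta> a m \<oplus>\<^bsub>G\<^esub> \<beta> a m') \<Longrightarrow>
      (\<And>a r m. a \<in> weyl_carrier \<Longrightarrow> r \<in> even_ops \<Longrightarrow> m \<in> carrier M \<Longrightarrow>
        \<beta> (a \<circ> r) m = \<beta> a (r \<odot>\<^bsub>M\<^esub> m)) \<Longrightarrow>
      \<exists>\<phi>. (\<forall>x\<in>carrier N. \<phi> x \<in> carrier G) \<and>
          (\<forall>x\<in>carrier N. \<forall>y\<in>carrier N. \<phi> (x \<oplus>\<^bsub>N\<^esub> y) = \<phi> x \<oplus>\<^bsub>G\<^esub> \<phi> y) \<and>
          (\<forall>a\<in>weyl_carrier. \<forall>m\<in>carrier M. \<phi> (a \<odot>\<^bsub>N\<^esub> j m) = \<beta> a m)"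

definition Ind_unit :: "(('n::finite) oper, 'u) module \<Rightarrow> 'u \<Rightarrow> 'u" where
  "Ind_unit M m = Ind_embedding M (pure_tensor Weyl Weyl_ev M (\<lambda>p. p) m)"

lemma Ind_unit_smult:
  assumes M: "left_module Weyl_ev M" and "a \<in> weyl_carrier" "m \<in> carrier M"
  shows "a \<odot>\<^bsub>FOb Ind M\<^esub> Ind_unit M m = Ind_embedding M (pure_tensor Weyl Weyl_ev M a m)"
proof -
  interpret tensor_product Weyl Weyl_ev M by (rule tensor_product_Weyl[OF M])
  have "pt (\<lambda>p. p) m \<in> carrier T" using assms by (intro pt_closed) (simp_all add: weyl_one_closed)
  then show ?thesis
    using assms T_smult_pt[of a "\<lambda>p. p" m]
    by (simp add: Ind_def Ind_unit_def transport_module_simps(4)[OF Ind_embedding_inj[OF M]]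
        weyl_one_closed comp_def)
qed

lemma weyl_induced_Ind:
  assumes M: "left_module Weyl_ev (M :: (('n::finite) oper, 'u) module)"
  shows "weyl_induced M (FOb Ind M) (Ind_unit M)"
proof -
  interpret tensor_product Weyl Weyl_ev M by (rule tensor_product_Weyl[OF M])
  let ?e = "Ind_embedding M"
  note e = Ind_embedding_inj[OF M]
  have N: "FOb Ind M = transport_module ?e T" by (simp add: Ind_def)
  note tr = transport_module_simps(1,2)[of ?e T] transport_module_simps(3,4)[OF e]
  have 1: "(\<lambda>p. p) \<in> carrier (Weyl :: 'n oper ring)"
    by (simp add: weyl_one_closed)
  show ?thesis
  proof (rule weyl_induced.intro[OF M _ weyl_induced_axioms.intro])
    show "left_module Weyl (FOb Ind M)"
      unfolding N by (rule left_module_transport[OF left_module_T e])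
  next
    fix m assume "m \<in> carrier M"
    then show "Ind_unit M m \<in> carrier (FOb Ind M)"
      unfolding N by (simp add: tr Ind_unit_def pt_closed[OF 1])
  next
    fix m m' assume "m \<in> carrier M" "m' \<in> carrier M"
    then show "Ind_unit M (m \<oplus>\<^bsub>M\<^esub> m') = Ind_unit M m \<oplus>\<^bsub>FOb Ind M\<^esub> Ind_unit M m'"
      unfolding N by (simp add: tr Ind_unit_def pt_closed[OF 1] pt_add_right[OF 1])
  next
    fix a :: "'n oper" and m assume a: "a \<in> even_ops" and m: "m \<in> carrier M"
    have "pt (\<lambda>p. p) (a \<odot>\<^bsub>M\<^esub> m) = pt a m"
      using pt_balanced[OF 1 _ m, of a] a by (simp add: comp_def)
    then show "Ind_unit M (a \<odot>\<^bsub>M\<^esub> m) = a \<odot>\<^bsub>FOb Ind M\<^esub> Ind_unit M m"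
      using Ind_unit_smult[OF M _ m, of a] a even_ops_subset by (auto simp: Ind_unit_def)
  next
    fix n i assume "n \<in> carrier (FOb Ind M)"
    then obtain X where X: "X \<in> carrier T" "n = ?e X" unfolding N by (auto simp: tr)
    obtain m0 m1 m2 where m: "m0 \<in> carrier M" "m1 \<in> carrier M" "m2 \<in> carrier M"
      and X': "X = pt (\<lambda>p. p) m0 \<oplus>\<^bsub>T\<^esub> (pt (pdiff i) m1 \<oplus>\<^bsub>T\<^esub> pt (tvar i) m2)"
      using tensor_generation[OF M X(1)] by blast
    have dt: "pdiff i \<in> weyl_carrier" "tvar i \<in> weyl_carrier" by (rule weyl_carrier.intros)+
    have c: "pt (\<lambda>p. p) m0 \<in> carrier T" "pt (pdiff i) m1 \<in> carrier T" "pt (tvar i) m2 \<in> carrier T"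
      using m 1 dt by (auto intro: pt_closed)
    have "n = Ind_unit M m0 \<oplus>\<^bsub>FOb Ind M\<^esub> (pdiff i \<odot>\<^bsub>FOb Ind M\<^esub> Ind_unit M m1 \<oplus>\<^bsub>FOb Ind M\<^esub>
        tvar i \<odot>\<^bsub>FOb Ind M\<^esub> Ind_unit M m2)"
      unfolding Ind_unit_smult[OF M dt(1) m(2)] Ind_unit_smult[OF M dt(2) m(3)]
      using X(2) X' c by (simp add: N tr Ind_unit_def)
    then show "\<exists>m0\<in>carrier M. \<exists>m1\<in>carrier M. \<exists>m2\<in>carrier M. n = Ind_unit M m0 \<oplus>\<^bsub>FOb Ind M\<^esub>
       (pdiff i \<odot>\<^bsub>FOb Ind M\<^esub> Ind_unit M m1 \<oplus>\<^bsub>FOb Ind M\<^esub> tvar i \<odot>\<^bsub>FOb Ind M\<^esub> Ind_unit M m2)"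
      using m by blast
  next
    fix G :: "('n oper, 'u) module" and \<beta>
    assume \<beta>: "abelian_group G"
      "\<And>a m. a \<in> weyl_carrier \<Longrightarrow> m \<in> carrier M \<Longrightarrow> \<beta> a m \<in> carrier G"
      "\<And>a b m. a \<in> weyl_carrier \<Longrightarrow> b \<in> weyl_carrier \<Longrightarrow> m \<in> carrier M \<Longrightarrow>
        \<beta> (\<lambda>p. a p + b p) m = \<beta> a m \<oplus>\<^bsub>G\<^esub> \<beta> b m"
      "\<And>a m m'. a \<in> weyl_carrier \<Longrightarrow> m \<in> carrier M \<Longrightarrow> m' \<in> carrier M \<Longrightarrow>
        \<beta> a (m \<oplus>\<^bsub>M\<^esub> m') = \<beta> a m \<oplus>\<^bsub>G\<^esub> \<beta> a m'"
      "\<And>a r m. a \<in> weyl_carrier \<Longrightarrow> r \<in> even_ops \<Longrightarrow> m \<in> carrier M \<Longrightarrow>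
        \<beta> (a \<circ> r) m = \<beta> a (r \<odot>\<^bsub>M\<^esub> m)"
    have "\<exists>\<phi>. (\<forall>X\<in>carrier T. \<phi> X \<in> carrier G) \<and>
      (\<forall>X\<in>carrier T. \<forall>Y\<in>carrier T. \<phi> (X \<oplus>\<^bsub>T\<^esub> Y) = \<phi> X \<oplus>\<^bsub>G\<^esub> \<phi> Y) \<and>
      (\<forall>a\<in>carrier Weyl. \<forall>m\<in>carrier M. \<phi> (pt a m) = \<beta> a m)"
      by (rule tensor_lift[OF \<beta>(1)]) (simp_all add: \<beta>(2-))
    then obtain \<phi> where \<phi>: "\<And>X. X \<in> carrier T \<Longrightarrow> \<phi> X \<in> carrier G"
      "\<And>X Y. X \<in> carrier T \<Longrightarrow> Y \<in> carrier T \<Longrightarrow> \<phi> (X \<oplus>\<^bsub>T\<^esub> Y) = \<phi> X \<oplus>\<^bsub>G\<^esub> \<phi> Y"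
      "\<And>a m. a \<in> carrier Weyl \<Longrightarrow> m \<in> carrier M \<Longrightarrow> \<phi> (pt a m) = \<beta> a m"
      by blast
    let ?\<psi> = "\<lambda>x. \<phi> (inv_into (carrier T) ?e x)"
    have "?\<psi> (a \<odot>\<^bsub>FOb Ind M\<^esub> Ind_unit M m) = \<beta> a m" if "a \<in> weyl_carrier" "m \<in> carrier M" for a m
      using that \<phi>(3)[of a m] e pt_closed[of a m] by (simp add: Ind_unit_smult[OF M])
    moreover have "?\<psi> x \<in> carrier G" if "x \<in> carrier (FOb Ind M)" for x
      using that e \<phi>(1) unfolding N by (auto simp: tr)
    moreover have "?\<psi> (x \<oplus>\<^bsub>FOb Ind M\<^esub> y) = ?\<psi> x \<oplus>\<^bsub>G\<^esub> ?\<psi> y"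
      if "x \<in> carrier (FOb Ind M)" "y \<in> carrier (FOb Ind M)" for x y
      using that e \<phi>(2) unfolding N by (auto simp: tr)
    ultimately show "\<exists>\<phi>. (\<forall>x\<in>carrier (FOb Ind M). \<phi> x \<in> carrier G) \<and>
          (\<forall>x\<in>carrier (FOb Ind M). \<forall>y\<in>carrier (FOb Ind M). \<phi> (x \<oplus>\<^bsub>FOb Ind M\<^esub> y) = \<phi> x \<oplus>\<^bsub>G\<^esub> \<phi> y) \<and>
          (\<forall>a\<in>weyl_carrier. \<forall>m\<in>carrier M. \<phi> (a \<odot>\<^bsub>FOb Ind M\<^esub> Ind_unit M m) = \<beta> a m)"
      by (intro exI[of _ ?\<psi>]) blast
  qed
qed

lemma Ind_arrow:
  assumes M: "left_module Weyl_ev M" "left_module Weyl_ev M'"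
    and f: "f \<in> module_hom Weyl_ev M M'"
  shows "FArr Ind M M' f \<in> module_hom Weyl (FOb Ind M) (FOb Ind M')"
    and "m \<in> carrier M \<Longrightarrow> FArr Ind M M' f (Ind_unit M m) = Ind_unit M' (f m)"
proof -
  interpret A: tensor_product Weyl Weyl_ev M by (rule tensor_product_Weyl[OF M(1)])
  interpret B: tensor_product Weyl Weyl_ev M' by (rule tensor_product_Weyl[OF M(2)])
  note e = Ind_embedding_inj[OF M(1)] and e' = Ind_embedding_inj[OF M(2)]
  note tm = tensor_map_pure[OF A.tensor_product_axioms B.tensor_product_axioms f]
  note tr = transport_module_simps(1,2) transport_module_simps(3,4)[OF e]
    transport_module_simps(3,4)[OF e']
  have fc: "f m \<in> carrier M'" if "m \<in> carrier M" for m
    using f that by (auto simp: module_hom_def)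
  have F: "FArr Ind M M' f (Ind_embedding M X) = Ind_embedding M' (tensor_map Weyl Weyl_ev M M' f X)"
    if "X \<in> carrier A.T" for X
    using that e by (simp add: Ind_def)
  have lin: "tensor_map Weyl Weyl_ev M M' f (a \<odot>\<^bsub>A.T\<^esub> X) = a \<odot>\<^bsub>B.T\<^esub> tensor_map Weyl Weyl_ev M M' f X"
    if a: "a \<in> carrier Weyl" and X: "X \<in> carrier A.T" for a X
  proof -
    interpret TA: left_module Weyl A.T by (rule A.left_module_T)
    interpret TB: left_module Weyl B.T by (rule B.left_module_T)
    show ?thesis using X
    proof (induction rule: A.T_induct)
      case zero
      have "tensor_map Weyl Weyl_ev M M' f \<zero>\<^bsub>A.T\<^esub> = \<zero>\<^bsub>B.T\<^esub>"
        using tm(3)[of "\<zero>\<^bsub>A.T\<^esub>" "\<zero>\<^bsub>A.T\<^esub>"] tm(2)[of "\<zero>\<^bsub>A.T\<^esub>"] B.T.add.l_cancel_one'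
        by (simp add: A.T.zero_closed)
      then show ?case using a by (simp add: TA.smult_r_null TB.smult_r_null)
    next
      case (add X Y)
      then show ?case using a
        by (simp add: TA.smult_r_distr TB.smult_r_distr tm(2,3) TA.smult_closed)
    next
      case (pure b m)
      then show ?case using a A.T_smult_pt[OF a pure] B.T_smult_pt[OF a pure(1) fc[OF pure(2)]]
        by (simp add: tm(1) weyl_carrier.comp)
    qed
  qed
  show "FArr Ind M M' f \<in> module_hom Weyl (FOb Ind M) (FOb Ind M')"
    unfolding module_hom_def
  proof (intro CollectI conjI ballI)
    have N: "FOb Ind M = transport_module (Ind_embedding M) A.T"
      "FOb Ind M' = transport_module (Ind_embedding M') B.T" by (simp_all add: Ind_def)
    show "FArr Ind M M' f \<in> carrier (FOb Ind M) \<rightarrow>\<^sub>E carrier (FOb Ind M')"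
    proof
      fix x assume "x \<in> carrier (FOb Ind M)"
      then show "FArr Ind M M' f x \<in> carrier (FOb Ind M')"
        using F tm(2) by (auto simp: N tr)
    qed (auto simp: Ind_def transport_module_simps)
    interpret TA: left_module Weyl A.T by (rule A.left_module_T)
    show "FArr Ind M M' f (x \<oplus>\<^bsub>FOb Ind M\<^esub> y) = FArr Ind M M' f x \<oplus>\<^bsub>FOb Ind M'\<^esub> FArr Ind M M' f y"
      if "x \<in> carrier (FOb Ind M)" "y \<in> carrier (FOb Ind M)" for x y
      using that F tm(2,3) by (auto simp: N tr)
    show "FArr Ind M M' f (a \<odot>\<^bsub>FOb Ind M\<^esub> x) = a \<odot>\<^bsub>FOb Ind M'\<^esub> FArr Ind M M' f x"
      if "a \<in> carrier Weyl" "x \<in> carrier (FOb Ind M)" for a x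
      using that F tm(2) lin TA.smult_closed by (auto simp: N tr)
  qed
  show "FArr Ind M M' f (Ind_unit M m) = Ind_unit M' (f m)" if "m \<in> carrier M"
    using that F tm(1) A.pt_closed by (simp add: Ind_unit_def weyl_one_closed)
qed

context weyl_induced
begin

sublocale M: weyl_like_module Weyl_ev M even_ops
  using M.left_module_axioms weyl_ev_module_iff by blast

sublocale N: weyl_like_module Weyl N weyl_carrier
  using N.left_module_axioms weyl_module_iff by blast

text \<open>
  The balanced map \<open>a \<otimes> m \<mapsto> even_part a \<cdot> m\<close> is a left inverse of \<open>j\<close>.
\<close>

lemma j_inj: "inj_on j (carrier M)"
proof -
  obtain \<pi> where \<pi>: "\<forall>a\<in>weyl_carrier. \<forall>m\<in>carrier M. \<pi> (a \<odot>\<^bsub>N\<^esub> j m) = even_part a \<odot>\<^bsub>M\<^esub> m"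
    using universal[of M "\<lambda>a m. even_part a \<odot>\<^bsub>M\<^esub> m"] M.abelian_group_axioms
    by (auto simp: even_part_in_even_ops M.smult_closed' even_part_add M.smult_l_distr'
        M.smult_r_distr even_part_right M.smult_assoc')
  have "\<pi> (j m) = m" if "m \<in> carrier M" for m
    using bspec[OF bspec[OF \<pi> weyl_one_closed] that] that j_closed
    by (simp add: even_part_even[OF even_ops_one])
  then show ?thesis by (rule inj_on_inverseI)
qed

lemma hom_eqI:
  assumes g: "g \<in> module_hom Weyl N N'" and g': "g' \<in> module_hom Weyl N N'"
    and eq: "\<And>m. m \<in> carrier M \<Longrightarrow> g (j m) = g' (j m)"
  shows "g = g'"
proof (rule PiE_ext)
  show "g \<in> carrier N \<rightarrow>\<^sub>E carrier N'" "g' \<in> carrier N \<rightarrow>\<^sub>E carrier N'"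
    using g g' by (auto simp: module_hom_def)
  fix n assume "n \<in> carrier N"
  then obtain m0 m1 m2 where "m0 \<in> carrier M" "m1 \<in> carrier M" "m2 \<in> carrier M"
    "n = j m0 \<oplus>\<^bsub>N\<^esub> (pdiff undefined \<odot>\<^bsub>N\<^esub> j m1 \<oplus>\<^bsub>N\<^esub> tvar undefined \<odot>\<^bsub>N\<^esub> j m2)"
    using generation by blast
  then show "g n = g' n"
    using g g' eq j_closed N.smult_closed'
    by (simp add: module_hom_def weyl_carrier.tvar weyl_carrier.pdiff)
qed

lemma hom_extension:
  assumes N': "left_module Weyl (N' :: ('n oper, 'u) module)" and f: "f \<in> module_hom Weyl_ev M N'"
  obtains g where "g \<in> module_hom Weyl N N'" "\<And>m. m \<in> carrier M \<Longrightarrow> g (j m) = f m"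
proof -
  interpret N': weyl_like_module Weyl N' weyl_carrier
    using N' weyl_module_iff by blast
  have fc: "f m \<in> carrier N'" if "m \<in> carrier M" for m
    using f that by (auto simp: module_hom_def)
  have fadd: "f (m \<oplus>\<^bsub>M\<^esub> m') = f m \<oplus>\<^bsub>N'\<^esub> f m'" if "m \<in> carrier M" "m' \<in> carrier M" for m m'
    using f that by (auto simp: module_hom_def)
  have fsm: "f (a \<odot>\<^bsub>M\<^esub> m) = a \<odot>\<^bsub>N'\<^esub> f m" if "a \<in> even_ops" "m \<in> carrier M" for a m
    using f that by (auto simp: module_hom_def)
  have ev: "a \<in> weyl_carrier" if "a \<in> even_ops" for a :: "'n oper"
    using that even_ops_subset by blast
  obtain \<phi> where \<phi>: "\<forall>x\<in>carrier N. \<phi> x \<in> carrier N'"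
    "\<forall>x\<in>carrier N. \<forall>y\<in>carrier N. \<phi> (x \<oplus>\<^bsub>N\<^esub> y) = \<phi> x \<oplus>\<^bsub>N'\<^esub> \<phi> y"
    "\<forall>a\<in>weyl_carrier. \<forall>m\<in>carrier M. \<phi> (a \<odot>\<^bsub>N\<^esub> j m) = a \<odot>\<^bsub>N'\<^esub> f m"
    using universal[of N' "\<lambda>a m. a \<odot>\<^bsub>N'\<^esub> f m"] N'.abelian_group_axioms
    by (auto simp: fc fadd fsm ev N'.smult_closed' N'.smult_l_distr' N'.smult_r_distr N'.smult_assoc')
  let ?g = "restrict \<phi> (carrier N)"
  have lin: "\<phi> (a \<odot>\<^bsub>N\<^esub> n) = a \<odot>\<^bsub>N'\<^esub> \<phi> n" if a: "a \<in> weyl_carrier" and n: "n \<in> carrier N" for a n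
  proof -
    obtain m0 m1 m2 where m: "m0 \<in> carrier M" "m1 \<in> carrier M" "m2 \<in> carrier M"
      and n: "n = j m0 \<oplus>\<^bsub>N\<^esub> (pdiff undefined \<odot>\<^bsub>N\<^esub> j m1 \<oplus>\<^bsub>N\<^esub> tvar undefined \<odot>\<^bsub>N\<^esub> j m2)"
      using generation[OF n] by blast
    have gen: "\<phi> (a \<odot>\<^bsub>N\<^esub> (b \<odot>\<^bsub>N\<^esub> j m)) = a \<odot>\<^bsub>N'\<^esub> \<phi> (b \<odot>\<^bsub>N\<^esub> j m)"
      if "b \<in> weyl_carrier" "m \<in> carrier M" for b m
      using that a \<phi>(3) by (simp add: N.smult_assoc' N'.smult_assoc' j_closed fc weyl_carrier.comp)
    have "\<phi> (a \<odot>\<^bsub>N\<^esub> j m0) = a \<odot>\<^bsub>N'\<^esub> \<phi> (j m0)"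
      using gen[OF weyl_one_closed m(1)] m(1) j_closed by simp
    then show ?thesis
      unfolding n using a m gen \<phi>(1,2) j_closed
      by (simp add: N.smult_r_distr N'.smult_r_distr N.smult_closed' weyl_carrier.tvar weyl_carrier.pdiff)
  qed
  show thesis
  proof
    show "?g \<in> module_hom Weyl N N'"
      using \<phi> lin by (auto simp: module_hom_def N.smult_closed')
    fix m assume m: "m \<in> carrier M"
    then show "?g (j m) = f m"
      using \<phi>(3) weyl_one_closed j_closed fc by (metis N'.smult_one' N.smult_one' restrict_apply')
  qed
qed

end

section \<open>Finite multiplicities\<close>

definition lin_closed :: "(('n::finite) oper, 'u) module \<Rightarrow> 'u set \<Rightarrow> bool" where
  "lin_closed M S \<longleftrightarrow> \<zero>\<^bsub>M\<^esub> \<in> S \<and> (\<forall>x\<in>S. \<forall>y\<in>S. x \<oplus>\<^bsub>M\<^esub> y \<in> S) \<and> (\<forall>c. \<forall>x\<in>S. scal c \<odot>\<^bsub>M\<^esub> x \<in> S)"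

text \<open>
  Finite dimensionality without linear combinations: a finite subset of \<open>V\<close> whose linear hull
  contains \<open>V\<close>. As neither the carrier nor finite sums occur, it is visibly unchanged by
  passing to a submodule and easy to push through additive maps.
\<close>

definition finitely_spanned :: "(('n::finite) oper, 'u) module \<Rightarrow> 'u set \<Rightarrow> bool" where
  "finitely_spanned M V \<longleftrightarrow>
     (\<exists>B. finite B \<and> B \<subseteq> V \<and> (\<forall>S. lin_closed M S \<longrightarrow> B \<subseteq> S \<longrightarrow> V \<subseteq> S))"

context weyl_like_module
begin

lemma finite_dimensional_iff:
  assumes V: "V \<subseteq> carrier M"
  shows "finite_dimensional M V \<longleftrightarrow> finitely_spanned M V"
proof
  assume "finite_dimensional M V"
  then obtain B where B: "finite B" "B \<subseteq> V"
    and span: "\<And>v. v \<in> V \<Longrightarrow> \<exists>c. v = (\<Oplus>\<^bsub>M\<^esub>b\<in>B. scal (c b) \<odot>\<^bsub>M\<^esub> b)"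
    unfolding finite_dimensional_def by blast
  have "V \<subseteq> S" if S: "lin_closed M S" "B \<subseteq> S" for S
  proof
    fix v assume "v \<in> V"
    then obtain c where v: "v = (\<Oplus>\<^bsub>M\<^esub>b\<in>B. scal (c b) \<odot>\<^bsub>M\<^esub> b)" using span by blast
    have "(\<Oplus>\<^bsub>M\<^esub>b\<in>K. scal (c b) \<odot>\<^bsub>M\<^esub> b) \<in> S" if "finite K" "K \<subseteq> B" for K
      using that
    proof (induction K rule: finite_induct)
      case empty
      then show ?case using S by (simp add: lin_closed_def)
    next
      case (insert k K)
      then have "(\<Oplus>\<^bsub>M\<^esub>b\<in>insert k K. scal (c b) \<odot>\<^bsub>M\<^esub> b) =
          scal (c k) \<odot>\<^bsub>M\<^esub> k \<oplus>\<^bsub>M\<^esub> (\<Oplus>\<^bsub>M\<^esub>b\<in>K. scal (c b) \<odot>\<^bsub>M\<^esub> b)"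
        using B V by (intro M.finsum_insert) (auto intro!: smult_closed' scal_C)
      then show ?case using insert S by (auto simp: lin_closed_def)
    qed
    then show "v \<in> S" using v B by blast
  qed
  then show "finitely_spanned M V" using B unfolding finitely_spanned_def by blast
next
  assume "finitely_spanned M V"
  then obtain B where B: "finite B" "B \<subseteq> V"
    and span: "\<And>S. lin_closed M S \<Longrightarrow> B \<subseteq> S \<Longrightarrow> V \<subseteq> S"
    unfolding finitely_spanned_def by blast
  let ?comb = "\<lambda>c. (\<Oplus>\<^bsub>M\<^esub>b\<in>B. scal (c b) \<odot>\<^bsub>M\<^esub> b)"
  have cl: "(\<lambda>b. scal (c b) \<odot>\<^bsub>M\<^esub> b) \<in> B \<rightarrow> carrier M" for c
    using B V by (auto intro!: smult_closed' scal_C)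
  have "lin_closed M (range ?comb)"
    unfolding lin_closed_def
  proof (intro conjI ballI allI)
    have "?comb (\<lambda>_. 0) = (\<Oplus>\<^bsub>M\<^esub>b\<in>B. \<zero>\<^bsub>M\<^esub>)"
      using B V by (intro M.finsum_cong') auto
    also have "\<dots> = \<zero>\<^bsub>M\<^esub>" by simp
    finally show "\<zero>\<^bsub>M\<^esub> \<in> range ?comb"
      by (intro range_eqI[of _ ?comb "\<lambda>_. 0"]) (rule sym)
  next
    fix x y assume "x \<in> range ?comb" "y \<in> range ?comb"
    then obtain c d where x: "x = ?comb c" and y: "y = ?comb d" by blast
    have "scal (c b + d b) \<odot>\<^bsub>M\<^esub> b = scal (c b) \<odot>\<^bsub>M\<^esub> b \<oplus>\<^bsub>M\<^esub> scal (d b) \<odot>\<^bsub>M\<^esub> b" if "b \<in> B" for b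
    proof -
      have "scal (c b + d b) = (\<lambda>p. scal (c b) p + scal (d b) p :: 'n cpoly)"
        by (rule ext) (rule scal_add_left)
      then show ?thesis using that B V by (simp add: smult_l_distr' scal_C subset_iff)
    qed
    then have "?comb (\<lambda>b. c b + d b) = (\<Oplus>\<^bsub>M\<^esub>b\<in>B. scal (c b) \<odot>\<^bsub>M\<^esub> b \<oplus>\<^bsub>M\<^esub> scal (d b) \<odot>\<^bsub>M\<^esub> b)"
      using cl[of c] cl[of d] by (intro M.finsum_cong') auto
    also have "\<dots> = x \<oplus>\<^bsub>M\<^esub> y" unfolding x y using cl by (intro M.finsum_addf)
    finally show "x \<oplus>\<^bsub>M\<^esub> y \<in> range ?comb"
      by (intro range_eqI[of _ ?comb "\<lambda>b. c b + d b"]) (rule sym)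
  next
    fix a x assume "x \<in> range ?comb"
    then obtain c where x: "x = ?comb c" by blast
    have eq: "scal a \<odot>\<^bsub>M\<^esub> (scal (c b) \<odot>\<^bsub>M\<^esub> b) = scal (a * c b) \<odot>\<^bsub>M\<^esub> b" if "b \<in> B" for b
    proof -
      have "scal a \<circ> scal (c b) = (scal (a * c b) :: 'n oper)" by (auto simp: scal_scal)
      then show ?thesis using that B V smult_assoc'[OF scal_C scal_C, of b a "c b"] by auto
    qed
    have "scal a \<odot>\<^bsub>M\<^esub> x = (\<Oplus>\<^bsub>M\<^esub>b\<in>B. scal a \<odot>\<^bsub>M\<^esub> (scal (c b) \<odot>\<^bsub>M\<^esub> b))"
      unfolding x using B cl by (intro smult_finsum) (auto simp: scal_C)
    also have "\<dots> = ?comb (\<lambda>b. a * c b)"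
      using eq cl by (intro M.finsum_cong') auto
    finally show "scal a \<odot>\<^bsub>M\<^esub> x \<in> range ?comb"
      by (rule range_eqI[of _ ?comb "\<lambda>b. a * c b"])
  qed
  moreover have "B \<subseteq> range ?comb"
  proof
    fix b0 assume b0: "b0 \<in> B"
    have "?comb (\<lambda>b. if b0 = b then 1 else 0) = (\<Oplus>\<^bsub>M\<^esub>b\<in>B. if b0 = b then b else \<zero>\<^bsub>M\<^esub>)"
      using B V by (intro M.finsum_cong') auto
    also have "\<dots> = b0"
      using b0 B V by (intro M.finsum_singleton) auto
    finally show "b0 \<in> range ?comb"
      by (intro range_eqI[of _ ?comb "\<lambda>b. if b0 = b then 1 else 0"]) (rule sym)
  qed
  ultimately have "V \<subseteq> range ?comb" by (rule span)
  then show "finite_dimensional M V" using B unfolding finite_dimensional_def by blast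
qed

lemma weight_space_lin_closed: "lin_closed M (weight_space M \<mu>)"
  by (simp add: lin_closed_def weight_space_zero weight_space_add weight_space_scal)

end

lemma finitely_spanned_image:
  assumes V: "finitely_spanned M V" "lin_closed M V"
    and zero: "f \<zero>\<^bsub>M\<^esub> = \<zero>\<^bsub>M'\<^esub>"
    and add: "\<And>x y. x \<in> V \<Longrightarrow> y \<in> V \<Longrightarrow> f (x \<oplus>\<^bsub>M\<^esub> y) = f x \<oplus>\<^bsub>M'\<^esub> f y"
    and scal: "\<And>c x. x \<in> V \<Longrightarrow> f (scal c \<odot>\<^bsub>M\<^esub> x) = scal c \<odot>\<^bsub>M'\<^esub> f x"
  shows "finitely_spanned M' (f ` V)"
proof -
  obtain B where B: "finite B" "B \<subseteq> V"
    and span: "\<And>S. lin_closed M S \<Longrightarrow> B \<subseteq> S \<Longrightarrow> V \<subseteq> S"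
    using V unfolding finitely_spanned_def by blast
  have "f ` V \<subseteq> S" if S: "lin_closed M' S" "f ` B \<subseteq> S" for S
  proof -
    have "lin_closed M {v \<in> V. f v \<in> S}"
      using S(1) V(2) zero add scal unfolding lin_closed_def by auto
    from span[OF this] show ?thesis using S B by auto
  qed
  then show ?thesis
    unfolding finitely_spanned_def using B by (intro exI[of _ "f ` B"]) auto
qed

lemma finitely_spanned_sum:
  assumes "finitely_spanned M V1" "finitely_spanned M V2" "V1 \<subseteq> W" "V2 \<subseteq> W"
    and W: "\<And>w. w \<in> W \<Longrightarrow> \<exists>x\<in>V1. \<exists>y\<in>V2. w = x \<oplus>\<^bsub>M\<^esub> y"
  shows "finitely_spanned M W"
proof -
  obtain B1 where B1: "finite B1" "B1 \<subseteq> V1" "\<And>S. lin_closed M S \<Longrightarrow> B1 \<subseteq> S \<Longrightarrow> V1 \<subseteq> S"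
    using assms(1) unfolding finitely_spanned_def by blast
  obtain B2 where B2: "finite B2" "B2 \<subseteq> V2" "\<And>S. lin_closed M S \<Longrightarrow> B2 \<subseteq> S \<Longrightarrow> V2 \<subseteq> S"
    using assms(2) unfolding finitely_spanned_def by blast
  have "W \<subseteq> S" if S: "lin_closed M S" "B1 \<union> B2 \<subseteq> S" for S
  proof
    fix w assume "w \<in> W"
    then obtain x y where "x \<in> V1" "y \<in> V2" "w = x \<oplus>\<^bsub>M\<^esub> y" using W by blast
    moreover have "x \<in> S" "y \<in> S"
      using B1(3)[OF S(1)] B2(3)[OF S(1)] S(2) \<open>x \<in> V1\<close> \<open>y \<in> V2\<close> by auto
    ultimately show "w \<in> S" using S(1) unfolding lin_closed_def by blast
  qed
  then show ?thesis
    unfolding finitely_spanned_def using B1 B2 assms by (intro exI[of _ "B1 \<union> B2"]) auto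
qed

lemma finitely_spanned_zero: "finitely_spanned M {\<zero>\<^bsub>M\<^esub>}"
  unfolding finitely_spanned_def by (intro exI[of _ "{}"]) (auto simp: lin_closed_def)

lemma mem_weight_modules_Weyl_ev:
  "M \<in> weight_modules Weyl_ev \<and> supp M \<subseteq> T \<longleftrightarrow>
     left_module Weyl_ev M \<and> carrier M \<subseteq> Res_carrier T M \<and> (\<forall>\<mu>. finitely_spanned M (weight_space M \<mu>))"
proof (cases "left_module Weyl_ev M")
  case True
  then interpret weyl_like_module Weyl_ev M even_ops using weyl_ev_module_iff by blast
  have "weight_space M \<mu> \<subseteq> carrier M" for \<mu> by (auto simp: weight_space_def)
  then show ?thesis using True weight_module_iff[of T] by (auto simp: weight_modules_def finite_dimensional_iff)
qed (simp add: weight_modules_def)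

lemma mem_weight_modules_Weyl:
  "M \<in> weight_modules Weyl \<and> supp M \<subseteq> T \<longleftrightarrow>
     left_module Weyl M \<and> carrier M \<subseteq> Res_carrier T M \<and> (\<forall>\<mu>. finitely_spanned M (weight_space M \<mu>))"
proof (cases "left_module Weyl M")
  case True
  then interpret weyl_like_module Weyl M weyl_carrier using weyl_module_iff by blast
  have "weight_space M \<mu> \<subseteq> carrier M" for \<mu> by (auto simp: weight_space_def)
  then show ?thesis using True weight_module_iff[of T] by (auto simp: weight_modules_def finite_dimensional_iff)
qed (simp add: weight_modules_def)

section \<open>Cosets and the parity splitting of weights\<close>

text \<open>
  \<open>T0\<close> is the coset of \<open>Q\<close> under consideration and \<open>T1\<close> its complement in the coset of \<open>P\<close>; an odd
  generator exchanges them.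
\<close>

locale parity_split =
  fixes T0 T1 :: "(complex ^ 'n::finite) set"
  assumes disjoint: "T0 \<inter> T1 = {}"
    and Q_stable: "\<mu> \<in> T0 \<Longrightarrow> \<alpha> \<in> Q_lattice \<Longrightarrow> \<mu> + \<alpha> \<in> T0"
    and T0_axis: "\<mu> \<in> T0 \<Longrightarrow> \<mu> + axis i 1 \<in> T1" "\<mu> \<in> T0 \<Longrightarrow> \<mu> + - axis i 1 \<in> T1"
    and T1_axis: "\<mu> \<in> T1 \<Longrightarrow> \<mu> + axis i 1 \<in> T0" "\<mu> \<in> T1 \<Longrightarrow> \<mu> + - axis i 1 \<in> T0"

lemma coset_parity_split:
  assumes "nubar \<in> coset_space Q_lattice"
  shows "parity_split nubar (coset_projection nubar - nubar)"
    and "nubar \<subseteq> coset_projection nubar"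
proof -
  obtain x where nu: "nubar = {y. y - x \<in> Q_lattice}"
    using assms by (auto simp: coset_space_def quotient_def congruent_mod_def)
  have mu: "coset_projection nubar = {y. y - x \<in> P_lattice}"
  proof (intro equalityI subsetI)
    fix y assume "y \<in> coset_projection nubar"
    then obtain z where "z - x \<in> Q_lattice" "y - z \<in> P_lattice"
      by (auto simp: coset_projection_def congruent_mod_def nu)
    then have "(y - z) + (z - x) \<in> P_lattice" using Q_lattice_subset by (intro P_lattice_add) auto
    then show "y \<in> {y. y - x \<in> P_lattice}" by simp
  next
    fix y assume "y \<in> {y. y - x \<in> P_lattice}"
    moreover have "x \<in> nubar" by (simp add: nu Q_lattice_zero)
    ultimately show "y \<in> coset_projection nubar"
      by (auto simp: coset_projection_def congruent_mod_def)
  qed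
  show "nubar \<subseteq> coset_projection nubar" unfolding mu using Q_lattice_subset by (auto simp: nu)
  have shift: "(\<mu> + \<alpha> - x \<in> P_lattice) \<and> (\<mu> + \<alpha> - x \<in> Q_lattice \<longleftrightarrow> (\<mu> - x \<in> Q_lattice \<longleftrightarrow> \<alpha> \<in> Q_lattice))"
    if "\<mu> - x \<in> P_lattice" "\<alpha> \<in> P_lattice" for \<mu> \<alpha>
    using P_lattice_add[OF that] Q_lattice_add_iff[OF that] by (simp add: algebra_simps)
  have ax: "axis i 1 \<in> P_lattice" "axis i 1 \<notin> Q_lattice" "- axis i 1 \<in> P_lattice"
    "- axis i 1 \<notin> Q_lattice" for i :: 'a
    using axis_lattice[of i] P_lattice_uminus Q_lattice_uminus_iff by auto
  have QP: "\<alpha> \<in> P_lattice" if "\<alpha> \<in> Q_lattice" for \<alpha> :: "complex ^ 'a" using that Q_lattice_subset by blast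
  show "parity_split nubar (coset_projection nubar - nubar)"
    unfolding mu unfolding nu
    by unfold_locales (use shift ax QP in \<open>auto simp del: add_uminus_conv_diff\<close>)
qed

context weyl_like_module
begin

text \<open>
  The maps \<open>f\<close> in question are module homomorphisms and also the non-extensional unit of the
  induced module, hence the explicit hypotheses.
\<close>

lemma Res_carrier_hom:
  assumes M': "weyl_like_module R' M' C'"
    and f: "\<And>m. m \<in> carrier M \<Longrightarrow> f m \<in> carrier M'"
    and add: "\<And>m m'. m \<in> carrier M \<Longrightarrow> m' \<in> carrier M \<Longrightarrow> f (m \<oplus>\<^bsub>M\<^esub> m') = f m \<oplus>\<^bsub>M'\<^esub> f m'"
    and lin: "\<And>a m. a \<in> even_ops \<Longrightarrow> m \<in> carrier M \<Longrightarrow> f (a \<odot>\<^bsub>M\<^esub> m) = a \<odot>\<^bsub>M'\<^esub> f m"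
  shows "x \<in> weight_space M \<mu> \<Longrightarrow> f x \<in> weight_space M' \<mu>"
    and "y \<in> Res_carrier T M \<Longrightarrow> f y \<in> Res_carrier T M'"
    and "f \<zero>\<^bsub>M\<^esub> = \<zero>\<^bsub>M'\<^esub>"
proof -
  interpret M': weyl_like_module R' M' C' by fact
  show zero: "f \<zero>\<^bsub>M\<^esub> = \<zero>\<^bsub>M'\<^esub>"
    using lin[OF even_ops_zero M.zero_closed] f[OF M.zero_closed] by simp
  show w: "f x \<in> weight_space M' \<mu>" if "x \<in> weight_space M \<mu>" for x \<mu>
  proof -
    have xc: "x \<in> carrier M" using that by (rule weight_spaceD)
    have "euler i \<odot>\<^bsub>M'\<^esub> f x = scal (\<mu> $ i) \<odot>\<^bsub>M'\<^esub> f x" for i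
      using weight_spaceD(2)[OF that, of i] lin[OF even_ops_euler xc, of i]
        lin[OF even_ops_scal xc, of "\<mu> $ i"] by simp
    then show ?thesis using f[OF xc] by (simp add: weight_space_def)
  qed
  show "f y \<in> Res_carrier T M'" if "y \<in> Res_carrier T M"
    using that
    by (induction rule: Res_carrier_induct)
      (auto simp: zero add M'.Res_carrier_zero M'.Res_carrier_add intro: M'.Res_carrier_weight w)
qed

end

lemma module_homD:
  assumes "f \<in> module_hom R M M'"
  shows "x \<in> carrier M \<Longrightarrow> f x \<in> carrier M'"
    and "x \<in> carrier M \<Longrightarrow> y \<in> carrier M \<Longrightarrow> f (x \<oplus>\<^bsub>M\<^esub> y) = f x \<oplus>\<^bsub>M'\<^esub> f y"
    and "a \<in> carrier R \<Longrightarrow> x \<in> carrier M \<Longrightarrow> f (a \<odot>\<^bsub>M\<^esub> x) = a \<odot>\<^bsub>M'\<^esub> f x"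
  using assms by (auto simp: module_hom_def)

section \<open>Restriction\<close>

locale weyl_module = left_module Weyl N for N :: "(('n::finite) oper, 'u) module"
begin

sublocale weyl_like_module Weyl N weyl_carrier
  using left_module_axioms weyl_module_iff by blast

lemma odd_splitting:
  assumes "n \<in> carrier N"
  shows "n = pdiff i \<odot>\<^bsub>N\<^esub> (tvar i \<odot>\<^bsub>N\<^esub> n) \<oplus>\<^bsub>N\<^esub> tvar i \<odot>\<^bsub>N\<^esub> (scal (-1) \<odot>\<^bsub>N\<^esub> (pdiff i \<odot>\<^bsub>N\<^esub> n))"
proof -
  have W: "pdiff i \<in> weyl_carrier" "tvar i \<in> weyl_carrier" "scal (-1) \<in> weyl_carrier"
    by (rule weyl_carrier.intros)+
  have "n = (\<lambda>p. (pdiff i \<circ> tvar i) p + (tvar i \<circ> (scal (-1) \<circ> pdiff i)) p) \<odot>\<^bsub>N\<^esub> n"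
    using odd_decomposition[of i "\<lambda>p. p"] assms by (simp add: comp_def)
  also have "\<dots> = (pdiff i \<circ> tvar i) \<odot>\<^bsub>N\<^esub> n \<oplus>\<^bsub>N\<^esub> (tvar i \<circ> (scal (-1) \<circ> pdiff i)) \<odot>\<^bsub>N\<^esub> n"
    using assms W by (intro smult_l_distr' weyl_carrier.comp)
  also have "(pdiff i \<circ> tvar i) \<odot>\<^bsub>N\<^esub> n = pdiff i \<odot>\<^bsub>N\<^esub> (tvar i \<odot>\<^bsub>N\<^esub> n)"
    using assms W by (simp add: smult_assoc')
  also have "(tvar i \<circ> (scal (-1) \<circ> pdiff i)) \<odot>\<^bsub>N\<^esub> n =
      tvar i \<odot>\<^bsub>N\<^esub> (scal (-1) \<odot>\<^bsub>N\<^esub> (pdiff i \<odot>\<^bsub>N\<^esub> n))"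
    unfolding smult_assoc'[OF W(3,1) assms]
    by (rule smult_assoc'[OF W(2) weyl_carrier.comp[OF W(3,1)] assms, symmetric])
  finally show ?thesis .
qed

lemma Res_carrier_odd:
  assumes "parity_split T0 T1"
  shows "x \<in> Res_carrier T0 N \<Longrightarrow> tvar i \<odot>\<^bsub>N\<^esub> x \<in> Res_carrier T1 N"
    and "x \<in> Res_carrier T0 N \<Longrightarrow> pdiff i \<odot>\<^bsub>N\<^esub> x \<in> Res_carrier T1 N"
    and "x \<in> Res_carrier T1 N \<Longrightarrow> tvar i \<odot>\<^bsub>N\<^esub> x \<in> Res_carrier T0 N"
    and "x \<in> Res_carrier T1 N \<Longrightarrow> pdiff i \<odot>\<^bsub>N\<^esub> x \<in> Res_carrier T0 N"
proof -
  show "tvar i \<odot>\<^bsub>N\<^esub> x \<in> Res_carrier T1 N" if "x \<in> Res_carrier T0 N"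
    by (rule Res_carrier_smult[OF weyl_carrier.tvar tvar_degree _ that]) (rule parity_split.T0_axis(1)[OF assms])
  show "pdiff i \<odot>\<^bsub>N\<^esub> x \<in> Res_carrier T1 N" if "x \<in> Res_carrier T0 N"
    by (rule Res_carrier_smult[OF weyl_carrier.pdiff pdiff_degree _ that]) (rule parity_split.T0_axis(2)[OF assms])
  show "tvar i \<odot>\<^bsub>N\<^esub> x \<in> Res_carrier T0 N" if "x \<in> Res_carrier T1 N"
    by (rule Res_carrier_smult[OF weyl_carrier.tvar tvar_degree _ that]) (rule parity_split.T1_axis(1)[OF assms])
  show "pdiff i \<odot>\<^bsub>N\<^esub> x \<in> Res_carrier T0 N" if "x \<in> Res_carrier T1 N"
    by (rule Res_carrier_smult[OF weyl_carrier.pdiff pdiff_degree _ that]) (rule parity_split.T1_axis(2)[OF assms])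
qed

lemma Res_carrier_scal: "x \<in> Res_carrier T N \<Longrightarrow> scal c \<odot>\<^bsub>N\<^esub> x \<in> Res_carrier T N"
  using Res_carrier_smult[OF scal_C scal_degree, of T T] by simp

abbreviation "Res_mod T \<equiv> N\<lparr>carrier := Res_carrier T N\<rparr>"

lemma Res_left_module:
  assumes split: "parity_split T0 T1"
  shows "left_module Weyl_ev (Res_mod T0)"
proof -
  note c = Res_carrier_closed
  have ev: "a \<in> weyl_carrier" if "a \<in> even_ops" for a :: "'n oper"
    using that even_ops_subset by blast
  have "abelian_group (Res_mod T0)"
  proof (rule abelian_groupI)
    fix x assume x: "x \<in> carrier (Res_mod T0)"
    then have "scal (-1) \<odot>\<^bsub>N\<^esub> x \<oplus>\<^bsub>N\<^esub> x = \<zero>\<^bsub>N\<^esub>"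
      using c by (simp add: smult_minus_one M.l_neg)
    then show "\<exists>y\<in>carrier (Res_mod T0). y \<oplus>\<^bsub>Res_mod T0\<^esub> x = \<zero>\<^bsub>Res_mod T0\<^esub>"
      using x Res_carrier_scal by auto
  qed (auto simp: Res_carrier_zero Res_carrier_add M.a_assoc dest!: c intro: M.a_comm)
  then show ?thesis
    using Res_carrier_even_smult[OF _ parity_split.Q_stable[OF split]]
    by (intro left_module.intro left_module_axioms.intro ring_Weyl_ev)
      (simp_all add: c ev smult_l_distr' smult_r_distr smult_assoc')
qed

lemma Res_weight_space: "weight_space (Res_mod T) \<mu> = weight_space N \<mu> \<inter> Res_carrier T N"
  using Res_carrier_closed by (auto simp: weight_space_def)

lemma Res_weight_module:
  assumes split: "parity_split T0 T1"
  shows "carrier (Res_mod T0) \<subseteq> Res_carrier T0 (Res_mod T0)"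
proof
  interpret R: weyl_like_module Weyl_ev "Res_mod T0" even_ops
    using Res_left_module[OF split] weyl_ev_module_iff by blast
  fix x assume "x \<in> carrier (Res_mod T0)"
  then have "x \<in> Res_carrier T0 N" by simp
  then show "x \<in> Res_carrier T0 (Res_mod T0)"
  proof (induction rule: Res_carrier_induct)
    case zero
    show ?case using R.Res_carrier_zero by simp
  next
    case (add x y)
    then show ?case using R.Res_carrier_add[of x T0 y] by simp
  next
    case (homogeneous \<mu> x)
    then show ?case using R.Res_carrier_weight[of \<mu> T0 x] Res_carrier_weight[of \<mu> T0 x]
      by (simp add: Res_weight_space)
  qed
qed

text \<open>
  For weights in \<open>T0\<close> the weight space does not change; for all others it becomes zero by
  independence.
\<close>

lemma Res_finitely_spanned:
  assumes "parity_split T0 T1" and fin: "\<And>\<mu>. finitely_spanned N (weight_space N \<mu>)"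
  shows "finitely_spanned (Res_mod T0) (weight_space (Res_mod T0) \<mu>)"
proof -
  interpret R: weyl_like_module Weyl_ev "Res_mod T0" even_ops
    using Res_left_module[OF assms(1)] weyl_ev_module_iff by blast
  show ?thesis
  proof (cases "\<mu> \<in> T0")
    case True
    then have "weight_space (Res_mod T0) \<mu> = weight_space N \<mu>"
      using Res_carrier_weight by (auto simp: Res_weight_space)
    moreover have "lin_closed (Res_mod T0) = lin_closed N" by (rule ext) (simp add: lin_closed_def)
    ultimately show ?thesis using fin[of \<mu>] by (simp add: finitely_spanned_def)
  next
    case False
    have "x = \<zero>\<^bsub>N\<^esub>" if "x \<in> weight_space (Res_mod T0) \<mu>" for x
      using that False Res_carrier_weight[of \<mu> "{\<mu>}" x] Res_carrier_disjoint[of x "{\<mu>}" T0]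
      by (auto simp: Res_weight_space)
    then have "weight_space (Res_mod T0) \<mu> \<subseteq> {\<zero>\<^bsub>Res_mod T0\<^esub>}" by auto
    then have "weight_space (Res_mod T0) \<mu> = {\<zero>\<^bsub>Res_mod T0\<^esub>}"
      using R.weight_space_zero[of \<mu>] by blast
    then show ?thesis using finitely_spanned_zero[of "Res_mod T0"] by (simp only:)
  qed
qed

lemma Res_hom:
  assumes split: "parity_split T0 T1" and N': "left_module Weyl N'" and f: "f \<in> module_hom Weyl N N'"
  shows "restrict f (Res_carrier T0 N) \<in> module_hom Weyl_ev (Res_mod T0) (N'\<lparr>carrier := Res_carrier T0 N'\<rparr>)"
proof -
  have ev: "a \<in> weyl_carrier" if "a \<in> even_ops" for a :: "'n oper"
    using that even_ops_subset by blast
  have "weyl_like_module Weyl N' weyl_carrier" using N' weyl_module_iff by blast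
  then have "f x \<in> Res_carrier T0 N'" if "x \<in> Res_carrier T0 N" for x
    using that module_homD[OF f] ev by (intro Res_carrier_hom(2)[of Weyl N' weyl_carrier]) auto
  then show ?thesis
    using f Res_carrier_closed Res_carrier_add ev
      Res_carrier_even_smult[OF _ parity_split.Q_stable[OF split]]
    by (auto simp: module_hom_def)
qed

end

section \<open>Weights of the induced module\<close>

context weyl_induced
begin

sublocale NW: weyl_module N
  by unfold_locales

lemma j_weights:
  shows "x \<in> weight_space M \<mu> \<Longrightarrow> j x \<in> weight_space N \<mu>"
    and "y \<in> Res_carrier T M \<Longrightarrow> j y \<in> Res_carrier T N"
    and "j \<zero>\<^bsub>M\<^esub> = \<zero>\<^bsub>N\<^esub>"
  using M.Res_carrier_hom[OF N.weyl_like_module_axioms j_closed j_add j_smult] by blast+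

context
  fixes T0 T1
  assumes split: "parity_split T0 T1" and M_T0: "carrier M \<subseteq> Res_carrier T0 M"
begin

lemma graded_generation:
  assumes "n \<in> carrier N"
  obtains m n1 where "m \<in> carrier M" "j m \<in> Res_carrier T0 N" "n1 \<in> Res_carrier T1 N" "n = j m \<oplus>\<^bsub>N\<^esub> n1"
proof -
  have jT: "j m \<in> Res_carrier T0 N" if "m \<in> carrier M" for m
    using that M_T0 by (intro j_weights) auto
  obtain m0 m1 m2 where m: "m0 \<in> carrier M" "m1 \<in> carrier M" "m2 \<in> carrier M"
    and n: "n = j m0 \<oplus>\<^bsub>N\<^esub> (pdiff undefined \<odot>\<^bsub>N\<^esub> j m1 \<oplus>\<^bsub>N\<^esub> tvar undefined \<odot>\<^bsub>N\<^esub> j m2)"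
    using generation[OF assms] by blast
  show thesis
    by (rule that[OF m(1) jT[OF m(1)] _ n])
      (intro N.Res_carrier_add NW.Res_carrier_odd(1,2)[OF split] jT m)
qed

lemma induced_weight_module: "carrier N \<subseteq> Res_carrier (T0 \<union> T1) N"
proof
  fix n assume "n \<in> carrier N"
  then obtain m n1 where "j m \<in> Res_carrier T0 N" "n1 \<in> Res_carrier T1 N" "n = j m \<oplus>\<^bsub>N\<^esub> n1"
    using graded_generation by blast
  then show "n \<in> Res_carrier (T0 \<union> T1) N"
    using N.Res_carrier_mono[of T0 "T0 \<union> T1"] N.Res_carrier_mono[of T1 "T0 \<union> T1"]
    by (auto intro!: N.Res_carrier_add)
qed

text \<open>
  An element with weights in \<open>T0\<close> has no component in \<open>\<partial>\<^sub>i j(M) + t\<^sub>i j(M)\<close>, whose weights lie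
  in \<open>T1\<close>.
\<close>

lemma Res_induced: "Res_carrier T0 N = j ` carrier M"
proof
  show "j ` carrier M \<subseteq> Res_carrier T0 N" using M_T0 j_weights by blast
  show "Res_carrier T0 N \<subseteq> j ` carrier M"
  proof
    fix n assume n: "n \<in> Res_carrier T0 N"
    obtain m n1 where m: "m \<in> carrier M" and jm: "j m \<in> Res_carrier T0 N"
      and n1: "n1 \<in> Res_carrier T1 N" and eq: "n = j m \<oplus>\<^bsub>N\<^esub> n1"
      using graded_generation[OF N.Res_carrier_closed[OF n]] by blast
    have c: "j m \<in> carrier N" "n1 \<in> carrier N" using jm n1 N.Res_carrier_closed by auto
    have "n1 = scal (-1) \<odot>\<^bsub>N\<^esub> j m \<oplus>\<^bsub>N\<^esub> n"
      unfolding eq using c by (simp add: N.smult_minus_one N.M.a_assoc[symmetric] N.M.l_neg)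
    then have "n1 \<in> Res_carrier T0 N"
      using n jm by (simp add: N.Res_carrier_add NW.Res_carrier_scal)
    then have "n1 = \<zero>\<^bsub>N\<^esub>"
      using n1 parity_split.disjoint[OF split] by (rule N.Res_carrier_disjoint)
    then show "n \<in> j ` carrier M" using eq m c by simp
  qed
qed

lemma induced_weight_space:
  assumes "\<mu> \<in> T0" shows "weight_space N \<mu> = j ` weight_space M \<mu>"
proof
  show "j ` weight_space M \<mu> \<subseteq> weight_space N \<mu>" using j_weights by blast
  show "weight_space N \<mu> \<subseteq> j ` weight_space M \<mu>"
  proof
    fix n assume n: "n \<in> weight_space N \<mu>"
    then have "n \<in> j ` carrier M"
      using N.Res_carrier_weight[OF assms n] Res_induced by blast
    then obtain m where m: "m \<in> carrier M" "n = j m" by blast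
    have "euler i \<odot>\<^bsub>M\<^esub> m = scal (\<mu> $ i) \<odot>\<^bsub>M\<^esub> m" for i
    proof (rule inj_onD[OF j_inj])
      show "j (euler i \<odot>\<^bsub>M\<^esub> m) = j (scal (\<mu> $ i) \<odot>\<^bsub>M\<^esub> m)"
        using N.weight_spaceD(2)[OF n] m by (simp add: j_smult even_ops_euler even_ops_scal)
    qed (use m in \<open>auto intro!: M.smult_closed' even_ops_euler even_ops_scal\<close>)
    then show "n \<in> j ` weight_space M \<mu>" using m by (auto simp: weight_space_def)
  qed
qed

text \<open>
  A weight space of \<open>N\<close> with weight in \<open>T0\<close> is a copy of one of \<open>M\<close>; one with weight \<open>\<mu>\<close> in \<open>T1\<close> is
  the sum of the images of two weight spaces of the first kind, those of weights \<open>\<mu> + \<epsilon>\<^sub>i\<close>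
  under \<open>\<partial>\<^sub>i\<close> and \<open>\<mu> - \<epsilon>\<^sub>i\<close> under \<open>t\<^sub>i\<close>.
\<close>

lemma induced_finitely_spanned:
  assumes fin: "\<And>\<mu>. finitely_spanned M (weight_space M \<mu>)"
  shows "finitely_spanned N (weight_space N \<mu>)"
proof -
  have T0: "finitely_spanned N (weight_space N \<mu>)" if "\<mu> \<in> T0" for \<mu>
    unfolding induced_weight_space[OF that]
    using fin M.weight_space_lin_closed j_weights(3)
    by (rule finitely_spanned_image)
      (auto simp: weight_space_def j_add j_smult even_ops_scal)
  consider "\<mu> \<in> T0" | "\<mu> \<in> T1" | "\<mu> \<notin> T0 \<union> T1" by blast
  then show ?thesis
  proof cases
    case 1
    then show ?thesis by (rule T0)
  next
    case 2
    let ?i = "undefined :: 'n"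
    let ?U = "weight_space N (\<mu> + axis ?i 1)" and ?V = "weight_space N (\<mu> + - axis ?i 1)"
    have W: "pdiff ?i \<in> weyl_carrier" "tvar ?i \<in> weyl_carrier"
      by (rule weyl_carrier.intros)+
    have img: "finitely_spanned N ((\<lambda>n. a \<odot>\<^bsub>N\<^esub> n) ` weight_space N \<nu>)"
      if "a \<in> weyl_carrier" "\<nu> \<in> T0" for a \<nu>
    proof (rule finitely_spanned_image[OF T0[OF that(2)] N.weight_space_lin_closed])
      fix c x assume x: "x \<in> weight_space N \<nu>"
      have "a \<circ> scal c = scal c \<circ> a" using weyl_linear(2)[OF that(1)] by auto
      then show "a \<odot>\<^bsub>N\<^esub> (scal c \<odot>\<^bsub>N\<^esub> x) = scal c \<odot>\<^bsub>N\<^esub> (a \<odot>\<^bsub>N\<^esub> x)"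
        using x that by (simp add: N.smult_assoc' N.scal_C N.weight_spaceD(1))
    qed (use that in \<open>auto simp: N.smult_r_null N.smult_r_distr N.weight_spaceD(1)\<close>)
    have d: "pdiff ?i \<odot>\<^bsub>N\<^esub> x \<in> weight_space N \<mu>" if "x \<in> ?U" for x
      using N.weight_space_smult[OF W(1) pdiff_degree that] by simp
    have t: "tvar ?i \<odot>\<^bsub>N\<^esub> x \<in> weight_space N \<mu>" if "x \<in> ?V" for x
      using N.weight_space_smult[OF W(2) tvar_degree that] by simp
    show ?thesis
    proof (rule finitely_spanned_sum)
      show "finitely_spanned N ((\<lambda>n. pdiff ?i \<odot>\<^bsub>N\<^esub> n) ` ?U)"
        "finitely_spanned N ((\<lambda>n. tvar ?i \<odot>\<^bsub>N\<^esub> n) ` ?V)"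
        using img W parity_split.T1_axis[OF split 2] by blast+
      show "(\<lambda>n. pdiff ?i \<odot>\<^bsub>N\<^esub> n) ` ?U \<subseteq> weight_space N \<mu>" using d by blast
      show "(\<lambda>n. tvar ?i \<odot>\<^bsub>N\<^esub> n) ` ?V \<subseteq> weight_space N \<mu>" using t by blast
      fix n assume n: "n \<in> weight_space N \<mu>"
      have "tvar ?i \<odot>\<^bsub>N\<^esub> n \<in> ?U" using N.weight_space_smult[OF W(2) tvar_degree n] .
      moreover have "scal (-1) \<odot>\<^bsub>N\<^esub> (pdiff ?i \<odot>\<^bsub>N\<^esub> n) \<in> ?V"
        using N.weight_space_scal N.weight_space_smult[OF W(1) pdiff_degree n] by blast
      ultimately show "\<exists>x\<in>(\<lambda>n. pdiff ?i \<odot>\<^bsub>N\<^esub> n) ` ?U. \<exists>y\<in>(\<lambda>n. tvar ?i \<odot>\<^bsub>N\<^esub> n) ` ?V. n = x \<oplus>\<^bsub>N\<^esub> y"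
        using NW.odd_splitting[OF N.weight_spaceD(1)[OF n], of ?i] by blast
    qed
  next
    case 3
    have "x = \<zero>\<^bsub>N\<^esub>" if "x \<in> weight_space N \<mu>" for x
      using that 3 N.Res_carrier_weight[of \<mu> "{\<mu>}" x] N.Res_carrier_disjoint[of x "{\<mu>}" "T0 \<union> T1"]
        induced_weight_module N.weight_spaceD(1)[OF that] by auto
    then have "weight_space N \<mu> = {\<zero>\<^bsub>N\<^esub>}" using N.weight_space_zero by blast
    then show ?thesis by (simp add: finitely_spanned_zero)
  qed
qed

end

end

section \<open>Categories of modules\<close>

lemma module_category_simps [simp]:
  "Ob (module_category R S) = S"
  "Hom (module_category R S) = module_hom R"
  "Idn (module_category R S) M = (\<lambda>x\<in>carrier M. x)"
  "Cmp (module_category R S) L M N g f = compose (carrier L) g f"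
  by (simp_all add: module_category_def)

lemma module_hom_compose:
  assumes "f \<in> module_hom R L M" "g \<in> module_hom R M N" "left_module R L"
  shows "compose (carrier L) g f \<in> module_hom R L N"
proof -
  interpret left_module R L by fact
  show ?thesis
    using module_homD[OF assms(1)] module_homD[OF assms(2)] smult_closed
    by (auto simp: module_hom_def compose_def)
qed

lemma module_hom_id:
  assumes "left_module R M" shows "(\<lambda>x\<in>carrier M. x) \<in> module_hom R M M"
proof -
  interpret left_module R M by fact
  show ?thesis using smult_closed by (auto simp: module_hom_def)
qed

lemma is_category_module_category:
  assumes "\<And>M. M \<in> S \<Longrightarrow> left_module R M"
  shows "is_category (module_category R S)"
proof -
  have ext: "f \<in> carrier X \<rightarrow>\<^sub>E carrier Y" if "f \<in> module_hom R X Y" for f X Y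
    using that by (simp add: module_hom_def)
  have unit: "compose (carrier X) f (\<lambda>x\<in>carrier X. x) = f" "compose (carrier X) (\<lambda>x\<in>carrier Y. x) f = f"
    if "f \<in> module_hom R X Y" for f X Y
    using ext[OF that] by (auto simp: compose_def fun_eq_iff PiE_def extensional_def restrict_def)
  have assoc: "compose (carrier W) h (compose (carrier W) g f) = compose (carrier W) (compose (carrier X) h g) f"
    if "f \<in> module_hom R W X" for W X f g h
    using ext[OF that] by (auto simp: compose_def fun_eq_iff restrict_def)
  show ?thesis
    unfolding is_category_def module_category_simps
  proof (intro conjI ballI)
    show "(\<lambda>x\<in>carrier X. x) \<in> module_hom R X X" if "X \<in> S" for X
      using assms[OF that] by (rule module_hom_id)
    show "compose (carrier X) g f \<in> module_hom R X Z"
      if "X \<in> S" "f \<in> module_hom R X Y" "g \<in> module_hom R Y Z" for X Y Z f g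
      using that(2,3) assms[OF that(1)] by (rule module_hom_compose)
  qed (simp_all add: unit, rule assoc)
qed

lemma module_iso_arrow:
  assumes M: "left_module R M" and M': "left_module R M'" and f: "f \<in> module_hom R M M'"
    and bij: "bij_betw f (carrier M) (carrier M')"
  shows "is_iso_arrow (module_category R S) M M' f"
proof -
  interpret M: left_module R M by fact
  interpret M': left_module R M' by fact
  let ?g = "\<lambda>y\<in>carrier M'. inv_into (carrier M) f y"
  note fD = module_homD[OF f]
  have gc: "?g y \<in> carrier M" if "y \<in> carrier M'" for y
    using that bij by (simp add: bij_betw_def inv_into_into)
  have fg: "f (?g y) = y" if "y \<in> carrier M'" for y
    using that bij by (simp add: bij_betw_def f_inv_into_f)
  have gf: "?g (f x) = x" if "x \<in> carrier M" for x
    using that bij fD(1) by (simp add: bij_betw_def)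
  have inj: "x = x'" if "f x = f x'" "x \<in> carrier M" "x' \<in> carrier M" for x x'
    using that bij by (auto simp: bij_betw_def dest: inj_onD)
  have "?g \<in> module_hom R M' M"
    unfolding module_hom_def
  proof (intro CollectI conjI ballI)
    show "?g \<in> carrier M' \<rightarrow>\<^sub>E carrier M" using gc by auto
    show "?g (x \<oplus>\<^bsub>M'\<^esub> y) = ?g x \<oplus>\<^bsub>M\<^esub> ?g y" if xy: "x \<in> carrier M'" "y \<in> carrier M'" for x y
    proof (rule inj)
      have c: "x \<oplus>\<^bsub>M'\<^esub> y \<in> carrier M'" using xy by simp
      show "f (?g (x \<oplus>\<^bsub>M'\<^esub> y)) = f (?g x \<oplus>\<^bsub>M\<^esub> ?g y)"
        unfolding fg[OF c] fD(2)[OF gc[OF xy(1)] gc[OF xy(2)]] fg[OF xy(1)] fg[OF xy(2)] ..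
      show "?g (x \<oplus>\<^bsub>M'\<^esub> y) \<in> carrier M" using gc[OF c] .
      show "?g x \<oplus>\<^bsub>M\<^esub> ?g y \<in> carrier M" by (rule M.M.add.m_closed[OF gc[OF xy(1)] gc[OF xy(2)]])
    qed
    show "?g (a \<odot>\<^bsub>M'\<^esub> x) = a \<odot>\<^bsub>M\<^esub> ?g x" if a: "a \<in> carrier R" and x: "x \<in> carrier M'" for a x
    proof (rule inj)
      have c: "a \<odot>\<^bsub>M'\<^esub> x \<in> carrier M'" using a x by (rule M'.smult_closed)
      show "f (?g (a \<odot>\<^bsub>M'\<^esub> x)) = f (a \<odot>\<^bsub>M\<^esub> ?g x)"
        unfolding fg[OF c] fD(3)[OF a gc[OF x]] fg[OF x] ..
      show "?g (a \<odot>\<^bsub>M'\<^esub> x) \<in> carrier M" using gc[OF c] .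
      show "a \<odot>\<^bsub>M\<^esub> ?g x \<in> carrier M" using a gc[OF x] by (rule M.smult_closed)
    qed
  qed
  moreover have "compose (carrier M) ?g f = (\<lambda>x\<in>carrier M. x)"
    using gf unfolding compose_def by (intro restrict_ext)
  moreover have "compose (carrier M') f ?g = (\<lambda>x\<in>carrier M'. x)"
    using fg unfolding compose_def by (intro restrict_ext)
  ultimately show ?thesis
    using f unfolding is_iso_arrow_def by (auto intro!: bexI[of _ ?g] simp del: restrict_apply)
qed

section \<open>Unit and counit\<close>

lemma (in weyl_induced) unit_iso:
  assumes split: "parity_split T0 T1" and M_T0: "carrier M \<subseteq> Res_carrier T0 M"
  shows "is_iso_arrow (module_category Weyl_ev S) M (N\<lparr>carrier := Res_carrier T0 N\<rparr>) (restrict j (carrier M))"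
proof (rule module_iso_arrow[OF M.left_module_axioms NW.Res_left_module[OF split]])
  note Res = Res_induced[OF split M_T0]
  show "restrict j (carrier M) \<in> module_hom Weyl_ev M (N\<lparr>carrier := Res_carrier T0 N\<rparr>)"
    by (auto simp: module_hom_def Res j_add j_smult M.smult_closed')
  show "bij_betw (restrict j (carrier M)) (carrier M) (carrier (N\<lparr>carrier := Res_carrier T0 N\<rparr>))"
    using j_inj by (simp add: bij_betw_def Res)
qed

text \<open>
  Onto: a vector of odd weight is \<open>\<partial>\<^sub>i (t\<^sub>i n) - t\<^sub>i (\<partial>\<^sub>i n)\<close>, where \<open>t\<^sub>i n\<close> and \<open>\<partial>\<^sub>i n\<close> lie in the
  restriction. One-to-one: writing a kernel element as \<open>j m\<^sub>0 + \<partial>\<^sub>i j m\<^sub>1 + t\<^sub>i j m\<^sub>2\<close>, the weights force \<open>m\<^sub>0 = 0\<close> and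
  \<open>\<partial>\<^sub>i m\<^sub>1 + t\<^sub>i m\<^sub>2 = 0\<close> in \<open>N\<close>; every odd operator then annihilates the element, and hence so does
  \<open>1 = \<partial>\<^sub>i t\<^sub>i - t\<^sub>i \<partial>\<^sub>i\<close>.
\<close>

lemma counit_bij:
  assumes split: "parity_split T0 T1" and N: "left_module Weyl N"
    and N_T: "carrier N \<subseteq> Res_carrier (T0 \<union> T1) N"
    and ind: "weyl_induced (N\<lparr>carrier := Res_carrier T0 N\<rparr>) I j"
    and \<epsilon>: "\<epsilon> \<in> module_hom Weyl I N"
    and \<epsilon>_j: "\<And>m. m \<in> Res_carrier T0 N \<Longrightarrow> \<epsilon> (j m) = m"
  shows "bij_betw \<epsilon> (carrier I) (carrier N)"
proof -
  interpret N: weyl_module N using N by (simp add: weyl_module_def)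
  interpret I: weyl_induced "N.Res_mod T0" I j by fact
  note \<epsilon>D = module_homD[OF \<epsilon>]
  let ?d = "pdiff undefined :: 'a oper" and ?t = "tvar undefined :: 'a oper"
  have W: "?d \<in> weyl_carrier" "?t \<in> weyl_carrier" "(scal c :: 'a oper) \<in> weyl_carrier" for c
    by (rule weyl_carrier.intros)+
  note closed = N.Res_carrier_closed
  note j_cl = I.j_closed[simplified]
  have \<epsilon>_gen: "\<epsilon> (j m0 \<oplus>\<^bsub>I\<^esub> (?d \<odot>\<^bsub>I\<^esub> j m1 \<oplus>\<^bsub>I\<^esub> ?t \<odot>\<^bsub>I\<^esub> j m2)) =
      m0 \<oplus>\<^bsub>N\<^esub> (?d \<odot>\<^bsub>N\<^esub> m1 \<oplus>\<^bsub>N\<^esub> ?t \<odot>\<^bsub>N\<^esub> m2)"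
    if "m0 \<in> Res_carrier T0 N" "m1 \<in> Res_carrier T0 N" "m2 \<in> Res_carrier T0 N" for m0 m1 m2
    using that W by (simp add: \<epsilon>D \<epsilon>_j j_cl I.N.smult_closed')
  have kernel: "k = \<zero>\<^bsub>I\<^esub>" if k: "k \<in> carrier I" "\<epsilon> k = \<zero>\<^bsub>N\<^esub>" for k
  proof -
    obtain m0 m1 m2 where m: "m0 \<in> Res_carrier T0 N" "m1 \<in> Res_carrier T0 N" "m2 \<in> Res_carrier T0 N"
      and k_eq: "k = j m0 \<oplus>\<^bsub>I\<^esub> (?d \<odot>\<^bsub>I\<^esub> j m1 \<oplus>\<^bsub>I\<^esub> ?t \<odot>\<^bsub>I\<^esub> j m2)"
      using I.generation[OF k(1), of undefined] by auto
    define w where "w = ?d \<odot>\<^bsub>N\<^esub> m1 \<oplus>\<^bsub>N\<^esub> ?t \<odot>\<^bsub>N\<^esub> m2"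
    have w1: "w \<in> Res_carrier T1 N"
      unfolding w_def using m by (intro N.Res_carrier_add N.Res_carrier_odd(1,2)[OF split])
    have 0: "m0 \<oplus>\<^bsub>N\<^esub> w = \<zero>\<^bsub>N\<^esub>"
      using k(2) \<epsilon>_gen[OF m] by (simp add: k_eq w_def)
    have c: "m0 \<in> carrier N" "w \<in> carrier N" using closed m w1 by auto
    have "m0 = \<ominus>\<^bsub>N\<^esub> w" using 0 c by (intro N.M.minus_equality[symmetric])
    then have "m0 = scal (-1) \<odot>\<^bsub>N\<^esub> w" using c by (simp add: N.smult_minus_one)
    then have "m0 \<in> Res_carrier T1 N" using w1 N.Res_carrier_scal by simp
    with m(1) have m0: "m0 = \<zero>\<^bsub>N\<^esub>"
      using parity_split.disjoint[OF split] by (rule N.Res_carrier_disjoint)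
    then have w0: "w = \<zero>\<^bsub>N\<^esub>" using 0 c by simp
    have k1: "k = ?d \<odot>\<^bsub>I\<^esub> j m1 \<oplus>\<^bsub>I\<^esub> ?t \<odot>\<^bsub>I\<^esub> j m2"
      using k_eq I.j_weights(3) m W by (simp add: m0 I.N.smult_closed' j_cl)
    have odd0: "a \<odot>\<^bsub>I\<^esub> k = \<zero>\<^bsub>I\<^esub>" if a: "a \<in> odd_ops" for a
    proof -
      have aW: "a \<in> weyl_carrier" using a odd_ops_subset by blast
      \<comment> \<open>The products of two odd operators act through the restriction.\<close>
      have ev: "a \<circ> ?d \<in> even_ops" "a \<circ> ?t \<in> even_ops"
        using a by (simp_all add: odd_odd pdiff_odd tvar_odd)
      have "a \<odot>\<^bsub>I\<^esub> k = (a \<circ> ?d) \<odot>\<^bsub>I\<^esub> j m1 \<oplus>\<^bsub>I\<^esub> (a \<circ> ?t) \<odot>\<^bsub>I\<^esub> j m2"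
        unfolding k1 using aW W m by (simp add: I.N.smult_r_distr I.N.smult_assoc' I.N.smult_closed' j_cl)
      also have "\<dots> = j ((a \<circ> ?d) \<odot>\<^bsub>N\<^esub> m1) \<oplus>\<^bsub>I\<^esub> j ((a \<circ> ?t) \<odot>\<^bsub>N\<^esub> m2)"
        using I.j_smult[OF ev(1), of m1] I.j_smult[OF ev(2), of m2] m by simp
      also have "\<dots> = j ((a \<circ> ?d) \<odot>\<^bsub>N\<^esub> m1 \<oplus>\<^bsub>N\<^esub> (a \<circ> ?t) \<odot>\<^bsub>N\<^esub> m2)"
        using I.j_add[of "(a \<circ> ?d) \<odot>\<^bsub>N\<^esub> m1" "(a \<circ> ?t) \<odot>\<^bsub>N\<^esub> m2"] m
          N.Res_carrier_even_smult[OF ev(1) parity_split.Q_stable[OF split] m(2)]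
          N.Res_carrier_even_smult[OF ev(2) parity_split.Q_stable[OF split] m(3)] by simp
      also have "(a \<circ> ?d) \<odot>\<^bsub>N\<^esub> m1 \<oplus>\<^bsub>N\<^esub> (a \<circ> ?t) \<odot>\<^bsub>N\<^esub> m2 = a \<odot>\<^bsub>N\<^esub> w"
        unfolding w_def using aW W closed[OF m(2)] closed[OF m(3)]
        by (simp add: N.smult_r_distr N.smult_assoc' N.smult_closed')
      also have "\<dots> = \<zero>\<^bsub>N\<^esub>" unfolding w0 using aW by (simp add: N.smult_r_null)
      finally show ?thesis using I.j_weights(3) by simp
    qed
    have "k = ?d \<odot>\<^bsub>I\<^esub> (?t \<odot>\<^bsub>I\<^esub> k) \<oplus>\<^bsub>I\<^esub> ?t \<odot>\<^bsub>I\<^esub> (scal (-1) \<odot>\<^bsub>I\<^esub> (?d \<odot>\<^bsub>I\<^esub> k))"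
      by (rule I.NW.odd_splitting[OF k(1)])
    also have "\<dots> = \<zero>\<^bsub>I\<^esub>"
      using W by (simp add: odd0[OF pdiff_odd] odd0[OF tvar_odd] I.N.smult_r_null)
    finally show ?thesis .
  qed
  have "inj_on \<epsilon> (carrier I)"
  proof (rule inj_onI)
    fix x y assume xy: "x \<in> carrier I" "y \<in> carrier I" "\<epsilon> x = \<epsilon> y"
    define z where "z = x \<ominus>\<^bsub>I\<^esub> y"
    have z: "z \<in> carrier I" "x = z \<oplus>\<^bsub>I\<^esub> y"
      using xy by (simp_all add: z_def a_minus_def I.N.M.a_assoc I.N.M.l_neg)
    then have "\<epsilon> z \<oplus>\<^bsub>N\<^esub> \<epsilon> y = \<epsilon> y" using xy \<epsilon>D(2)[OF z(1) xy(2)] by simp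
    then have "\<epsilon> z = \<zero>\<^bsub>N\<^esub>"
      using \<epsilon>D(1)[OF z(1)] \<epsilon>D(1)[OF xy(2)] N.M.add.r_cancel_one by blast
    from kernel[OF z(1) this] show "x = y" using z(2) xy(2) by simp
  qed
  moreover have "\<epsilon> ` carrier I = carrier N"
  proof
    show "\<epsilon> ` carrier I \<subseteq> carrier N" using \<epsilon>D by blast
    show "carrier N \<subseteq> \<epsilon> ` carrier I"
    proof
      fix n assume "n \<in> carrier N"
      then have "n \<in> Res_carrier (T0 \<union> T1) N" using N_T by blast
      then show "n \<in> \<epsilon> ` carrier I"
      proof (induction rule: N.Res_carrier_induct)
        case zero
        show ?case using \<epsilon>_j[OF N.Res_carrier_zero] j_cl[OF N.Res_carrier_zero] by (metis image_eqI)
      next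
        case (add x y)
        then obtain x' y' where "x' \<in> carrier I" "y' \<in> carrier I" "x = \<epsilon> x'" "y = \<epsilon> y'" by blast
        then have "x \<oplus>\<^bsub>N\<^esub> y = \<epsilon> (x' \<oplus>\<^bsub>I\<^esub> y')" "x' \<oplus>\<^bsub>I\<^esub> y' \<in> carrier I"
          by (simp_all add: \<epsilon>D)
        then show ?case by blast
      next
        case (homogeneous \<mu> n)
        show ?case
        proof (cases "\<mu> \<in> T0")
          case True
          then have "n \<in> Res_carrier T0 N" using homogeneous by (intro N.Res_carrier_weight)
          then show ?thesis using \<epsilon>_j j_cl by (metis image_eqI)
        next
          case False
          then have n: "n \<in> Res_carrier T1 N" using homogeneous by (intro N.Res_carrier_weight) auto
          define m1 m2 where "m1 = ?t \<odot>\<^bsub>N\<^esub> n" and "m2 = scal (-1) \<odot>\<^bsub>N\<^esub> (?d \<odot>\<^bsub>N\<^esub> n)"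
          have m: "m1 \<in> Res_carrier T0 N" "m2 \<in> Res_carrier T0 N"
            unfolding m1_def m2_def
            by (intro N.Res_carrier_scal N.Res_carrier_odd(3,4)[OF split n])+
          have "n = ?d \<odot>\<^bsub>N\<^esub> m1 \<oplus>\<^bsub>N\<^esub> ?t \<odot>\<^bsub>N\<^esub> m2"
            unfolding m1_def m2_def by (rule N.odd_splitting[OF closed[OF n]])
          also have "\<dots> = \<zero>\<^bsub>N\<^esub> \<oplus>\<^bsub>N\<^esub> (?d \<odot>\<^bsub>N\<^esub> m1 \<oplus>\<^bsub>N\<^esub> ?t \<odot>\<^bsub>N\<^esub> m2)"
            using W closed[OF m(1)] closed[OF m(2)] by (simp add: N.smult_closed')
          also have "\<dots> = \<epsilon> (j \<zero>\<^bsub>N\<^esub> \<oplus>\<^bsub>I\<^esub> (?d \<odot>\<^bsub>I\<^esub> j m1 \<oplus>\<^bsub>I\<^esub> ?t \<odot>\<^bsub>I\<^esub> j m2))"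
            using \<epsilon>_gen[OF N.Res_carrier_zero m] by simp
          finally show ?thesis
            using m W j_cl[OF N.Res_carrier_zero] by (auto simp: j_cl I.N.smult_closed')
        qed
      qed
    qed
  qed
  ultimately show ?thesis by (simp add: bij_betw_def)
qed

section \<open>The equivalence\<close>

lemma Ob_Fev_cat: "M \<in> Ob (Fev_cat nubar) \<longleftrightarrow>
    left_module Weyl_ev M \<and> carrier M \<subseteq> Res_carrier nubar M \<and> (\<forall>\<mu>. finitely_spanned M (weight_space M \<mu>))"
  unfolding Fev_cat_def module_category_simps mem_Collect_eq by (rule mem_weight_modules_Weyl_ev)

lemma Ob_F_cat: "M \<in> Ob (F_cat mubar) \<longleftrightarrow>
    left_module Weyl M \<and> carrier M \<subseteq> Res_carrier mubar M \<and> (\<forall>\<mu>. finitely_spanned M (weight_space M \<mu>))"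
  unfolding F_cat_def module_category_simps mem_Collect_eq by (rule mem_weight_modules_Weyl)

lemma cat_simps [simp]:
  "Hom (Fev_cat nubar) = module_hom Weyl_ev"
  "Idn (Fev_cat nubar) M = (\<lambda>x\<in>carrier M. x)"
  "Cmp (Fev_cat nubar) L M N g f = compose (carrier L) g f"
  "Hom (F_cat mubar) = module_hom Weyl"
  "Idn (F_cat mubar) M = (\<lambda>x\<in>carrier M. x)"
  "Cmp (F_cat mubar) L M N g f = compose (carrier L) g f"
  by (simp_all add: Fev_cat_def F_cat_def)

lemma Res_simps [simp]:
  "FOb (Res nubar) N = N\<lparr>carrier := Res_carrier nubar N\<rparr>"
  "FArr (Res nubar) N N' f = restrict f (Res_carrier nubar N)"
  by (simp_all add: Res_def)

lemma functor_simps [simp]: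
  "FOb id_func X = X" "FArr id_func X Y f = f"
  "FOb (comp_func G F) X = FOb G (FOb F X)"
  "FArr (comp_func G F) X Y f = FArr G (FOb F X) (FOb F Y) (FArr F X Y f)"
  by (simp_all add: id_func_def comp_func_def)

lemma is_category_Fev_cat: "is_category (Fev_cat nubar)"
  unfolding Fev_cat_def by (rule is_category_module_category) (auto simp: weight_modules_def)

lemma is_category_F_cat: "is_category (F_cat mubar)"
  unfolding F_cat_def by (rule is_category_module_category) (auto simp: weight_modules_def)

context
  fixes T0 T1 :: "(complex ^ 'n::finite) set"
  assumes split: "parity_split T0 T1"
begin

text \<open>
  Functoriality on arrows is checked on the generating subset \<open>1 \<otimes> M\<close>.
\<close>

lemma is_functor_Ind:
  "is_functor (Fev_cat T0 :: (('n oper, 'u) module, 'u \<Rightarrow> 'u) cat) (F_cat (T0 \<union> T1)) Ind"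
  unfolding is_functor_def
proof (intro conjI ballI)
  fix X :: "('n oper, 'u) module" assume X: "X \<in> Ob (Fev_cat T0)"
  then have mX: "left_module Weyl_ev X" by (simp add: Ob_Fev_cat)
  interpret X: weyl_induced X "FOb Ind X" "Ind_unit X" by (rule weyl_induced_Ind[OF mX])
  show "FOb Ind X \<in> Ob (F_cat (T0 \<union> T1))"
    using X X.N.left_module_axioms X.induced_weight_module[OF split] X.induced_finitely_spanned[OF split]
    by (simp add: Ob_Fev_cat Ob_F_cat)
  have "FArr Ind X X (\<lambda>x\<in>carrier X. x) = (\<lambda>x\<in>carrier (FOb Ind X). x)"
    using Ind_arrow[OF mX mX module_hom_id[OF mX]] module_hom_id[OF X.N.left_module_axioms]
    by (intro X.hom_eqI) (auto simp: X.j_closed)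
  then show "FArr Ind X X (Idn (Fev_cat T0) X) = Idn (F_cat (T0 \<union> T1)) (FOb Ind X)" by simp
  fix Y :: "('n oper, 'u) module" assume Y: "Y \<in> Ob (Fev_cat T0)"
  then have mY: "left_module Weyl_ev Y" by (simp add: Ob_Fev_cat)
  fix f assume f: "f \<in> Hom (Fev_cat T0) X Y"
  then have f: "f \<in> module_hom Weyl_ev X Y" by simp
  show "FArr Ind X Y f \<in> Hom (F_cat (T0 \<union> T1)) (FOb Ind X) (FOb Ind Y)"
    using Ind_arrow(1)[OF mX mY f] by simp
  fix Z :: "('n oper, 'u) module" assume Z: "Z \<in> Ob (Fev_cat T0)"
  then have mZ: "left_module Weyl_ev Z" by (simp add: Ob_Fev_cat)
  fix g assume "g \<in> Hom (Fev_cat T0) Y Z"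
  then have g: "g \<in> module_hom Weyl_ev Y Z" by simp
  note gf = module_hom_compose[OF f g mX]
  have "FArr Ind X Z (compose (carrier X) g f) =
      compose (carrier (FOb Ind X)) (FArr Ind Y Z g) (FArr Ind X Y f)"
    using Ind_arrow[OF mX mY f] Ind_arrow[OF mY mZ g] Ind_arrow[OF mX mZ gf] module_homD(1)[OF f]
    by (intro X.hom_eqI module_hom_compose[OF _ _ X.N.left_module_axioms])
      (auto simp: X.j_closed compose_eq)
  then show "FArr Ind X Z (Cmp (Fev_cat T0) X Y Z g f) =
      Cmp (F_cat (T0 \<union> T1)) (FOb Ind X) (FOb Ind Y) (FOb Ind Z) (FArr Ind Y Z g) (FArr Ind X Y f)"
    by simp
qed

lemma Res_Ob:
  assumes "N \<in> Ob (F_cat (T0 \<union> T1))"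
  shows "N\<lparr>carrier := Res_carrier T0 N\<rparr> \<in> Ob (Fev_cat T0)"
proof -
  interpret N: weyl_module N using assms by (simp add: Ob_F_cat weyl_module_def)
  show ?thesis
    using assms N.Res_left_module[OF split] N.Res_weight_module[OF split] N.Res_finitely_spanned[OF split]
    by (simp add: Ob_Fev_cat Ob_F_cat)
qed

lemma is_functor_Res:
  "is_functor (F_cat (T0 \<union> T1) :: (('n oper, 'u) module, 'u \<Rightarrow> 'u) cat) (Fev_cat T0) (Res T0)"
  unfolding is_functor_def
proof (intro conjI ballI)
  fix X :: "('n oper, 'u) module" assume X: "X \<in> Ob (F_cat (T0 \<union> T1))"
  interpret X: weyl_module X using X by (simp add: Ob_F_cat weyl_module_def)
  have sub: "x \<in> carrier X" if "x \<in> Res_carrier T0 X" for x using X.Res_carrier_closed that by blast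
  show "FOb (Res T0) X \<in> Ob (Fev_cat T0)" using Res_Ob[OF X] by simp
  show "FArr (Res T0) X X (Idn (F_cat (T0 \<union> T1)) X) = Idn (Fev_cat T0) (FOb (Res T0) X)"
    using sub by (auto simp: fun_eq_iff restrict_def)
  fix Y :: "('n oper, 'u) module" assume Y: "Y \<in> Ob (F_cat (T0 \<union> T1))"
  then have mY: "left_module Weyl Y" by (simp add: Ob_F_cat)
  fix f assume f: "f \<in> Hom (F_cat (T0 \<union> T1)) X Y"
  then have fY: "restrict f (Res_carrier T0 X) \<in> module_hom Weyl_ev (X.Res_mod T0) (Y\<lparr>carrier := Res_carrier T0 Y\<rparr>)"
    using X.Res_hom[OF split mY] by simp
  then show "FArr (Res T0) X Y f \<in> Hom (Fev_cat T0) (FOb (Res T0) X) (FOb (Res T0) Y)" by simp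
  have fc: "f x \<in> Res_carrier T0 Y" if "x \<in> Res_carrier T0 X" for x
    using module_homD(1)[OF fY, of x] that by simp
  fix Z g
  show "FArr (Res T0) X Z (Cmp (F_cat (T0 \<union> T1)) X Y Z g f) =
      Cmp (Fev_cat T0) (FOb (Res T0) X) (FOb (Res T0) Y) (FOb (Res T0) Z) (FArr (Res T0) Y Z g) (FArr (Res T0) X Y f)"
    using sub fc by (auto simp: fun_eq_iff restrict_def compose_def)
qed

lemma unit_natural:
  "naturally_isomorphic (Fev_cat T0 :: (('n oper, 'u) module, 'u \<Rightarrow> 'u) cat) (Fev_cat T0)
     id_func (comp_func (Res T0) Ind)"
  unfolding naturally_isomorphic_def
proof (intro exI[of _ "\<lambda>X. restrict (Ind_unit X) (carrier X)"] conjI ballI)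
  fix X :: "('n oper, 'u) module" assume X: "X \<in> Ob (Fev_cat T0)"
  then have mX: "left_module Weyl_ev X" and wX: "carrier X \<subseteq> Res_carrier T0 X"
    by (simp_all add: Ob_Fev_cat)
  interpret X: weyl_induced X "FOb Ind X" "Ind_unit X" by (rule weyl_induced_Ind[OF mX])
  show "is_iso_arrow (Fev_cat T0) (FOb id_func X) (FOb (comp_func (Res T0) Ind) X)
      (restrict (Ind_unit X) (carrier X))"
    using X.unit_iso[OF split wX] by (simp add: Fev_cat_def)
  fix Y :: "('n oper, 'u) module" assume Y: "Y \<in> Ob (Fev_cat T0)"
  then have mY: "left_module Weyl_ev Y" by (simp add: Ob_Fev_cat)
  fix f assume "f \<in> Hom (Fev_cat T0) X Y"
  then have f: "f \<in> module_hom Weyl_ev X Y" by simp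
  have "compose (carrier X) (restrict (Ind_unit Y) (carrier Y)) f =
      compose (carrier X) (restrict (FArr Ind X Y f) (Res_carrier T0 (FOb Ind X))) (restrict (Ind_unit X) (carrier X))"
    unfolding compose_def
  proof (rule restrict_ext)
    fix x assume x: "x \<in> carrier X"
    then have "Ind_unit X x \<in> Res_carrier T0 (FOb Ind X)"
      using wX by (intro X.j_weights(2)) auto
    then show "restrict (Ind_unit Y) (carrier Y) (f x) =
        restrict (FArr Ind X Y f) (Res_carrier T0 (FOb Ind X)) (restrict (Ind_unit X) (carrier X) x)"
      using x module_homD(1)[OF f x] Ind_arrow(2)[OF mX mY f x] by simp
  qed
  then show "Cmp (Fev_cat T0) (FOb id_func X) (FOb id_func Y) (FOb (comp_func (Res T0) Ind) Y)
        (restrict (Ind_unit Y) (carrier Y)) (FArr id_func X Y f) =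
      Cmp (Fev_cat T0) (FOb id_func X) (FOb (comp_func (Res T0) Ind) X) (FOb (comp_func (Res T0) Ind) Y)
        (FArr (comp_func (Res T0) Ind) X Y f) (restrict (Ind_unit X) (carrier X))"
    by simp
qed

text \<open>
  The extension to the induced module of the inclusion of the restriction into \<open>N\<close>.
\<close>

lemma counit_exists:
  assumes N: "(N :: ('n oper, 'u) module) \<in> Ob (F_cat (T0 \<union> T1))"
  shows "\<exists>\<epsilon>\<in>module_hom Weyl (FOb Ind (FOb (Res T0) N)) N.
    \<forall>m\<in>Res_carrier T0 N. \<epsilon> (Ind_unit (FOb (Res T0) N) m) = m"
proof -
  interpret N: weyl_module N using N by (simp add: Ob_F_cat weyl_module_def)
  interpret R: weyl_induced "N.Res_mod T0" "FOb Ind (N.Res_mod T0)" "Ind_unit (N.Res_mod T0)"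
    by (rule weyl_induced_Ind[OF N.Res_left_module[OF split]])
  have "a \<odot>\<^bsub>N\<^esub> x \<in> Res_carrier T0 N" if "a \<in> even_ops" "x \<in> Res_carrier T0 N" for a x
    using that parity_split.Q_stable[OF split] by (intro N.Res_carrier_even_smult)
  then have "(\<lambda>x\<in>Res_carrier T0 N. x) \<in> module_hom Weyl_ev (N.Res_mod T0) N"
    using N.Res_carrier_closed by (auto simp: module_hom_def N.Res_carrier_add)
  from R.hom_extension[OF N.left_module_axioms this] obtain g
    where "g \<in> module_hom Weyl (FOb Ind (N.Res_mod T0)) N"
      "\<And>m. m \<in> Res_carrier T0 N \<Longrightarrow> g (Ind_unit (N.Res_mod T0) m) = m" by auto
  then show ?thesis by auto
qed

lemma counit_natural:
  "naturally_isomorphic (F_cat (T0 \<union> T1) :: (('n oper, 'u) module, 'u \<Rightarrow> 'u) cat) (F_cat (T0 \<union> T1))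
     (comp_func Ind (Res T0)) id_func"
proof -
  define \<epsilon> :: "('n oper, 'u) module \<Rightarrow> 'u \<Rightarrow> 'u" where
    "\<epsilon> N = (SOME \<epsilon>. \<epsilon> \<in> module_hom Weyl (FOb Ind (FOb (Res T0) N)) N \<and>
      (\<forall>m\<in>Res_carrier T0 N. \<epsilon> (Ind_unit (FOb (Res T0) N) m) = m))" for N
  have \<epsilon>: "\<epsilon> N \<in> module_hom Weyl (FOb Ind (FOb (Res T0) N)) N"
      "\<And>m. m \<in> Res_carrier T0 N \<Longrightarrow> \<epsilon> N (Ind_unit (FOb (Res T0) N) m) = m"
    if "N \<in> Ob (F_cat (T0 \<union> T1))" for N :: "('n oper, 'u) module"
    using someI_ex[OF counit_exists[OF that, unfolded Bex_def]] unfolding \<epsilon>_def by blast+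
  show ?thesis
    unfolding naturally_isomorphic_def
  proof (intro exI[of _ \<epsilon>] conjI ballI)
    fix X :: "('n oper, 'u) module" assume X: "X \<in> Ob (F_cat (T0 \<union> T1))"
    then have mX: "left_module Weyl X" and wX: "carrier X \<subseteq> Res_carrier (T0 \<union> T1) X"
      by (simp_all add: Ob_F_cat)
    interpret X: weyl_module X using mX by (simp add: weyl_module_def)
    note RX = X.Res_left_module[OF split]
    interpret R: weyl_induced "X.Res_mod T0" "FOb Ind (X.Res_mod T0)" "Ind_unit (X.Res_mod T0)"
      by (rule weyl_induced_Ind[OF RX])
    have bij: "bij_betw (\<epsilon> X) (carrier (FOb Ind (X.Res_mod T0))) (carrier X)"
      using \<epsilon>[OF X] by (intro counit_bij[OF split mX wX R.weyl_induced_axioms]) auto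
    show "is_iso_arrow (F_cat (T0 \<union> T1)) (FOb (comp_func Ind (Res T0)) X) (FOb id_func X) (\<epsilon> X)"
      using module_iso_arrow[OF R.N.left_module_axioms mX _ bij] \<epsilon>[OF X] by (simp add: F_cat_def)
    fix Y :: "('n oper, 'u) module" assume Y: "Y \<in> Ob (F_cat (T0 \<union> T1))"
    then have mY: "left_module Weyl Y" by (simp add: Ob_F_cat)
    interpret Y: weyl_module Y using mY by (simp add: weyl_module_def)
    note RY = Y.Res_left_module[OF split]
    fix f assume "f \<in> Hom (F_cat (T0 \<union> T1)) X Y"
    then have f: "f \<in> module_hom Weyl X Y" by simp
    let ?Rf = "restrict f (Res_carrier T0 X)"
    note Rf = X.Res_hom[OF split mY f]
    have "compose (carrier (FOb Ind (X.Res_mod T0))) (\<epsilon> Y) (FArr Ind (X.Res_mod T0) (Y.Res_mod T0) ?Rf) =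
        compose (carrier (FOb Ind (X.Res_mod T0))) f (\<epsilon> X)"
    proof (rule R.hom_eqI)
      show "compose (carrier (FOb Ind (X.Res_mod T0))) (\<epsilon> Y) (FArr Ind (X.Res_mod T0) (Y.Res_mod T0) ?Rf)
          \<in> module_hom Weyl (FOb Ind (X.Res_mod T0)) Y"
        using \<epsilon>(1)[OF Y] by (intro module_hom_compose[OF Ind_arrow(1)[OF RX RY Rf] _ R.N.left_module_axioms]) simp
      show "compose (carrier (FOb Ind (X.Res_mod T0))) f (\<epsilon> X) \<in> module_hom Weyl (FOb Ind (X.Res_mod T0)) Y"
        using \<epsilon>(1)[OF X] by (intro module_hom_compose[OF _ f R.N.left_module_axioms]) simp
      fix m assume m: "m \<in> carrier (X.Res_mod T0)"
      have "?Rf m \<in> Res_carrier T0 Y" using module_homD(1)[OF Rf m] by simp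
      then show "compose (carrier (FOb Ind (X.Res_mod T0))) (\<epsilon> Y) (FArr Ind (X.Res_mod T0) (Y.Res_mod T0) ?Rf)
            (Ind_unit (X.Res_mod T0) m) =
          compose (carrier (FOb Ind (X.Res_mod T0))) f (\<epsilon> X) (Ind_unit (X.Res_mod T0) m)"
        using m \<epsilon>(2)[OF X, of m] \<epsilon>(2)[OF Y, of "?Rf m"] R.j_closed[OF m] Ind_arrow(2)[OF RX RY Rf m]
        by (simp add: compose_eq)
    qed
    then show "Cmp (F_cat (T0 \<union> T1)) (FOb (comp_func Ind (Res T0)) X) (FOb (comp_func Ind (Res T0)) Y) (FOb id_func Y)
          (\<epsilon> Y) (FArr (comp_func Ind (Res T0)) X Y f) =
        Cmp (F_cat (T0 \<union> T1)) (FOb (comp_func Ind (Res T0)) X) (FOb id_func X) (FOb id_func Y)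
          (FArr id_func X Y f) (\<epsilon> X)"
      by simp
  qed
qed

end

theorem lemma3p1:
  fixes nubar :: "(complex ^ 'n::finite) set"
  assumes "nubar \<in> coset_space Q_lattice"
  shows "establish_equivalence
           (Fev_cat nubar :: (('n oper, 'u) module, 'u \<Rightarrow> 'u) cat)
           (F_cat (coset_projection nubar) :: (('n oper, 'u) module, 'u \<Rightarrow> 'u) cat)
           Ind (Res nubar)"
proof -
  note split = coset_parity_split(1)[OF assms]
  have "nubar \<union> (coset_projection nubar - nubar) = coset_projection nubar"
    using coset_parity_split(2)[OF assms] by blast
  then show ?thesis
    using is_functor_Ind[OF split] is_functor_Res[OF split]
      unit_natural[OF split] counit_natural[OF split]
    by (simp add: establish_equivalence_def is_category_Fev_cat is_category_F_cat)
qed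

end
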